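(* Let $\Phi$ be an irreducible root system of rank $n$ with Cartan matrix $C$. Then $\mathcal{V}^\Phi=\{V_J^\Phi(\mathbf{x}):J\subseteq[n]\}$ is a basis of the real vector space $\Delta(C)$, and $\dim_\mathbb{R}\Delta(C)=2^n$. In particular, $\Delta(C)$ is graded, $\sum_d\dim_\mathbb{R}\Delta(C)_d\,z^d=(1+z)^n$, and for each $d$ the set $\{V_J^\Phi:|J|=d\}$ is a basis of $\Delta(C)_d$.
   Context: Let $E$ be the real Euclidean space spanned by $\Phi$, $\alpha_1,\dots,\alpha_n$ simple roots, $\alpha^\vee=2\alpha/\langle\alpha,\alpha\rangle$, $\varpi_1,\dots,\varpi_n$ the fundamental weights ($\langle\varpi_i,\alpha_j^\vee\rangle=\delta_{ij}$), and $C=(C_{ij})$, $C_{ij}=\langle\alpha_i,\alpha_j^\vee\rangle$, so its $i$-th row gives the coordinates of $\alpha_i$ in the basis $(\varpi_j)$. Let $W$ be the Weyl group with simple reflections $s_j$, and for $J\subseteq[n]$ let $W_J=\langle s_j:j\in J\rangle$ and $\Pi_{W_J}(\lambda)=\mathrm{conv}\{w\lambda:w\in W_J\}$. $V_J^\Phi(\mathbf{x})\in\mathbb{R}[x_j:j\in J]$ is the homogeneous polynomial of degree $|J|$ such that for all $\lambda_1,\dots,\lambda_n\ge0$, $V_J^\Phi(\lambda)$ equals the $|J|$-dimensional volume of $\Pi_{W_J}(\sum_i\lambda_i\varpi_i)$, normalized on its affine span $L$ so that the lattice $\Lambda\cap(L-L)$ has covolume $1$, where $\Lambda=\bigoplus_i\mathbb{Z}\varpi_i$;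 $V_\emptyset^\Phi=1$. For $M\in M_n(\mathbb{R})$ with rows $M_i$, $\Delta(M)=\bigcap_{i=1}^n\{p\in\mathbb{R}[\mathbf{x}]:\frac{\partial}{\partial x_i}(p(\mathbf{x}-M_i)-p(\mathbf{x}))=0\}$, with $\mathbf{x}-M_i=(x_1-M_{i1},\dots,x_n-M_{in})$. Graded means containing the homogeneous components of each element; $\Delta(C)_d$ is the subspace of homogeneous degree-$d$ elements. *)

theory Defs
  imports
    "HOL-Analysis.Analysis"
    "HOL-Analysis.Finite_Function_Topology"
    "HOL-Algebra.Bij"
    "HOL-Algebra.Generated_Groups"
    "HOL-Computational_Algebra.Formal_Power_Series"
begin

section \<open>Real polynomials in the variables \<open>x\<^sub>i\<close>, \<open>i\<close> ranging over a finite type\<close>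

text \<open>
  The ring \<open>\<real>[x\<^sub>i]\<close> is the monoid algebra of the monoid of exponent vectors; its ring structure
  is that of \<^theory>\<open>HOL-Library.Poly_Mapping\<close>, and its real vector space structure that of
  \<^theory>\<open>HOL-Analysis.Finite_Function_Topology\<close>.
\<close>

type_synonym 'n rpoly = "('n \<Rightarrow>\<^sub>0 nat) \<Rightarrow>\<^sub>0 real"

definition pconst :: "real \<Rightarrow> 'n rpoly"
  where "pconst c = Poly_Mapping.single 0 c"

definition pvar :: "'n \<Rightarrow> 'n rpoly"
  where "pvar i = Poly_Mapping.single (Poly_Mapping.single i 1) 1"

definition peval :: "'n::finite rpoly \<Rightarrow> real ^ 'n \<Rightarrow> real"
  where "peval p x = (\<Sum>m\<in>Poly_Mapping.keys p.
           Poly_Mapping.lookup p m * (\<Prod>i\<in>UNIV. (x $ i) ^ Poly_Mapping.lookup m i))"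

definition psubst :: "('n::finite \<Rightarrow> 'n rpoly) \<Rightarrow> 'n rpoly \<Rightarrow> 'n rpoly"
  where "psubst \<sigma> p = (\<Sum>m\<in>Poly_Mapping.keys p.
           pconst (Poly_Mapping.lookup p m) * (\<Prod>i\<in>UNIV. \<sigma> i ^ Poly_Mapping.lookup m i))"

definition pshift :: "real ^ 'n \<Rightarrow> 'n::finite rpoly \<Rightarrow> 'n rpoly"
  where "pshift v p = psubst (\<lambda>i. pvar i - pconst (v $ i)) p"

definition pdiff :: "'n \<Rightarrow> 'n rpoly \<Rightarrow> 'n rpoly"
  where "pdiff i p = (\<Sum>m\<in>Poly_Mapping.keys p.
           Poly_Mapping.single (m - Poly_Mapping.single i 1)
             (real (Poly_Mapping.lookup m i) * Poly_Mapping.lookup p m))"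

definition mdeg :: "('n::finite \<Rightarrow>\<^sub>0 nat) \<Rightarrow> nat"
  where "mdeg m = (\<Sum>i\<in>UNIV. Poly_Mapping.lookup m i)"

definition pvars :: "'n rpoly \<Rightarrow> 'n set"
  where "pvars p = (\<Union>m\<in>Poly_Mapping.keys p. Poly_Mapping.keys m)"

definition homogeneous :: "nat \<Rightarrow> 'n::finite rpoly \<Rightarrow> bool"
  where "homogeneous d p \<longleftrightarrow> (\<forall>m\<in>Poly_Mapping.keys p. mdeg m = d)"

definition hom_component :: "nat \<Rightarrow> 'n::finite rpoly \<Rightarrow> 'n rpoly"
  where "hom_component d p = (\<Sum>m\<in>{m \<in> Poly_Mapping.keys p. mdeg m = d}.
           Poly_Mapping.single m (Poly_Mapping.lookup p m))"

definition graded :: "'n::finite rpoly set \<Rightarrow> bool"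
  where "graded S \<longleftrightarrow> (\<forall>p\<in>S. \<forall>d. hom_component d p \<in> S)"

definition graded_part :: "'n::finite rpoly set \<Rightarrow> nat \<Rightarrow> 'n rpoly set"
  where "graded_part S d = {p \<in> S. homogeneous d p}"

definition is_basis_of :: "'v::real_vector set \<Rightarrow> 'v set \<Rightarrow> bool"
  where "is_basis_of B S \<longleftrightarrow> B \<subseteq> S \<and> independent B \<and> span B = S"

definition Delta :: "real ^ 'n ^ 'n \<Rightarrow> 'n::finite rpoly set"
  where "Delta M = (\<Inter>i. {p. pdiff i (pshift (M $ i) p - p) = 0})"


section \<open>Root systems\<close>

definition coroot :: "'a::real_inner \<Rightarrow> 'a"
  where "coroot \<alpha> = (2 / (\<alpha> \<bullet> \<alpha>)) *\<^sub>R \<alpha>"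

definition refl_along :: "'a::real_inner \<Rightarrow> 'a \<Rightarrow> 'a"
  where "refl_along \<alpha> v = v - (v \<bullet> coroot \<alpha>) *\<^sub>R \<alpha>"

text \<open>Root systems are crystallographic and reduced, as usual in the presence of a Cartan matrix.\<close>

definition root_system :: "'a::euclidean_space set \<Rightarrow> bool"
  where "root_system \<Phi> \<longleftrightarrow>
    finite \<Phi> \<and> 0 \<notin> \<Phi> \<and> span \<Phi> = UNIV \<and>
    (\<forall>\<alpha>\<in>\<Phi>. refl_along \<alpha> ` \<Phi> = \<Phi>) \<and>
    (\<forall>\<alpha>\<in>\<Phi>. \<forall>\<beta>\<in>\<Phi>. \<beta> \<bullet> coroot \<alpha> \<in> \<int>) \<and>
    (\<forall>\<alpha>\<in>\<Phi>. \<forall>c. c *\<^sub>R \<alpha> \<in> \<Phi> \<longrightarrow> c = 1 \<or> c = -1)"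

definition irreducible_root_system :: "'a::euclidean_space set \<Rightarrow> bool"
  where "irreducible_root_system \<Phi> \<longleftrightarrow>
    root_system \<Phi> \<and> \<Phi> \<noteq> {} \<and>
    \<not> (\<exists>A B. A \<noteq> {} \<and> B \<noteq> {} \<and> A \<inter> B = {} \<and> A \<union> B = \<Phi> \<and> (\<forall>\<alpha>\<in>A. \<forall>\<beta>\<in>B. \<alpha> \<bullet> \<beta> = 0))"

definition simple_roots :: "'a::euclidean_space set \<Rightarrow> ('n::finite \<Rightarrow> 'a) \<Rightarrow> bool"
  where "simple_roots \<Phi> \<alpha> \<longleftrightarrow>
    inj \<alpha> \<and> range \<alpha> \<subseteq> \<Phi> \<and> is_basis_of (range \<alpha>) UNIV \<and>
    (\<forall>\<beta>\<in>\<Phi>. \<exists>c::'n \<Rightarrow> nat. \<beta> = (\<Sum>i\<in>UNIV. real (c i) *\<^sub>R \<alpha> i) \<or>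
                           \<beta> = - (\<Sum>i\<in>UNIV. real (c i) *\<^sub>R \<alpha> i))"

definition cartan_matrix :: "('n::finite \<Rightarrow> 'a::euclidean_space) \<Rightarrow> real ^ 'n ^ 'n"
  where "cartan_matrix \<alpha> = (\<chi> i j. \<alpha> i \<bullet> coroot (\<alpha> j))"

definition fund_weight :: "('n::finite \<Rightarrow> 'a::euclidean_space) \<Rightarrow> 'n \<Rightarrow> 'a"
  where "fund_weight \<alpha> i = (THE w. \<forall>j. w \<bullet> coroot (\<alpha> j) = (if i = j then 1 else 0))"

definition weight :: "('n::finite \<Rightarrow> 'a::euclidean_space) \<Rightarrow> real ^ 'n \<Rightarrow> 'a"
  where "weight \<alpha> l = (\<Sum>i\<in>UNIV. (l $ i) *\<^sub>R fund_weight \<alpha> i)"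

definition weight_lattice :: "('n::finite \<Rightarrow> 'a::euclidean_space) \<Rightarrow> 'a set"
  where "weight_lattice \<alpha> = range (\<lambda>c::'n \<Rightarrow> int. \<Sum>i\<in>UNIV. of_int (c i) *\<^sub>R fund_weight \<alpha> i)"

definition parabolic :: "('n::finite \<Rightarrow> 'a::euclidean_space) \<Rightarrow> 'n set \<Rightarrow> ('a \<Rightarrow> 'a) set"
  where "parabolic \<alpha> J = generate (BijGroup UNIV) ((\<lambda>j. refl_along (\<alpha> j)) ` J)"

definition weight_polytope :: "('n::finite \<Rightarrow> 'a::euclidean_space) \<Rightarrow> 'n set \<Rightarrow> 'a \<Rightarrow> 'a set"
  where "weight_polytope \<alpha> J \<mu> = convex hull ((\<lambda>w. w \<mu>) ` parabolic \<alpha> J)"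


section \<open>Volume normalized by a lattice\<close>

definition lattice_basis :: "'a::real_vector set \<Rightarrow> 'a set \<Rightarrow> bool"
  where "lattice_basis G B \<longleftrightarrow> finite B \<and> independent B \<and>
           G = range (\<lambda>c::'a \<Rightarrow> int. \<Sum>b\<in>B. of_int (c b) *\<^sub>R b)"

definition direction_space :: "'a::euclidean_space set \<Rightarrow> 'a set"
  where "direction_space P = {x - y | x y. x \<in> affine hull P \<and> y \<in> affine hull P}"

text \<open>
  The \<open>k\<close>-dimensional volume of \<open>P\<close>, normalized on the affine span \<open>L\<close> of \<open>P\<close> so that the lattice
  \<open>\<Lambda> \<inter> (L - L)\<close> has covolume \<open>1\<close>: Lebesgue measure in the coordinates given by an origin in \<open>P\<close> and
  a \<open>\<int>\<close>-basis \<open>B\<close> of that lattice. A change of origin translates, and a change of \<open>\<int>\<close>-basis is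
  unimodular, so the choices do not matter. The volume is \<open>0\<close> if \<open>P\<close> has dimension less than \<open>k\<close>, and
  \<open>1\<close> if \<open>k = 0\<close> and \<open>P\<close> is a point.
\<close>

definition lattice_volume :: "'a::euclidean_space set \<Rightarrow> nat \<Rightarrow> 'a set \<Rightarrow> real"
  where "lattice_volume \<Lambda> k P =
    (if aff_dim P = int k then
       (let B = (SOME B. lattice_basis (\<Lambda> \<inter> direction_space P) B);
            a = (SOME a. a \<in> P)
        in measure (Pi\<^sub>M B (\<lambda>_. lborel))
             {c \<in> Pi\<^sub>E B (\<lambda>_. UNIV). a + (\<Sum>b\<in>B. c b *\<^sub>R b) \<in> P})
     else 0)"

text \<open>A polynomial is determined by its values on the nonnegative orthant, so there is at most one such \<open>p\<close>.\<close>

definition vol_poly :: "('n::finite \<Rightarrow> 'a::euclidean_space) \<Rightarrow> 'n set \<Rightarrow> 'n rpoly"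
  where "vol_poly \<alpha> J = (THE p. pvars p \<subseteq> J \<and> homogeneous (card J) p \<and>
           (\<forall>l. (\<forall>i. 0 \<le> l $ i) \<longrightarrow>
              peval p l = lattice_volume (weight_lattice \<alpha>) (card J) (weight_polytope \<alpha> J (weight \<alpha> l))))"

end

theory Submission
  imports Defs
begin

text \<open>
  For a polynomial the defining condition of \<open>\<Delta>(C)\<close> says that \<open>\<partial>\<^sub>i p\<close> is periodic, hence constant, in the
  direction \<open>\<alpha>\<^sub>i\<close>; so \<open>\<Delta>(C)\<close> is cut out by the operators \<open>\<partial>\<^sub>i D\<^sub>i\<close> with \<open>D\<^sub>i = \<Sum>\<^sub>j C\<^sub>i\<^sub>j \<partial>\<^sub>j\<close>. Since all principal
  minors of \<open>C\<close> are invertible, an element of \<open>\<Delta>(C)\<close> is determined by its square-free coefficients.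
  The recursion \<open>|J| V\<^sub>J(\<lambda>) = \<Sum>\<^sub>i m\<^sub>i V\<^bsub>J - i\<^esub>(\<lambda>)\<close>, where \<open>\<lambda> = \<Sum>\<^sub>i m\<^sub>i \<alpha>\<^sub>i\<close> on \<open>J\<close>, defines homogeneous polynomials with
  \<open>D\<^sub>i V\<^sub>J = V\<^bsub>J - i\<^esub>\<close>. They lie in \<open>\<Delta>(C)\<close>, and the only square-free monomial of \<open>V\<^sub>J\<close> is \<open>x\<^bsup>J\<^esup>\<close>; hence they form
  a basis.

  It remains to see that \<open>V\<^sub>J\<close> is the volume up to a nonzero factor. The weight polytope of a dominant
  \<open>\<lambda>\<close> is tiled by the \<open>W\<^sub>J\<close>-translates of its dominant part, which is the set of all dominant \<open>\<lambda> - y\<close>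
  with \<open>y\<close> in the cone over the simple roots. By Fubini, and because \<open>\<langle>\<alpha>\<^sub>i, \<alpha>\<^sub>j\<rangle> \<le> 0\<close> for \<open>i \<noteq> j\<close>, the volume of
  this set also satisfies \<open>D\<^sub>i G\<^sub>J = G\<^bsub>J - i\<^esub>\<close>. So \<open>G\<^sub>J - V\<^sub>J\<close> is locally constant and homogeneous of positive
  degree, hence zero. Passing from root coordinates to a lattice basis changes the volume only by a constant,
  by uniqueness of translation-invariant measures.
\<close>


section \<open>Polynomials and their derivatives\<close>

text \<open>Rescaling keeps a basis a basis, so it is enough that volume and \<open>vpoly J\<close>
  differ by one nonzero constant for each J, fixed before the weight. Covolumes and determinants
  therefore enter only as proportionality factors of measures. The obstacle is that the polytope
  volume is not known in advance to be polynomial or even differentiable, and that moving the weight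
  moves all facets at once. Its dominant part, described by the differences y, is better behaved:
  the slice at height t over a simple root depends on the weight only after t times that root has
  been subtracted. Adding s times the root to the weight thus keeps all old slices and adds those of
  height between 0 and s. The induction hypothesis evaluates the new slices only at nonnegative
  coordinates, so every comparison has to move inside the nonnegative orthant, by short steps. The
  recursion for the polynomials is forced: it is Euler's identity with the point expanded in the
  rows of C and the wanted derivatives inserted.\<close>

abbreviation lk :: "('a \<Rightarrow>\<^sub>0 'b::zero) \<Rightarrow> 'a \<Rightarrow> 'b" where "lk \<equiv> Poly_Mapping.lookup"
abbreviation sg :: "'a \<Rightarrow> 'b::zero \<Rightarrow> ('a \<Rightarrow>\<^sub>0 'b)" where "sg \<equiv> Poly_Mapping.single"

section \<open>Evaluation of polynomials at real points\<close>

definition monom_eval :: "real ^ 'n \<Rightarrow> ('n::finite \<Rightarrow>\<^sub>0 nat) \<Rightarrow> real"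
  where "monom_eval x m = (\<Prod>i\<in>UNIV. (x $ i) ^ lk m i)"

lemma monom_eval_0 [simp]: "monom_eval x 0 = 1"
  by (simp add: monom_eval_def)

lemma monom_eval_add: "monom_eval x (m + k) = monom_eval x m * monom_eval x k"
  by (simp add: monom_eval_def lookup_add power_add prod.distrib)

lemma monom_eval_single: "monom_eval x (sg i n) = (x $ i) ^ n"
proof -
  have "monom_eval x (sg i n) = (\<Prod>j\<in>UNIV. if j = i then (x $ i) ^ n else 1)"
    unfolding monom_eval_def by (rule prod.cong) (auto simp: lookup_single when_def)
  then show ?thesis by simp
qed

lemma monom_eval_scaleR: "monom_eval (s *\<^sub>R x) m = s ^ mdeg m * monom_eval x m"
  by (simp add: monom_eval_def mdeg_def power_mult_distrib prod.distrib power_sum)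

lemma peval_superset:
  assumes "finite S" "Poly_Mapping.keys p \<subseteq> S"
  shows "peval p x = (\<Sum>m\<in>S. lk p m * monom_eval x m)"
  unfolding peval_def monom_eval_def
  by (rule sum.mono_neutral_left) (use assms in \<open>auto simp: in_keys_iff\<close>)

lemma peval_zero [simp]: "peval 0 x = 0"
  by (simp add: peval_def)

lemma peval_add: "peval (p + q) x = peval p x + peval q x"
proof -
  let ?S = "Poly_Mapping.keys p \<union> Poly_Mapping.keys q"
  have "Poly_Mapping.keys (p + q) \<subseteq> ?S" by (rule keys_add)
  then show ?thesis
    by (simp add: peval_superset[of ?S] lookup_add algebra_simps sum.distrib)
qed

lemma peval_uminus: "peval (- p) x = - peval p x"
  using peval_add[of p "- p" x] by simp

lemma peval_diff: "peval (p - q) x = peval p x - peval q x"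
  using peval_add[of p "- q" x] by (simp add: peval_uminus)

lemma peval_sum: "peval (\<Sum>i\<in>I. f i) x = (\<Sum>i\<in>I. peval (f i) x)"
  by (induction I rule: infinite_finite_induct) (auto simp: peval_add)

lemma peval_single: "peval (sg m c) x = c * monom_eval x m"
  by (subst peval_superset[of "{m}"]) (auto simp: lookup_single split: if_splits)

lemma sum_single_lookup: "(\<Sum>m\<in>Poly_Mapping.keys p. sg m (lk p m)) = p"
proof (rule poly_mapping_eqI)
  fix k
  have "lk (\<Sum>m\<in>Poly_Mapping.keys p. sg m (lk p m)) k
      = (\<Sum>m\<in>Poly_Mapping.keys p. if m = k then lk p k else 0)"
    unfolding lookup_sum by (rule sum.cong) (auto simp: lookup_single when_def)
  also have "\<dots> = lk p k" by (auto simp: in_keys_iff)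
  finally show "lk (\<Sum>m\<in>Poly_Mapping.keys p. sg m (lk p m)) k = lk p k" .
qed

lemma peval_mult: "peval (p * q) x = peval p x * peval q x"
proof -
  have "p * q = (\<Sum>m\<in>Poly_Mapping.keys p. \<Sum>k\<in>Poly_Mapping.keys q. sg (m + k) (lk p m * lk q k))"
    by (subst (1 2) sum_single_lookup[symmetric]) (simp only: sum_product mult_single)
  then have "peval (p * q) x = (\<Sum>m\<in>Poly_Mapping.keys p. \<Sum>k\<in>Poly_Mapping.keys q.
      (lk p m * monom_eval x m) * (lk q k * monom_eval x k))"
    by (simp add: peval_sum peval_single monom_eval_add algebra_simps)
  then show ?thesis
    by (simp add: sum_product peval_def monom_eval_def)
qed

lemma peval_pconst [simp]: "peval (pconst c) x = c"
  by (simp add: pconst_def peval_single)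

lemma peval_pvar [simp]: "peval (pvar i) x = x $ i"
  by (simp add: pvar_def peval_single monom_eval_single)

lemma peval_one [simp]: "peval 1 x = 1"
  using peval_single[of 0 1 x] by simp

lemma peval_power: "peval (p ^ n) x = peval p x ^ n"
  by (induction n) (auto simp: peval_mult)

lemma peval_prod: "peval (\<Prod>i\<in>I. f i) x = (\<Prod>i\<in>I. peval (f i) x)"
  by (induction I rule: infinite_finite_induct) (auto simp: peval_mult)

lemma lookup_scaleR: "lk (c *\<^sub>R (p :: 'n rpoly)) m = c * lk p m"
proof -
  have "finite {i. c *\<^sub>R lk p i \<noteq> 0}"
    by (rule finite_subset[of _ "Poly_Mapping.keys p"]) (auto simp: in_keys_iff)
  then show ?thesis by (simp add: scaleR_poly_mapping_def)
qed

lemma keys_scaleR: "Poly_Mapping.keys (c *\<^sub>R (p :: 'n rpoly)) \<subseteq> Poly_Mapping.keys p"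
  by (auto simp: in_keys_iff lookup_scaleR)

lemma peval_scaleR: "peval (c *\<^sub>R p) x = c * peval p x"
  by (subst (1 2) peval_superset[of "Poly_Mapping.keys p"])
     (auto simp: keys_scaleR lookup_scaleR sum_distrib_left algebra_simps)

lemma peval_pshift: "peval (pshift v p) x = peval p (x - v)"
  unfolding pshift_def psubst_def
  by (simp add: peval_sum peval_mult peval_prod peval_power peval_diff)
     (simp add: peval_def)

section \<open>Coefficients and values of derivatives\<close>

lemma lookup_pdiff: "lk (pdiff i p) m = real (lk m i + 1) * lk p (m + sg i 1)"
proof -
  let ?K = "Poly_Mapping.keys p"
  \<comment> \<open>Exponent subtraction truncates at zero, so a key without \<open>i\<close> is
    also sent somewhere; the condition on \<open>lk k i\<close> discards it, and at most one key
    contributes to each coefficient.\<close>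
  have *: "(lk k i \<noteq> 0 \<and> k - sg i 1 = m) \<longleftrightarrow> k = m + sg i 1" for k
  proof
    assume a: "lk k i \<noteq> 0 \<and> k - sg i 1 = m"
    show "k = m + sg i 1"
    proof (rule poly_mapping_eqI)
      fix j
      have "lk m j = lk k j - lk (sg i 1) j" using a by (auto simp: lookup_minus)
      then show "lk k j = lk (m + sg i 1) j" using a
        by (auto simp: lookup_add lookup_single when_def split: if_splits)
    qed
  qed (auto simp: lookup_add)
  have "lk (pdiff i p) m
      = (\<Sum>k\<in>?K. if k = m + sg i 1 then real (lk m i + 1) * lk p (m + sg i 1) else 0)"
    unfolding pdiff_def lookup_sum
  proof (rule sum.cong)
    fix k assume "k \<in> ?K"
    show "lk (sg (k - sg i 1) (real (lk k i) * lk p k)) m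
      = (if k = m + sg i 1 then real (lk m i + 1) * lk p (m + sg i 1) else 0)"
      using *[of k] by (auto simp: lookup_single when_def lookup_add)
  qed simp
  also have "\<dots> = real (lk m i + 1) * lk p (m + sg i 1)" by (auto simp: in_keys_iff)
  finally show ?thesis .
qed

lemma pdiff_add: "pdiff i (p + q) = pdiff i p + pdiff i q"
  by (rule poly_mapping_eqI) (simp add: lookup_pdiff lookup_add algebra_simps)

lemma pdiff_diff: "pdiff i (p - q) = pdiff i p - pdiff i q"
  by (rule poly_mapping_eqI) (simp add: lookup_pdiff lookup_minus algebra_simps)

lemma pdiff_scaleR: "pdiff i (c *\<^sub>R p) = c *\<^sub>R pdiff i p"
  by (rule poly_mapping_eqI) (simp add: lookup_pdiff lookup_scaleR)

lemma pdiff_zero [simp]: "pdiff i 0 = 0"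
  by (rule poly_mapping_eqI) (simp add: lookup_pdiff)

lemma pdiff_sum: "pdiff i (\<Sum>j\<in>I. f j) = (\<Sum>j\<in>I. pdiff i (f j))"
  by (induction I rule: infinite_finite_induct) (auto simp: pdiff_add)

lemma pdiff_commute: "pdiff i (pdiff j p) = pdiff j (pdiff i p)"
  by (rule poly_mapping_eqI)
     (auto simp: lookup_pdiff lookup_add lookup_single when_def add_ac)

lemma pdiff_single: "pdiff i (sg m c) = sg (m - sg i 1) (real (lk m i) * c)"
  by (cases "c = 0") (auto simp: pdiff_def)

lemma monom_eval_has_derivative:
  "((\<lambda>s. monom_eval (x + s *\<^sub>R v) m) has_real_derivative
     (\<Sum>i\<in>UNIV. v $ i * peval (pdiff i (sg m 1)) (x + s *\<^sub>R v))) (at s)"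
proof -
  have "((\<lambda>s. \<Prod>i\<in>UNIV. (x $ i + s * v $ i) ^ lk m i) has_real_derivative
     (\<Sum>i\<in>UNIV. (of_nat (lk m i) * v $ i * (x $ i + s * v $ i) ^ (lk m i - 1)) *
        (\<Prod>j\<in>UNIV - {i}. (x $ j + s * v $ j) ^ lk m j))) (at s)"
    by (rule has_field_derivative_prod) (auto intro!: derivative_eq_intros)
  moreover have "of_nat (lk m i) * v $ i * (x $ i + s * v $ i) ^ (lk m i - 1) *
        (\<Prod>j\<in>UNIV - {i}. (x $ j + s * v $ j) ^ lk m j)
      = v $ i * peval (pdiff i (sg m 1)) (x + s *\<^sub>R v)" for i
  proof -
    have "monom_eval (x + s *\<^sub>R v) (m - sg i 1) = (x $ i + s * v $ i) ^ (lk m i - 1) *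
        (\<Prod>j\<in>UNIV - {i}. (x $ j + s * v $ j) ^ lk m j)"
      unfolding monom_eval_def
      by (subst prod.remove[of _ i])
         (auto simp: lookup_minus lookup_single when_def intro!: prod.cong)
    then show ?thesis by (simp add: pdiff_single peval_single)
  qed
  ultimately show ?thesis
    by (simp only: monom_eval_def vector_add_component vector_scaleR_component real_scaleR_def)
qed

text \<open>The directional derivative along \<open>v\<close>, kept inside the polynomial ring. For
  \<open>v\<close> a row of the matrix it is the operator D of the overview.\<close>

definition pdir :: "real ^ 'n \<Rightarrow> 'n::finite rpoly \<Rightarrow> 'n rpoly"
  where "pdir v p = (\<Sum>i\<in>UNIV. v $ i *\<^sub>R pdiff i p)"

lemma peval_pdir: "peval (pdir v p) x = (\<Sum>i\<in>UNIV. v $ i * peval (pdiff i p) x)"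
  by (simp add: pdir_def peval_sum peval_scaleR)

lemma pdir_axis: "pdir (axis i 1) p = pdiff i p"
proof -
  have "pdir (axis i 1) p = (\<Sum>j\<in>UNIV. if j = i then pdiff i p else 0)"
    unfolding pdir_def by (rule sum.cong) (auto simp: axis_def)
  then show ?thesis by simp
qed

text \<open>The bridge from formal to analytic derivatives: the product rule, Euler's identity and
  the commutation with shifts are all read off from uniqueness of the analytic derivative.\<close>

lemma peval_has_derivative:
  "((\<lambda>s. peval p (x + s *\<^sub>R v)) has_real_derivative peval (pdir v p) (x + s *\<^sub>R v)) (at s)"
proof -
  let ?K = "Poly_Mapping.keys p" and ?y = "x + s *\<^sub>R v"
  have "((\<lambda>s. \<Sum>m\<in>?K. lk p m * monom_eval (x + s *\<^sub>R v) m) has_real_derivative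
      (\<Sum>m\<in>?K. lk p m * (\<Sum>i\<in>UNIV. v $ i * peval (pdiff i (sg m 1)) ?y))) (at s)"
    by (intro DERIV_sum DERIV_cmult monom_eval_has_derivative)
  moreover have "(\<Sum>m\<in>?K. lk p m * (\<Sum>i\<in>UNIV. v $ i * peval (pdiff i (sg m 1)) ?y))
      = peval (pdir v p) ?y"
  proof -
    have "pdiff i p = (\<Sum>m\<in>?K. lk p m *\<^sub>R pdiff i (sg m 1))" for i
    proof -
      have "lk p m *\<^sub>R sg m 1 = sg m (lk p m)" for m
        by (rule poly_mapping_eqI) (simp add: lookup_scaleR lookup_single when_def)
      then have "pdiff i p = pdiff i (\<Sum>m\<in>?K. lk p m *\<^sub>R sg m 1)"
        using sum_single_lookup[of p] by simp
      then show ?thesis by (simp add: pdiff_sum pdiff_scaleR)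
    qed
    then have "peval (pdir v p) ?y
       = (\<Sum>i\<in>UNIV. \<Sum>m\<in>?K. v $ i * (lk p m * peval (pdiff i (sg m 1)) ?y))"
      by (simp add: peval_pdir peval_sum peval_scaleR sum_distrib_left)
    also have "\<dots> = (\<Sum>m\<in>?K. \<Sum>i\<in>UNIV. v $ i * (lk p m * peval (pdiff i (sg m 1)) ?y))"
      by (rule sum.swap)
    finally show ?thesis by (simp add: sum_distrib_left algebra_simps)
  qed
  ultimately show ?thesis
    by (simp add: peval_superset[of ?K])
qed

section \<open>Continuity, degree bounds, and vanishing on an open orthant\<close>

lemma peval_continuous: "continuous_on UNIV (peval p)"
  unfolding peval_def by (intro continuous_intros)

text \<open>A bound instead of the degree: the zero polynomial needs no convention, and each
  differentiation lowers the bound by one, which drives the inductions on \<open>d\<close>.\<close>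

definition tdeg_le :: "nat \<Rightarrow> 'n::finite rpoly \<Rightarrow> bool"
  where "tdeg_le d p \<longleftrightarrow> (\<forall>m. lk p m \<noteq> 0 \<longrightarrow> mdeg m \<le> d)"

lemma mdeg_add: "mdeg (m + k) = mdeg m + mdeg k"
  by (simp add: mdeg_def lookup_add sum.distrib)

lemma mdeg_single [simp]: "mdeg (sg i n) = n"
  by (simp add: mdeg_def lookup_single when_def)

lemma tdeg_le_exists: "\<exists>d. tdeg_le d p"
proof -
  have "mdeg m \<le> (\<Sum>k\<in>Poly_Mapping.keys p. mdeg k)" if "lk p m \<noteq> 0" for m
    using that by (intro member_le_sum) (auto simp: in_keys_iff)
  then show ?thesis unfolding tdeg_le_def by blast
qed

lemma tdeg_le_pdiff:
  assumes "tdeg_le (Suc d) p" shows "tdeg_le d (pdiff i p)"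
  unfolding tdeg_le_def
proof (intro allI impI)
  fix m assume "lk (pdiff i p) m \<noteq> 0"
  then have "lk p (m + sg i 1) \<noteq> 0" by (auto simp: lookup_pdiff)
  then have "mdeg (m + sg i 1) \<le> Suc d" using assms by (auto simp: tdeg_le_def)
  then show "mdeg m \<le> d" by (simp add: mdeg_add)
qed

lemma tdeg_le_pdir:
  assumes "tdeg_le (Suc d) p" shows "tdeg_le d (pdir v p)"
  unfolding tdeg_le_def
proof (intro allI impI)
  fix m assume "lk (pdir v p) m \<noteq> 0"
  then have "(\<Sum>i\<in>UNIV. v $ i * lk (pdiff i p) m) \<noteq> 0"
    by (simp add: pdir_def lookup_sum lookup_scaleR)
  then have "\<exists>i. lk (pdiff i p) m \<noteq> 0"
    by (metis (no_types, lifting) mult_zero_right sum.neutral)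
  then show "mdeg m \<le> d" using tdeg_le_pdiff[OF assms] by (auto simp: tdeg_le_def)
qed

lemma mdeg_eq_0_iff: "mdeg m = 0 \<longleftrightarrow> m = 0"
proof
  assume "mdeg m = 0"
  then show "m = 0" by (intro poly_mapping_eqI) (simp add: mdeg_def)
qed (simp add: mdeg_def)

lemma pdiff_all_zero_imp_const:
  assumes "\<And>i. pdiff i p = 0" shows "p = pconst (lk p 0)"
proof (rule poly_mapping_eqI)
  fix m
  show "lk p m = lk (pconst (lk p 0)) m"
  proof (cases "m = 0")
    case False
    then obtain i where i: "lk m i \<noteq> 0" by (metis poly_mapping_eqI lookup_zero)
    have "m = (m - sg i 1) + sg i 1"
      by (rule poly_mapping_eqI) (use i in \<open>auto simp: lookup_add lookup_minus lookup_single when_def\<close>)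
    then have "real (lk (m - sg i 1) i + 1) * lk p m = 0"
      using lookup_pdiff[of i p "m - sg i 1"] assms[of i] by auto
    then have "lk p m = 0" by (auto simp del: of_nat_add simp: add_eq_0_iff)
    then show ?thesis using False by (simp add: pconst_def lookup_single)
  qed (simp add: pconst_def)
qed

text \<open>Induction on a degree bound: the orthant is open, so all partial derivatives vanish on
  it as well; hence the polynomial is constant, and the all-ones vector shows the constant to be
  zero. This yields both extensionality and the uniqueness behind \<open>vol_poly\<close>.\<close>

lemma peval_eq_0_on_orthant_imp_zero:
  assumes "\<And>x. (\<And>i. 0 < x $ i) \<Longrightarrow> peval p x = 0"
  shows "p = 0"
proof -
  obtain d where "tdeg_le d p" using tdeg_le_exists by blast
  then show ?thesis using assms
  proof (induction d arbitrary: p)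
    case 0
    have "lk p m = 0" if "m \<noteq> 0" for m
      using "0.prems"(1) that by (auto simp: tdeg_le_def mdeg_eq_0_iff)
    then have p: "p = pconst (lk p 0)"
      by (intro poly_mapping_eqI) (auto simp: pconst_def lookup_single when_def)
    have "peval p (\<chi> i. 1) = 0" using 0 by simp
    then have "lk p 0 = 0" using p by (metis peval_pconst)
    then show ?case using p by (simp add: pconst_def)
  next
    case (Suc d)
    have "pdiff i p = 0" for i
    proof (rule Suc.IH)
      show "tdeg_le d (pdiff i p)" by (rule tdeg_le_pdiff[OF Suc.prems(1)])
      fix x :: "real^'a" assume x: "\<And>i. 0 < x $ i"
      have der: "((\<lambda>s. peval p (x + s *\<^sub>R axis i 1)) has_real_derivative peval (pdir (axis i 1) p) x) (at 0)"
        using peval_has_derivative[of p x "axis i 1" 0] by simp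
      have "eventually (\<lambda>s. peval p (x + s *\<^sub>R axis i 1) = 0) (nhds 0)"
      proof (rule eventually_nhds_metric[THEN iffD2], intro exI[of _ "x $ i"] conjI allI impI)
        fix s :: real assume "dist s 0 < x $ i"
        then have "0 < (x + s *\<^sub>R axis i 1) $ j" for j using x[of j] by (auto simp: axis_def)
        then show "peval p (x + s *\<^sub>R axis i 1) = 0" by (rule Suc.prems(2))
      qed (use x in auto)
      then have "((\<lambda>s. 0) has_real_derivative peval (pdiff i p) x) (at 0)"
        using der unfolding pdir_axis by (subst (asm) DERIV_cong_ev) auto
      then show "peval (pdiff i p) x = 0" using DERIV_unique DERIV_const by blast
    qed
    then have p: "p = pconst (lk p 0)" by (rule pdiff_all_zero_imp_const)
    have "peval p (\<chi> i. 1) = 0" using Suc.prems(2) by simp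
    then have "lk p 0 = 0" using p by (metis peval_pconst)
    then show ?case using p by (simp add: pconst_def)
  qed
qed

lemma peval_eqI:
  assumes "\<And>x. peval p x = peval q x" shows "p = q"
  using peval_eq_0_on_orthant_imp_zero[of "p - q"] assms by (simp add: peval_diff)

section \<open>Product rule, periodic polynomials and the differential form of Delta\<close>

lemma pdir_mult: "pdir v (p * q) = pdir v p * q + p * pdir v q"
proof (rule peval_eqI)
  fix x
  have "((\<lambda>s. peval (p * q) (x + s *\<^sub>R v)) has_real_derivative
      peval (pdir v p) (x + 0 *\<^sub>R v) * peval q (x + 0 *\<^sub>R v)
        + peval (pdir v q) (x + 0 *\<^sub>R v) * peval p (x + 0 *\<^sub>R v)) (at 0)"
    unfolding peval_mult by (rule DERIV_mult; rule peval_has_derivative)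
  from DERIV_unique[OF this peval_has_derivative]
  show "peval (pdir v (p * q)) x = peval (pdir v p * q + p * pdir v q) x"
    by (simp add: peval_add peval_mult algebra_simps)
qed

lemma pdir_commute: "pdir v (pdir w p) = pdir w (pdir v p)"
  unfolding pdir_def pdiff_sum pdiff_scaleR scaleR_sum_right
  by (subst sum.swap) (simp add: pdiff_commute mult.commute)


lemma peval_along_const:
  assumes "pdir v q = 0" shows "peval q (x + s *\<^sub>R v) = peval q x"
proof -
  have "((\<lambda>s. peval q (x + s *\<^sub>R v)) has_real_derivative 0) (at t)" for t
    using peval_has_derivative[of q x v t] by (simp add: assms)
  then have "(\<lambda>s. peval q (x + s *\<^sub>R v)) s = (\<lambda>s. peval q (x + s *\<^sub>R v)) 0"
    by (intro DERIV_isconst_all) blast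
  then show ?thesis by simp
qed

lemma peval_mvt: "\<exists>z. peval q (x + v) - peval q x = peval (pdir v q) (x + z *\<^sub>R v)"
  using MVT2[of 0 1 "\<lambda>s. peval q (x + s *\<^sub>R v)" "\<lambda>s. peval (pdir v q) (x + s *\<^sub>R v)"]
    peval_has_derivative[of q x v] by auto

text \<open>The derivative along \<open>v\<close> is again periodic and of smaller degree, so by
  induction it is constant on lines in direction \<open>v\<close>; the mean value theorem over one
  period makes this constant zero.\<close>

lemma periodic_imp_pdir_zero:
  assumes "\<And>x. peval q (x - v) = peval q x"
  shows "pdir v q = 0"
proof -
  obtain d where "tdeg_le d q" using tdeg_le_exists by blast
  \<comment> \<open>With the bound raised by one, the derivative along \<open>v\<close> is already
    constant in the base case.\<close>
  then have "tdeg_le (Suc d) q" by (auto simp: tdeg_le_def)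
  then show ?thesis using assms
  proof (induction d arbitrary: q)
    case 0
    have "tdeg_le 0 (pdir v q)" by (rule tdeg_le_pdir[OF "0.prems"(1)])
    then have "lk (pdir v q) m = 0" if "m \<noteq> 0" for m
      using that by (auto simp: tdeg_le_def mdeg_eq_0_iff)
    then have p: "pdir v q = pconst (lk (pdir v q) 0)"
      by (intro poly_mapping_eqI) (auto simp: pconst_def lookup_single when_def)
    obtain z where "peval q (0 + v) - peval q 0 = peval (pdir v q) (0 + z *\<^sub>R v)"
      using peval_mvt by blast
    then have "lk (pdir v q) 0 = 0" using "0.prems"(2)[of v]
      by (subst (asm) p) simp
    then show ?case using p by (simp add: pconst_def)
  next
    case (Suc d)
    have per: "peval (pdir v q) (x - v) = peval (pdir v q) x" for x
    proof -
      have "((\<lambda>s. peval q ((x - v) + s *\<^sub>R v)) has_real_derivative peval (pdir v q) (x - v)) (at 0)"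
        using peval_has_derivative[of q "x - v" v 0] by simp
      moreover have "peval q ((x - v) + s *\<^sub>R v) = peval q (x + s *\<^sub>R v)" for s
        using Suc.prems(2)[of "x + s *\<^sub>R v"] by (simp add: algebra_simps)
      moreover have "((\<lambda>s. peval q (x + s *\<^sub>R v)) has_real_derivative peval (pdir v q) x) (at 0)"
        using peval_has_derivative[of q x v 0] by simp
      ultimately show ?thesis by (auto intro: DERIV_unique)
    qed
    have z: "pdir v (pdir v q) = 0"
      by (rule Suc.IH[OF tdeg_le_pdir[OF Suc.prems(1)] per])
    show ?case
    proof (rule peval_eqI)
      fix x
      obtain z where "peval q (x + v) - peval q x = peval (pdir v q) (x + z *\<^sub>R v)"
        using peval_mvt by blast
      then show "peval (pdir v q) x = peval 0 x"
        using Suc.prems(2)[of "x + v"] peval_along_const[OF z] by simp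
    qed
  qed
qed

lemma pdiff_pshift: "pdiff i (pshift v p) = pshift v (pdiff i p)"
proof (rule peval_eqI)
  fix x
  have "((\<lambda>s. peval (pshift v p) (x + s *\<^sub>R axis i 1)) has_real_derivative
     peval (pdiff i (pshift v p)) (x + 0 *\<^sub>R axis i 1)) (at 0)"
    using peval_has_derivative[of "pshift v p" x "axis i 1" 0] by (simp add: pdir_axis)
  moreover have "((\<lambda>s. peval (pshift v p) (x + s *\<^sub>R axis i 1)) has_real_derivative
     peval (pdiff i p) ((x - v) + 0 *\<^sub>R axis i 1)) (at 0)"
    using peval_has_derivative[of p "x - v" "axis i 1" 0] by (simp add: pdir_axis peval_pshift algebra_simps)
  ultimately show "peval (pdiff i (pshift v p)) x = peval (pshift v (pdiff i p)) x"
    by (auto simp: peval_pshift intro: DERIV_unique)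
qed

lemma Delta_iff: "p \<in> Delta M \<longleftrightarrow> (\<forall>i. pdir (M $ i) (pdiff i p) = 0)"
proof -
  have "pdiff i (pshift (M $ i) p - p) = 0 \<longleftrightarrow> pdir (M $ i) (pdiff i p) = 0" for i
  proof
    assume "pdiff i (pshift (M $ i) p - p) = 0"
    then have "pshift (M $ i) (pdiff i p) = pdiff i p" by (simp add: pdiff_diff pdiff_pshift)
    then show "pdir (M $ i) (pdiff i p) = 0"
      by (intro periodic_imp_pdir_zero) (metis peval_pshift)
  next
    assume a: "pdir (M $ i) (pdiff i p) = 0"
    have "pshift (M $ i) (pdiff i p) = pdiff i p"
    proof (rule peval_eqI)
      show "peval (pshift (M $ i) (pdiff i p)) x = peval (pdiff i p) x" for x
        using peval_along_const[OF a, of x "-1"] by (simp add: peval_pshift)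
    qed
    then show "pdiff i (pshift (M $ i) p - p) = 0" by (simp add: pdiff_diff pdiff_pshift)
  qed
  then show ?thesis by (simp add: Delta_def)
qed

lemma homogeneous_peval_scaleR:
  assumes "homogeneous d p" shows "peval p (s *\<^sub>R x) = s ^ d * peval p x"
  using assms
  by (auto simp: peval_superset[of "Poly_Mapping.keys p"] homogeneous_def monom_eval_scaleR sum_distrib_left
      intro!: sum.cong)

text \<open>Homogeneity differentiated along the ray through \<open>x\<close>. The point doubles as
  the direction, which is the form needed once \<open>x\<close> is expanded in rows of the
  matrix.\<close>

lemma euler_homogeneous:
  assumes "homogeneous d p"
  shows "peval (pdir x p) x = real d * peval p x"
proof -
  have "((\<lambda>s. peval p (x + s *\<^sub>R x)) has_real_derivative peval (pdir x p) x) (at 0)"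
    using peval_has_derivative[of p x x 0] by simp
  moreover have "peval p (x + s *\<^sub>R x) = (1 + s) ^ d * peval p x" for s
    using homogeneous_peval_scaleR[OF assms, of "1 + s" x] by (simp add: algebra_simps)
  moreover have "((\<lambda>s. (1 + s) ^ d * peval p x) has_real_derivative real d * peval p x) (at 0)"
    by (auto intro!: derivative_eq_intros)
  ultimately show ?thesis by (auto intro: DERIV_unique)
qed

section \<open>Volume polynomials of a matrix with invertible principal minors\<close>

lemma pvars_subset_iff: "pvars p \<subseteq> J \<longleftrightarrow> (\<forall>m. lk p m \<noteq> 0 \<longrightarrow> Poly_Mapping.keys m \<subseteq> J)"
  by (fastforce simp: pvars_def in_keys_iff)

lemma homogeneous_iff: "homogeneous d p \<longleftrightarrow> (\<forall>m. lk p m \<noteq> 0 \<longrightarrow> mdeg m = d)"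
  by (auto simp: homogeneous_def in_keys_iff)

lemma keys_add_nat: "Poly_Mapping.keys (m + k :: 'n \<Rightarrow>\<^sub>0 nat) = Poly_Mapping.keys m \<union> Poly_Mapping.keys k"
  by (auto simp: in_keys_iff lookup_add)

lemma pvars_mult:
  assumes "pvars p \<subseteq> J" "pvars q \<subseteq> J" shows "pvars (p * q) \<subseteq> J"
proof -
  have "Poly_Mapping.keys m \<subseteq> J" if m: "m \<in> Poly_Mapping.keys (p * q)" for m
  proof -
    obtain a b where "m = a + b" "a \<in> Poly_Mapping.keys p" "b \<in> Poly_Mapping.keys q"
      using m keys_mult[of p q] by blast
    then show ?thesis using assms by (auto simp: pvars_def keys_add_nat)
  qed
  then show ?thesis by (auto simp: pvars_def)
qed

lemma homogeneous_mult:
  assumes "homogeneous d p" "homogeneous e q" shows "homogeneous (d + e) (p * q)"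
  unfolding homogeneous_def
proof
  fix m assume m: "m \<in> Poly_Mapping.keys (p * q)"
  obtain a b where "m = a + b" "a \<in> Poly_Mapping.keys p" "b \<in> Poly_Mapping.keys q"
    using m keys_mult[of p q] by blast
  then show "mdeg m = d + e" using assms by (auto simp: homogeneous_def mdeg_add)
qed

lemma pvars_sum:
  assumes "\<And>i. i \<in> I \<Longrightarrow> pvars (f i) \<subseteq> J" shows "pvars (\<Sum>i\<in>I. f i) \<subseteq> J"
proof -
  have "Poly_Mapping.keys (\<Sum>i\<in>I. f i) \<subseteq> (\<Union>i\<in>I. Poly_Mapping.keys (f i))" by (rule keys_sum)
  then show ?thesis using assms by (fastforce simp: pvars_def)
qed

lemma homogeneous_sum:
  assumes "\<And>i. i \<in> I \<Longrightarrow> homogeneous d (f i)" shows "homogeneous d (\<Sum>i\<in>I. f i)"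
proof -
  have "Poly_Mapping.keys (\<Sum>i\<in>I. f i) \<subseteq> (\<Union>i\<in>I. Poly_Mapping.keys (f i))" by (rule keys_sum)
  then show ?thesis using assms by (fastforce simp: homogeneous_def)
qed

lemma pvars_scaleR: "pvars p \<subseteq> J \<Longrightarrow> pvars (c *\<^sub>R p) \<subseteq> J"
  by (auto simp: pvars_subset_iff lookup_scaleR)

lemma homogeneous_scaleR: "homogeneous d p \<Longrightarrow> homogeneous d (c *\<^sub>R p)"
  by (auto simp: homogeneous_iff lookup_scaleR)

lemma pvars_pvar: "pvars (pvar i) = {i}"
  by (simp add: pvars_def pvar_def)

lemma homogeneous_pvar: "homogeneous 1 (pvar i)"
  by (simp add: homogeneous_def pvar_def)

lemma pdiff_eq_0: "pvars (p :: 'n rpoly) \<subseteq> J \<Longrightarrow> i \<notin> J \<Longrightarrow> pdiff i p = 0"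
proof (rule poly_mapping_eqI)
  fix m :: "'n \<Rightarrow>\<^sub>0 nat" assume "pvars p \<subseteq> J" "i \<notin> J"
  moreover have "i \<in> Poly_Mapping.keys (m + sg i 1)" by (simp add: keys_add_nat)
  ultimately have "lk p (m + sg i 1) = 0" by (auto simp: pvars_subset_iff)
  then show "lk (pdiff i p) m = lk 0 m" by (simp add: lookup_pdiff)
qed

text \<open>Lets a full row of the matrix be replaced by its restriction to \<open>J\<close>, so
  that identities for the principal submatrix on \<open>J\<close> apply.\<close>

lemma pdir_cong:
  assumes "pvars p \<subseteq> J" "\<And>j. j \<in> J \<Longrightarrow> v $ j = w $ j" shows "pdir v p = pdir w p"
  unfolding pdir_def
proof (rule sum.cong)
  fix i show "v $ i *\<^sub>R pdiff i p = w $ i *\<^sub>R pdiff i p"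
    using assms pdiff_eq_0[OF assms(1)] by (cases "i \<in> J") auto
qed simp

lemma pdir_sum_left: "pdir (\<Sum>i\<in>I. c i *\<^sub>R v i) p = (\<Sum>i\<in>I. c i *\<^sub>R pdir (v i) p)"
  unfolding pdir_def scaleR_sum_right
  by (subst sum.swap) (simp add: scaleR_sum_left)

lemma pdir_sum: "pdir v (\<Sum>i\<in>I. f i) = (\<Sum>i\<in>I. pdir v (f i))"
  unfolding pdir_def pdiff_sum scaleR_sum_right by (rule sum.swap)

lemma pdir_scaleR: "pdir v (c *\<^sub>R p) = c *\<^sub>R pdir v p"
  unfolding pdir_def pdiff_scaleR scaleR_sum_right by (simp add: mult.commute)

lemma peval_pdir_pvar: "peval (pdir v (pvar j)) x = v $ j"
proof -
  have "((\<lambda>s. peval (pvar j) (x + s *\<^sub>R v)) has_real_derivative v $ j) (at 0)"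
    by (auto intro!: derivative_eq_intros)
  then show ?thesis
    using peval_has_derivative[of "pvar j" x v 0] by (auto intro: DERIV_unique)
qed

lemma peval_cong:
  assumes "pvars p \<subseteq> J" "\<And>j. j \<in> J \<Longrightarrow> x $ j = y $ j" shows "peval p x = peval p y"
  unfolding peval_def
proof (intro sum.cong arg_cong2[where f = "(*)"] prod.cong refl)
  fix m i assume "m \<in> Poly_Mapping.keys p"
  then have "Poly_Mapping.keys m \<subseteq> J" using assms(1) by (auto simp: pvars_def)
  then show "x $ i ^ lk m i = y $ i ^ lk m i"
    using assms(2)[of i] by (cases "i \<in> J") (auto simp: in_keys_iff subset_iff dest: spec[of _ i])
qed

section \<open>Square-free monomials and divided-power coefficients\<close>

definition sqfree_monom :: "'n set \<Rightarrow> ('n::finite \<Rightarrow>\<^sub>0 nat)"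
  where "sqfree_monom J = (\<Sum>i\<in>J. sg i 1)"

lemma lookup_sqfree_monom: "lk (sqfree_monom J) i = (if i \<in> J then 1 else 0)"
  by (simp add: sqfree_monom_def lookup_sum lookup_single when_def)

lemma keys_sqfree_monom: "Poly_Mapping.keys (sqfree_monom J) = J"
  by (auto simp: in_keys_iff lookup_sqfree_monom split: if_splits)

lemma mdeg_sqfree_monom: "mdeg (sqfree_monom J) = card J"
  by (simp add: mdeg_def lookup_sqfree_monom sum.If_cases)

lemma sqfree_monom_remove: "i \<in> J \<Longrightarrow> sqfree_monom J = sqfree_monom (J - {i}) + sg i 1"
  unfolding sqfree_monom_def by (subst sum.remove[of J i]) (auto simp: add.commute)

text \<open>The coefficient with respect to divided powers. In these coordinates differentiation is
  a pure shift of the index, so membership in \<open>Delta\<close> becomes linear relations whose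
  only coefficients are entries of the matrix.\<close>

definition fact_coeff :: "'n::finite rpoly \<Rightarrow> ('n \<Rightarrow>\<^sub>0 nat) \<Rightarrow> real"
  where "fact_coeff p m = (\<Prod>k\<in>UNIV. fact (lk m k)) * lk p m"

lemma fact_coeff_pdiff: "fact_coeff (pdiff i p) m = fact_coeff p (m + sg i 1)"
proof -
  have "(\<Prod>k\<in>UNIV. fact (lk (m + sg i 1) k)) = (\<Prod>k\<in>UNIV. fact (lk m k) * (if k = i then real (lk m i + 1) else 1))"
    by (rule prod.cong) (auto simp: lookup_add lookup_single when_def)
  also have "\<dots> = (\<Prod>k\<in>UNIV. fact (lk m k)) * real (lk m i + 1)"
    by (simp add: prod.distrib)
  finally show ?thesis by (simp add: fact_coeff_def lookup_pdiff)
qed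

lemma fact_coeff_pdir: "fact_coeff (pdir v p) m = (\<Sum>j\<in>UNIV. v $ j * fact_coeff p (m + sg j 1))"
proof -
  have "fact_coeff (pdir v p) m = (\<Sum>j\<in>UNIV. v $ j * fact_coeff (pdiff j p) m)"
    by (simp add: fact_coeff_def pdir_def lookup_sum lookup_scaleR sum_distrib_left algebra_simps)
  then show ?thesis by (simp add: fact_coeff_pdiff)
qed

lemma Delta_subspace: "subspace (Delta M)"
  unfolding subspace_def
proof (intro conjI ballI allI)
  show "0 \<in> Delta M" by (simp add: Delta_iff pdir_def)
  show "p + q \<in> Delta M" if "p \<in> Delta M" "q \<in> Delta M" for p q
    using that by (auto simp: Delta_iff pdiff_add pdir_def scaleR_add_right sum.distrib)
  show "c *\<^sub>R p \<in> Delta M" if "p \<in> Delta M" for c :: real and p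
    using that by (auto simp: Delta_iff pdiff_scaleR pdir_scaleR)
qed

lemma fps_nth_one_plus_X_power: "fps_nth ((1 + fps_X :: int fps) ^ n) k = int (n choose k)"
proof (induction n arbitrary: k)
  case (Suc n)
  show ?case
    by (cases k) (simp_all add: distrib_right Suc)
qed auto

lemma dim_of_basis: "is_basis_of A V \<Longrightarrow> dim V = card A"
  unfolding is_basis_of_def by (metis dim_span dim_eq_card)

text \<open>\<open>mu J\<close> is the inverse of the principal submatrix of \<open>C\<close> on
  \<open>J\<close>. Its nonzero diagonal is what makes the square-free coefficient of each volume
  polynomial nonzero.\<close>

locale principal_invertible =
  fixes C :: "real ^ 'n::finite ^ 'n" and mu :: "'n set \<Rightarrow> 'n \<Rightarrow> 'n \<Rightarrow> real"
  assumes left_inv: "i \<in> J \<Longrightarrow> j \<in> J \<Longrightarrow> (\<Sum>k\<in>J. mu J i k * C $ k $ j) = (if i = j then 1 else 0)"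
    and right_inv: "i \<in> J \<Longrightarrow> j \<in> J \<Longrightarrow> (\<Sum>k\<in>J. C $ i $ k * mu J k j) = (if i = j then 1 else 0)"
    and diag: "i \<in> J \<Longrightarrow> mu J i i \<noteq> 0"
begin

text \<open>The coefficient of row \<open>i\<close> when the point is written on \<open>J\<close> as
  a combination of the rows of \<open>C\<close>; for a Cartan matrix, its coordinate at the simple
  root \<open>i\<close>.\<close>

definition height :: "'n set \<Rightarrow> 'n \<Rightarrow> 'n rpoly"
  where "height J i = (\<Sum>j\<in>J. mu J j i *\<^sub>R pvar j)"

text \<open>Solving Euler's identity for the polynomial: with the point expanded as the sum of
  \<open>height J i\<close> times row \<open>i\<close>, each derivative along row \<open>i\<close>
  is replaced by the polynomial of \<open>J - {i}\<close>. The counter repeats the cardinality so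
  that primitive recursion applies.\<close>

primrec vpoly_aux :: "nat \<Rightarrow> 'n set \<Rightarrow> 'n rpoly" where
  "vpoly_aux 0 J = 1"
| "vpoly_aux (Suc k) J = (1 / real (Suc k)) *\<^sub>R (\<Sum>i\<in>J. height J i * vpoly_aux k (J - {i}))"

definition vpoly :: "'n set \<Rightarrow> 'n rpoly"
  where "vpoly J = vpoly_aux (card J) J"

lemma vpoly_empty: "vpoly {} = 1"
  by (simp add: vpoly_def)

lemma vpoly_rec:
  assumes "J \<noteq> {}"
  shows "vpoly J = (1 / real (card J)) *\<^sub>R (\<Sum>i\<in>J. height J i * vpoly (J - {i}))"
proof -
  obtain k where k: "card J = Suc k"
    using assms by (metis card_gt_0_iff finite gr0_implies_Suc)
  have "vpoly (J - {i}) = vpoly_aux k (J - {i})" if "i \<in> J" for i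
    using that k by (simp add: vpoly_def card_Diff_singleton)
  then show ?thesis unfolding vpoly_def k by simp
qed

lemma height_props: "pvars (height J i) \<subseteq> J" "homogeneous 1 (height J i)"
  unfolding height_def
  by (auto intro!: pvars_sum pvars_scaleR homogeneous_sum homogeneous_scaleR
        homogeneous_pvar[simplified] simp: pvars_pvar)

lemma vpoly_props: "pvars (vpoly J) \<subseteq> J \<and> homogeneous (card J) (vpoly J)"
proof (induction "card J" arbitrary: J)
  case 0
  then show ?case by (simp add: vpoly_empty pvars_def homogeneous_def mdeg_def)
next
  case (Suc k)
  then have ne: "J \<noteq> {}" by auto
  have "pvars (height J i * vpoly (J - {i})) \<subseteq> J \<and> homogeneous (card J) (height J i * vpoly (J - {i}))"
    if "i \<in> J" for i
  proof -
    have c: "k = card (J - {i})" "card J = 1 + k" using that Suc(2) by auto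
    have "pvars (vpoly (J - {i})) \<subseteq> J" "homogeneous k (vpoly (J - {i}))"
      using Suc(1)[OF c(1)] c(1) by auto
    then show ?thesis unfolding c(2)
      by (intro conjI pvars_mult homogeneous_mult height_props)
  qed
  then show ?case unfolding vpoly_rec[OF ne]
    by (intro conjI pvars_scaleR homogeneous_scaleR pvars_sum homogeneous_sum) auto
qed

lemmas vpoly_vars = vpoly_props[THEN conjunct1]
lemmas vpoly_homogeneous = vpoly_props[THEN conjunct2]

lemma pdir_height:
  assumes "i \<in> J" "k \<in> J" shows "peval (pdir (C $ k) (height J i)) x = (if k = i then 1 else 0)"
  using right_inv[OF assms(2,1)]
  by (simp add: height_def pdir_sum pdir_scaleR peval_sum peval_scaleR peval_pdir_pvar mult.commute)

text \<open>Induction on \<open>card J\<close>. The product rule gives one term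
  \<open>vpoly (J - {k})\<close> from the derivative of \<open>height J k\<close>. In the remaining
  terms the derivatives along rows \<open>k\<close> and \<open>i\<close> can be interchanged, and
  their sum is the derivative of \<open>vpoly (J - {k})\<close> along the point itself, which
  Euler's identity turns into \<open>card J - 1\<close> further copies.\<close>

lemma pdir_vpoly: "k \<in> J \<Longrightarrow> pdir (C $ k) (vpoly J) = vpoly (J - {k})"
proof (induction "card J" arbitrary: J k)
  case 0
  then show ?case by simp
next
  case (Suc r)
  then have ne: "J \<noteq> {}" by auto
  have r: "card (J - {i}) = r" if "i \<in> J" for i using that Suc(2) by auto
  show ?case
  proof (rule peval_eqI)
    fix x :: "real ^ 'n"
    let ?U = "vpoly (J - {k})" and ?h = "\<lambda>i. peval (height J i) x"
    \<comment> \<open>For \<open>i\<close> different from \<open>k\<close> both sides are the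
      polynomial of \<open>J - {i, k}\<close> by the induction hypothesis.\<close>
    have swap: "pdir (C $ k) (vpoly (J - {i})) = pdir (C $ i) ?U" if "i \<in> J" for i
    proof (cases "i = k")
      case False
      then show ?thesis
        using Suc(1)[of "J - {i}" k] Suc(1)[of "J - {k}" i] r that Suc(3)
        by (auto simp: Diff_insert2[symmetric] insert_commute)
    qed simp
    have "real (card J) * peval (pdir (C $ k) (vpoly J)) x
        = (\<Sum>i\<in>J. peval (pdir (C $ k) (height J i)) x * peval (vpoly (J - {i})) x
             + ?h i * peval (pdir (C $ k) (vpoly (J - {i}))) x)"
      using ne by (simp add: vpoly_rec[OF ne] pdir_scaleR peval_scaleR pdir_sum peval_sum pdir_mult
          peval_add peval_mult)
    also have "\<dots> = (\<Sum>i\<in>J. (if i = k then peval ?U x else 0) + ?h i * peval (pdir (C $ i) ?U) x)"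
      by (rule sum.cong) (auto simp: pdir_height Suc(3) swap)
    also have "\<dots> = peval ?U x + peval (pdir (\<Sum>i\<in>J. ?h i *\<^sub>R C $ i) ?U) x"
      using Suc(3) by (simp add: sum.distrib pdir_sum_left peval_sum peval_scaleR)
    \<comment> \<open>The combination of rows equals \<open>x\<close> only in the coordinates of
      \<open>J\<close>, which suffices because no other variables occur.\<close>
    also have "pdir (\<Sum>i\<in>J. ?h i *\<^sub>R C $ i) ?U = pdir x ?U"
    proof (rule pdir_cong)
      show "pvars ?U \<subseteq> J" using vpoly_vars[of "J - {k}"] by auto
      fix j assume j: "j \<in> J"
      have "(\<Sum>i\<in>J. ?h i *\<^sub>R C $ i) $ j = (\<Sum>i\<in>J. \<Sum>l\<in>J. x $ l * (mu J l i * C $ i $ j))"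
        by (simp add: height_def peval_sum peval_scaleR sum_distrib_left algebra_simps)
      also have "\<dots> = (\<Sum>l\<in>J. x $ l * (\<Sum>i\<in>J. mu J l i * C $ i $ j))"
        by (subst sum.swap) (simp add: sum_distrib_left)
      also have "\<dots> = (\<Sum>l\<in>J. if l = j then x $ l else 0)"
        by (rule sum.cong) (auto simp: left_inv j)
      finally show "(\<Sum>i\<in>J. ?h i *\<^sub>R C $ i) $ j = x $ j" using j by simp
    qed
    also have "peval (pdir x ?U) x = real r * peval ?U x"
      using euler_homogeneous[OF vpoly_homogeneous] r[OF Suc(3)] by simp
    finally have "real (card J) * peval (pdir (C $ k) (vpoly J)) x = real (card J) * peval ?U x"
      using Suc(2)[symmetric] by (simp add: algebra_simps)
    then show "peval (pdir (C $ k) (vpoly J)) x = peval ?U x"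
      using ne by simp
  qed
qed

text \<open>For \<open>i\<close> in \<open>J\<close> the derivative along row \<open>i\<close>
  removes the variable \<open>i\<close> altogether, so the subsequent partial derivative is zero;
  for other \<open>i\<close> the variable is absent from the start.\<close>

lemma vpoly_in_Delta: "vpoly J \<in> Delta C"
  unfolding Delta_iff
proof
  fix i
  show "pdir (C $ i) (pdiff i (vpoly J)) = 0"
  proof (cases "i \<in> J")
    case True
    have "pdir (C $ i) (pdiff i (vpoly J)) = pdiff i (pdir (C $ i) (vpoly J))"
      unfolding pdir_axis[symmetric] by (rule pdir_commute)
    also have "\<dots> = 0"
      unfolding pdir_vpoly[OF True] by (rule pdiff_eq_0[OF vpoly_vars]) simp
    finally show ?thesis .
  next
    case False
    then show ?thesis by (simp add: pdiff_eq_0[OF vpoly_vars] pdir_def)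
  qed
qed

text \<open>A monomial of \<open>vpoly J\<close> has its support in \<open>J\<close> and degree
  \<open>card J\<close>; a square-free one must then have support exactly \<open>J\<close>.\<close>

lemma lookup_vpoly_other: "J \<noteq> K \<Longrightarrow> lk (vpoly J) (sqfree_monom K) = 0"
proof (rule ccontr)
  assume ne: "J \<noteq> K" and *: "lk (vpoly J) (sqfree_monom K) \<noteq> 0"
  have "K \<subseteq> J" using vpoly_vars[of J] * keys_sqfree_monom by (auto simp: pvars_subset_iff)
  moreover have "card K = card J"
    using vpoly_homogeneous[of J] * mdeg_sqfree_monom[of K] by (auto simp: homogeneous_iff)
  ultimately show False using ne card_subset_eq[of J K] by simp
qed

text \<open>On the variables of \<open>J\<close>, the partial derivative at \<open>i\<close> is the
  combination of the row derivatives with coefficients \<open>mu J i k\<close>. At the square-free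
  monomial of \<open>J - {i}\<close> only \<open>k = i\<close> survives, so the coefficient is
  \<open>mu J i i\<close> times the one for \<open>J - {i}\<close>.\<close>

lemma lookup_vpoly_same: "lk (vpoly J) (sqfree_monom J) \<noteq> 0"
proof (induction "card J" arbitrary: J)
  case 0
  then show ?case by (simp add: vpoly_empty sqfree_monom_def lookup_one)
next
  case (Suc r)
  then obtain i where i: "i \<in> J" by fastforce
  have "pdiff i (vpoly J) = pdir (axis i 1) (vpoly J)" by (simp add: pdir_axis)
  also have "\<dots> = pdir (\<Sum>k\<in>J. mu J i k *\<^sub>R C $ k) (vpoly J)"
  proof (rule pdir_cong[OF vpoly_vars])
    fix j assume "j \<in> J"
    then show "axis i 1 $ j = (\<Sum>k\<in>J. mu J i k *\<^sub>R C $ k) $ j"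
      using left_inv[OF i] by (simp add: axis_def)
  qed
  also have "\<dots> = (\<Sum>k\<in>J. mu J i k *\<^sub>R vpoly (J - {k}))"
    unfolding pdir_sum_left by (rule sum.cong) (auto simp: pdir_vpoly)
  finally have d: "pdiff i (vpoly J) = (\<Sum>k\<in>J. mu J i k *\<^sub>R vpoly (J - {k}))" .
  have "lk (vpoly J) (sqfree_monom J) = lk (pdiff i (vpoly J)) (sqfree_monom (J - {i}))"
    unfolding lookup_pdiff sqfree_monom_remove[OF i] by (simp add: lookup_sqfree_monom)
  also have "\<dots> = (\<Sum>k\<in>J. if k = i then mu J i i * lk (vpoly (J - {i})) (sqfree_monom (J - {i})) else 0)"
    unfolding d lookup_sum lookup_scaleR
  proof (rule sum.cong)
    fix k assume "k \<in> J"
    then show "mu J i k * lk (vpoly (J - {k})) (sqfree_monom (J - {i})) =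
        (if k = i then mu J i i * lk (vpoly (J - {i})) (sqfree_monom (J - {i})) else 0)"
      using i lookup_vpoly_other[of "J - {k}" "J - {i}"] by auto
  qed simp
  also have "\<dots> \<noteq> 0" using i diag[OF i] Suc(1)[of "J - {i}"] Suc(2) by simp
  finally show ?case .
qed

text \<open>Modulo the quadrics \<open>x\<^sub>i \<cdot> (\<Sum>\<^sub>j C\<^sub>i\<^sub>j x\<^sub>j)\<close> every monomial that is not square-free is a combination of
  monomials with a strictly larger support, because the principal minor on its support is invertible.\<close>

lemma Delta_eq_0_if_sqfree_0:
  assumes "p \<in> Delta C" and sqf: "\<And>J. lk p (sqfree_monom J) = 0"
  shows "p = 0"
proof -
  have rel: "(\<Sum>j\<in>UNIV. C $ i $ j * fact_coeff p (m + sg j 1 + sg i 1)) = 0" for i m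
  proof -
    have "fact_coeff (pdir (C $ i) (pdiff i p)) m = 0"
      using assms(1) by (simp add: Delta_iff fact_coeff_def)
    then show ?thesis by (simp add: fact_coeff_pdir fact_coeff_pdiff)
  qed
  have "fact_coeff p m = 0" for m
  proof (induction "CARD('n) - card (Poly_Mapping.keys m)" arbitrary: m rule: less_induct)
    case less
    let ?J = "Poly_Mapping.keys m"
    show ?case
    proof (cases "m = sqfree_monom ?J")
      case True
      then show ?thesis using sqf[of ?J] by (simp add: fact_coeff_def)
    next
      case False
      then obtain i where "lk m i \<noteq> lk (sqfree_monom ?J) i" by (metis poly_mapping_eqI)
      then have i: "i \<in> ?J" "lk m i \<ge> 2"
        by (auto simp: lookup_sqfree_monom in_keys_iff split: if_splits)
      \<comment> \<open>As \<open>i\<close> has exponent at least 2, one factor can be removed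
        without changing the support.\<close>
      define m' where "m' = m - sg i 1"
      have km': "Poly_Mapping.keys m' = ?J"
        using i by (auto simp: m'_def in_keys_iff lookup_minus lookup_single when_def)
      have mm: "m = m' + sg i 1"
        by (rule poly_mapping_eqI)
           (use i in \<open>auto simp: m'_def lookup_add lookup_minus lookup_single when_def\<close>)
      have out: "fact_coeff p (m' + sg j 1) = 0" if "j \<notin> ?J" for j
      proof (rule less)
        have "Poly_Mapping.keys (m' + sg j 1) = insert j ?J" by (simp add: keys_add_nat km')
        moreover have "card (insert j ?J) = Suc (card ?J)" using that by simp
        moreover have "card (insert j ?J) \<le> CARD('n)" by (rule card_mono) auto
        ultimately show "CARD('n) - card (Poly_Mapping.keys (m' + sg j 1)) < CARD('n) - card ?J" by simp
      qed
      have eq: "(\<Sum>j\<in>?J. C $ k $ j * fact_coeff p (m' + sg j 1)) = 0" if "k \<in> ?J" for k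
      proof -
        have "lk m' k \<noteq> 0" using that unfolding km'[symmetric] in_keys_iff .
        then have "m' = (m' - sg k 1) + sg k 1"
          by (intro poly_mapping_eqI) (auto simp: lookup_add lookup_minus lookup_single when_def)
        then have "m' - sg k 1 + sg j 1 + sg k 1 = m' + sg j 1" for j
          by (metis add.assoc add.commute)
        then have "(\<Sum>j\<in>UNIV. C $ k $ j * fact_coeff p (m' + sg j 1)) = 0"
          using rel[where i = k and m = "m' - sg k 1"] by simp
        moreover have "(\<Sum>j\<in>UNIV. C $ k $ j * fact_coeff p (m' + sg j 1))
            = (\<Sum>j\<in>?J. C $ k $ j * fact_coeff p (m' + sg j 1))"
          by (rule sum.mono_neutral_right) (use out in auto)
        ultimately show ?thesis by simp
      qed
      \<comment> \<open>The relations for all \<open>k\<close> in the support form a square system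
        in the unknowns indexed by the support; row \<open>i\<close> of the inverse isolates the
        wanted one.\<close>
      have "0 = (\<Sum>k\<in>?J. mu ?J i k * (\<Sum>j\<in>?J. C $ k $ j * fact_coeff p (m' + sg j 1)))"
        using eq by simp
      also have "\<dots> = (\<Sum>j\<in>?J. (\<Sum>k\<in>?J. mu ?J i k * C $ k $ j) * fact_coeff p (m' + sg j 1))"
        unfolding sum_distrib_left sum_distrib_right by (subst sum.swap) (simp add: algebra_simps)
      also have "\<dots> = (\<Sum>j\<in>?J. if j = i then fact_coeff p (m' + sg i 1) else 0)"
        by (rule sum.cong) (auto simp: left_inv i)
      also have "\<dots> = fact_coeff p m" using i mm by simp
      finally show ?thesis by simp
    qed
  qed
  then show ?thesis by (intro poly_mapping_eqI) (auto simp: fact_coeff_def)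
qed

section \<open>Bases of Delta from nonzero multiples of the volume polynomials\<close>

context
  fixes c :: "'n set \<Rightarrow> real" and B :: "'n set \<Rightarrow> 'n rpoly"
  assumes c_nz: "\<And>J. c J \<noteq> 0" and B_eq: "\<And>J. B J = c J *\<^sub>R vpoly J"
begin

lemma lookup_B: "lk (B J) (sqfree_monom K) = 0 \<longleftrightarrow> J \<noteq> K"
  by (cases "J = K") (auto simp: B_eq lookup_scaleR c_nz lookup_vpoly_same lookup_vpoly_other)

lemma inj_B: "inj B"
  by (rule injI) (metis lookup_B)

lemma B_in_Delta: "B J \<in> Delta C"
  unfolding B_eq by (rule subspace_scale[OF Delta_subspace vpoly_in_Delta])

lemma homogeneous_B: "homogeneous (card J) (B J)"
  unfolding B_eq by (rule homogeneous_scaleR[OF vpoly_homogeneous])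

text \<open>The matrix of square-free coefficients of the \<open>B J\<close> is diagonal, so
  dividing by the diagonal matches all square-free coefficients, and these determine an element of
  \<open>Delta C\<close>.\<close>

lemma Delta_expansion:
  assumes "p \<in> Delta C"
  shows "p = (\<Sum>J\<in>UNIV. (lk p (sqfree_monom J) / lk (B J) (sqfree_monom J)) *\<^sub>R B J)"
proof -
  let ?q = "\<Sum>J\<in>UNIV. (lk p (sqfree_monom J) / lk (B J) (sqfree_monom J)) *\<^sub>R B J"
  have "p - ?q = 0"
  proof (rule Delta_eq_0_if_sqfree_0)
    show "p - ?q \<in> Delta C"
      using Delta_subspace assms
      by (intro subspace_diff[OF Delta_subspace] subspace_sum[OF Delta_subspace]
          subspace_scale[OF Delta_subspace] B_in_Delta) auto
    fix K
    have "lk ?q (sqfree_monom K) = (\<Sum>J\<in>UNIV. if J = K then lk p (sqfree_monom K) else 0)"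
      unfolding lookup_sum lookup_scaleR by (rule sum.cong) (auto simp: lookup_B)
    then show "lk (p - ?q) (sqfree_monom K) = 0" by (simp add: lookup_minus)
  qed
  then show ?thesis by simp
qed

lemma independent_B: "independent (B ` S)"
proof (rule independent_if_scalars_zero)
  show "finite (B ` S)" by simp
  fix f x assume f: "(\<Sum>x\<in>B ` S. f x *\<^sub>R x) = 0" and "x \<in> B ` S"
  then obtain J where J: "J \<in> S" "x = B J" by auto
  have "0 = lk (\<Sum>x\<in>B ` S. f x *\<^sub>R x) (sqfree_monom J)" using f by simp
  also have "\<dots> = (\<Sum>K\<in>S. f (B K) * lk (B K) (sqfree_monom J))"
    by (subst sum.reindex) (auto intro: inj_on_subset[OF inj_B] simp: lookup_sum lookup_scaleR)
  also have "\<dots> = (\<Sum>K\<in>S. if K = J then f x * lk (B J) (sqfree_monom J) else 0)"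
    by (rule sum.cong) (use lookup_B J in auto)
  also have "\<dots> = f x * lk (B J) (sqfree_monom J)" using J by simp
  finally show "f x = 0" using lookup_B by simp
qed

lemma Delta_basis: "is_basis_of (range B) (Delta C)"
proof -
  have "span (range B) \<subseteq> Delta C"
    by (rule span_minimal[OF _ Delta_subspace]) (auto simp: B_in_Delta)
  moreover have "Delta C \<subseteq> span (range B)"
  proof
    fix p assume "p \<in> Delta C"
    then show "p \<in> span (range B)"
      by (subst Delta_expansion) (auto intro: span_sum span_scale span_base)
  qed
  ultimately show ?thesis
    unfolding is_basis_of_def using B_in_Delta independent_B by auto
qed

lemma Delta_graded: "graded (Delta C)"
  unfolding graded_def
proof (intro ballI allI)
  fix p d assume p: "p \<in> Delta C"
  define b where "b J = lk p (sqfree_monom J) / lk (B J) (sqfree_monom J)" for J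
  have e: "p = (\<Sum>J\<in>UNIV. b J *\<^sub>R B J)" unfolding b_def by (rule Delta_expansion[OF p])
  have lh: "lk (hom_component d p) m = (if mdeg m = d then lk p m else 0)" for m
  proof -
    have "lk (hom_component d p) m
        = (\<Sum>k\<in>{m \<in> Poly_Mapping.keys p. mdeg m = d}. if k = m then lk p m else 0)"
      unfolding hom_component_def lookup_sum by (rule sum.cong) (auto simp: lookup_single when_def)
    then show ?thesis by (auto simp: in_keys_iff)
  qed
  \<comment> \<open>Each \<open>B J\<close> is homogeneous of degree \<open>card J\<close>, so
    taking a component just selects terms of the expansion.\<close>
  have "hom_component d p = (\<Sum>J\<in>{J. card J = d}. b J *\<^sub>R B J)"
  proof (rule poly_mapping_eqI)
    fix m
    have nz: "lk (B J) m = 0" if "mdeg m \<noteq> card J" for J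
      using homogeneous_B[of J] that by (auto simp: homogeneous_iff)
    have "lk (hom_component d p) m = (if mdeg m = d then (\<Sum>J\<in>UNIV. b J * lk (B J) m) else 0)"
      unfolding lh by (subst e) (simp add: lookup_sum lookup_scaleR)
    also have "\<dots> = (\<Sum>J\<in>{J. card J = d}. b J * lk (B J) m)"
    proof (cases "mdeg m = d")
      case True
      have "(\<Sum>J\<in>UNIV. b J * lk (B J) m) = (\<Sum>J\<in>{J. card J = d}. b J * lk (B J) m)"
        by (rule sum.mono_neutral_right) (use nz True in auto)
      then show ?thesis using True by simp
    qed (use nz in \<open>auto intro!: sum.neutral[symmetric]\<close>)
    finally show "lk (hom_component d p) m = lk (\<Sum>J\<in>{J. card J = d}. b J *\<^sub>R B J) m"
      by (simp add: lookup_sum lookup_scaleR)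
  qed
  then show "hom_component d p \<in> Delta C"
    by (auto intro!: subspace_sum[OF Delta_subspace] subspace_scale[OF Delta_subspace] B_in_Delta)
qed

lemma graded_part_basis: "is_basis_of (B ` {J. card J = d}) (graded_part (Delta C) d)"
proof -
  have "homogeneous d p" if "p \<in> span (B ` {J. card J = d})" for p
    using that
  proof (induction rule: span_induct_alt)
    case base
    show ?case by (simp add: homogeneous_iff)
  next
    case (step r x y)
    then have "homogeneous d x" using homogeneous_B by auto
    then show ?case using step(2) unfolding homogeneous_iff lookup_add lookup_scaleR
      by (metis add.right_neutral mult_zero_right)
  qed
  moreover have "span (B ` {J. card J = d}) \<subseteq> Delta C"
    by (rule span_minimal[OF _ Delta_subspace]) (auto simp: B_in_Delta)
  moreover have "p \<in> span (B ` {J. card J = d})" if p: "p \<in> Delta C" "homogeneous d p" for p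
  proof -
    have z: "lk p (sqfree_monom J) = 0" if "card J \<noteq> d" for J
      using p(2) that by (auto simp: homogeneous_iff mdeg_sqfree_monom)
    have "(\<Sum>J\<in>{J. card J = d}. (lk p (sqfree_monom J) / lk (B J) (sqfree_monom J)) *\<^sub>R B J)
        \<in> span (B ` {J. card J = d})"
      by (intro span_sum span_scale span_base) auto
    also have "(\<Sum>J\<in>{J. card J = d}. (lk p (sqfree_monom J) / lk (B J) (sqfree_monom J)) *\<^sub>R B J)
        = (\<Sum>J\<in>UNIV. (lk p (sqfree_monom J) / lk (B J) (sqfree_monom J)) *\<^sub>R B J)"
      by (rule sum.mono_neutral_left) (auto simp: z)
    also have "\<dots> = p" by (rule Delta_expansion[OF p(1), symmetric])
    finally show ?thesis .
  qed
  ultimately have "span (B ` {J. card J = d}) = graded_part (Delta C) d"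
    unfolding graded_part_def by blast
  then show ?thesis
    unfolding is_basis_of_def using independent_B[of "{J. card J = d}"]
      span_superset[of "B ` {J. card J = d}"] by simp
qed

theorem Delta_structure:
  "is_basis_of {B J | J. J \<subseteq> UNIV} (Delta C)
    \<and> dim (Delta C) = 2 ^ CARD('n)
    \<and> graded (Delta C)
    \<and> Abs_fps (\<lambda>d. int (dim (graded_part (Delta C) d))) = (1 + fps_X) ^ CARD('n)
    \<and> (\<forall>d. is_basis_of {B J | J. card J = d} (graded_part (Delta C) d))"
proof (intro conjI allI)
  show "is_basis_of {B J | J. J \<subseteq> UNIV} (Delta C)"
    using Delta_basis by (simp add: full_SetCompr_eq)
  show "dim (Delta C) = 2 ^ CARD('n)"
    using dim_of_basis[OF Delta_basis] card_image[OF inj_B] card_Pow[of "UNIV :: 'n set"] by simp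
  show "Abs_fps (\<lambda>d. int (dim (graded_part (Delta C) d))) = (1 + fps_X) ^ CARD('n)"
  proof (rule fps_ext)
    fix d
    have "dim (graded_part (Delta C) d) = card {J :: 'n set. card J = d}"
      using dim_of_basis[OF graded_part_basis] card_image[OF inj_on_subset[OF inj_B]] by simp
    also have "\<dots> = CARD('n) choose d"
      using n_subsets[of "UNIV :: 'n set" d] by simp
    finally show "fps_nth (Abs_fps (\<lambda>d. int (dim (graded_part (Delta C) d)))) d = fps_nth ((1 + fps_X) ^ CARD('n)) d"
      by (simp add: fps_nth_one_plus_X_power)
  qed
  show "is_basis_of {B J | J. card J = d} (graded_part (Delta C) d)" for d
    using graded_part_basis[of d] by (simp add: image_Collect)
qed (rule Delta_graded)

end

end

section \<open>Translation-invariant measures on subspaces and lattice bases\<close>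

lemma independent_coordinate_functional:
  fixes B :: "'a::euclidean_space set"
  assumes "independent B" "b \<in> B"
  obtains f :: "'a \<Rightarrow> real" where "linear f" "f b = 1" "\<And>b'. b' \<in> B \<Longrightarrow> b' \<noteq> b \<Longrightarrow> f b' = 0"
proof -
  obtain f :: "'a \<Rightarrow> real" where "linear f" "\<forall>x\<in>B. f x = (if x = b then 1 else 0)"
    using linear_independent_extend[OF assms(1), of "\<lambda>x. if x = b then 1 else 0"] by auto
  then show ?thesis using that[of f] assms(2) by auto
qed

text \<open>Pushing the coordinate measure into the ambient space puts the measures of different
  bases of one subspace on the same sigma-algebra, where they can be compared.\<close>

definition span_measure :: "'a::euclidean_space set \<Rightarrow> 'a measure"
  where "span_measure B = distr (Pi\<^sub>M B (\<lambda>_. lborel)) borel (\<lambda>c. \<Sum>b\<in>B. c b *\<^sub>R b)"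

lemma sets_span_measure [simp, measurable_cong]: "sets (span_measure B) = sets borel"
  by (simp add: span_measure_def)

lemma space_span_measure [simp]: "space (span_measure B) = UNIV"
  by (simp add: span_measure_def)

lemma measurable_combination [measurable]:
  "(\<lambda>c. \<Sum>b\<in>B. c b *\<^sub>R b) \<in> Pi\<^sub>M B (\<lambda>_. lborel) \<rightarrow>\<^sub>M (borel :: 'a::euclidean_space measure)"
proof (rule borel_measurable_sum)
  fix b assume "b \<in> B"
  then have "(\<lambda>c. c b) \<in> Pi\<^sub>M B (\<lambda>_. lborel :: real measure) \<rightarrow>\<^sub>M lborel"
    by (rule measurable_component_singleton)
  then show "(\<lambda>c. c b *\<^sub>R b) \<in> Pi\<^sub>M B (\<lambda>_. lborel) \<rightarrow>\<^sub>M borel"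
    by (intro borel_measurable_scaleR) auto
qed

lemma emeasure_span_measure:
  assumes "S \<in> sets borel"
  shows "emeasure (span_measure B) S
    = emeasure (Pi\<^sub>M B (\<lambda>_. lborel)) {c \<in> Pi\<^sub>E B (\<lambda>_. UNIV). (\<Sum>b\<in>B. c b *\<^sub>R b) \<in> S}"
  unfolding span_measure_def
  by (subst emeasure_distr) (use assms in \<open>auto simp: space_PiM intro!: arg_cong2[where f = emeasure]\<close>)

lemma nn_integral_span_measure:
  assumes [measurable]: "f \<in> borel_measurable borel"
  shows "(\<integral>\<^sup>+y. f y \<partial>span_measure B) = (\<integral>\<^sup>+c. f (\<Sum>b\<in>B. c b *\<^sub>R b) \<partial>Pi\<^sub>M B (\<lambda>_. lborel))"
  unfolding span_measure_def by (subst nn_integral_distr) auto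

interpretation lborel_product: product_sigma_finite "\<lambda>_. lborel :: real measure"
  by standard

lemma sum_fun_upd_insert:
  assumes "finite B" "b \<notin> B"
  shows "(\<Sum>x\<in>insert b B. (c(b := t)) x *\<^sub>R x) = (\<Sum>x\<in>B. c x *\<^sub>R x) + t *\<^sub>R (b :: 'a::real_vector)"
proof -
  have "(\<Sum>x\<in>B. (c(b := t)) x *\<^sub>R x) = (\<Sum>x\<in>B. c x *\<^sub>R x)"
    by (rule sum.cong) (use assms in auto)
  then show ?thesis using assms by simp
qed

lemma borel_measurable_nn_integral_slice:
  assumes "finite B" and f [measurable]: "f \<in> borel_measurable borel"
  shows "(\<lambda>r. \<integral>\<^sup>+y. f (y + r *\<^sub>R b) \<partial>span_measure B) \<in> borel_measurable borel"
proof -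
  have "sigma_finite_measure (Pi\<^sub>M B (\<lambda>_. lborel :: real measure))"
    using assms(1) by (rule lborel_product.sigma_finite)
  then interpret sigma_finite_measure "Pi\<^sub>M B (\<lambda>_. lborel :: real measure)" .
  show ?thesis by (simp add: nn_integral_span_measure) measurable
qed

lemma nn_integral_span_measure_insert:
  assumes fin: "finite B" "b \<notin> B" and f [measurable]: "f \<in> borel_measurable borel"
  shows "(\<integral>\<^sup>+y. f y \<partial>span_measure (insert b B)) = (\<integral>\<^sup>+t. (\<integral>\<^sup>+y. f (y + t *\<^sub>R b) \<partial>span_measure B) \<partial>lborel)"
proof -
  have "(\<integral>\<^sup>+y. f y \<partial>span_measure (insert b B))
      = (\<integral>\<^sup>+t. (\<integral>\<^sup>+c. f (\<Sum>x\<in>insert b B. (c(b := t)) x *\<^sub>R x) \<partial>Pi\<^sub>M B (\<lambda>_. lborel)) \<partial>lborel)"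
    unfolding nn_integral_span_measure[OF f]
    by (rule lborel_product.product_nn_integral_insert_rev[OF fin]) measurable
  also have "\<dots> = (\<integral>\<^sup>+t. (\<integral>\<^sup>+y. f (y + t *\<^sub>R b) \<partial>span_measure B) \<partial>lborel)"
    unfolding sum_fun_upd_insert[OF fin] by (simp add: nn_integral_span_measure)
  finally show ?thesis .
qed

text \<open>The same Fubini decomposition with the new direction innermost: lines parallel to
  \<open>b\<close> are measured first, as needed for null subspaces.\<close>

lemma nn_integral_span_measure_insert':
  assumes fin: "finite B" "b \<notin> B" and f [measurable]: "f \<in> borel_measurable borel"
  shows "(\<integral>\<^sup>+y. f y \<partial>span_measure (insert b B)) = (\<integral>\<^sup>+y. (\<integral>\<^sup>+t. f (y + t *\<^sub>R b) \<partial>lborel) \<partial>span_measure B)"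
proof -
  have "(\<integral>\<^sup>+y. f y \<partial>span_measure (insert b B))
      = (\<integral>\<^sup>+c. (\<integral>\<^sup>+t. f (\<Sum>x\<in>insert b B. (c(b := t)) x *\<^sub>R x) \<partial>lborel) \<partial>Pi\<^sub>M B (\<lambda>_. lborel))"
    unfolding nn_integral_span_measure[OF f]
    by (rule lborel_product.product_nn_integral_insert[OF fin]) measurable
  also have "\<dots> = (\<integral>\<^sup>+y. (\<integral>\<^sup>+t. f (y + t *\<^sub>R b) \<partial>lborel) \<partial>span_measure B)"
    unfolding sum_fun_upd_insert[OF fin]
    by (rule nn_integral_span_measure[symmetric]) measurable
  finally show ?thesis .
qed

lemma nn_integral_span_measure_empty:
  assumes [measurable]: "f \<in> borel_measurable borel"
  shows "(\<integral>\<^sup>+y. f y \<partial>span_measure {}) = f 0"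
  by (simp add: nn_integral_span_measure[OF assms] nn_integral_count_space_finite PiM_empty)

lemma nn_integral_span_measure_translate:
  assumes "finite B" "u \<in> span B" "f \<in> borel_measurable borel"
  shows "(\<integral>\<^sup>+y. f (y + u) \<partial>span_measure B) = (\<integral>\<^sup>+y. f y \<partial>span_measure B)"
  using assms
proof (induction B arbitrary: u f rule: finite_induct)
  case empty
  then show ?case by simp
next
  case (insert b B)
  note [measurable] = insert(5)
  obtain s where "u - s *\<^sub>R b \<in> span B" using insert(4) span_breakdown_eq by blast
  then obtain v where v: "v \<in> span B" "u = v + s *\<^sub>R b" by (metis diff_add_cancel)
  have "(\<integral>\<^sup>+y. f (y + u) \<partial>span_measure (insert b B))
      = (\<integral>\<^sup>+t. (\<integral>\<^sup>+y. (\<lambda>z. f (z + (s + t) *\<^sub>R b)) (y + v) \<partial>span_measure B) \<partial>lborel)"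
    using insert(1,2) by (subst nn_integral_span_measure_insert) (auto simp: v algebra_simps)
  also have "\<dots> = (\<integral>\<^sup>+t. (\<lambda>r. \<integral>\<^sup>+y. f (y + r *\<^sub>R b) \<partial>span_measure B) (s + t) \<partial>lborel)"
    by (subst insert(3)[OF v(1)]) auto
  also have "\<dots> = (\<integral>\<^sup>+r. (\<integral>\<^sup>+y. f (y + r *\<^sub>R b) \<partial>span_measure B) \<partial>lborel)"
    using nn_integral_real_affine[OF borel_measurable_nn_integral_slice[OF insert(1,5)], of 1 b s] by simp
  also have "\<dots> = (\<integral>\<^sup>+y. f y \<partial>span_measure (insert b B))"
    using insert(1,2) by (subst nn_integral_span_measure_insert) auto
  finally show ?case .
qed

lemma nn_integral_span_measure_scale:
  assumes "finite B" "s > 0" "f \<in> borel_measurable borel"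
  shows "(\<integral>\<^sup>+y. f y \<partial>span_measure B) = ennreal (s ^ card B) * (\<integral>\<^sup>+y. f (s *\<^sub>R y) \<partial>span_measure B)"
  using assms
proof (induction B arbitrary: f rule: finite_induct)
  case empty
  then show ?case by (simp add: nn_integral_span_measure_empty)
next
  case (insert b B)
  note [measurable] = insert(5)
  have "sigma_finite_measure (Pi\<^sub>M B (\<lambda>_. lborel :: real measure))"
    using insert(1) by (rule lborel_product.sigma_finite)
  then interpret sigma_finite_measure "Pi\<^sub>M B (\<lambda>_. lborel :: real measure)" .
  have m [measurable]: "(\<lambda>r. \<integral>\<^sup>+y. f (y + r *\<^sub>R b) \<partial>span_measure B) \<in> borel_measurable borel"
    by (simp add: nn_integral_span_measure) measurable
  have [measurable]: "(\<lambda>r. \<integral>\<^sup>+y. f (s *\<^sub>R y + (s * r) *\<^sub>R b) \<partial>span_measure B) \<in> borel_measurable borel"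
    by (simp add: nn_integral_span_measure) measurable
  have "(\<integral>\<^sup>+y. f y \<partial>span_measure (insert b B))
      = (\<integral>\<^sup>+r. (\<integral>\<^sup>+y. f (y + r *\<^sub>R b) \<partial>span_measure B) \<partial>lborel)"
    using insert(1,2) by (subst nn_integral_span_measure_insert) auto
  also have "\<dots> = ennreal s * (\<integral>\<^sup>+t. (\<integral>\<^sup>+y. f (y + (s * t) *\<^sub>R b) \<partial>span_measure B) \<partial>lborel)"
    using nn_integral_real_affine[OF m, of s 0] insert(4) by simp
  also have "\<dots> = ennreal s * (\<integral>\<^sup>+t. ennreal (s ^ card B) *
      (\<integral>\<^sup>+y. f (s *\<^sub>R y + (s * t) *\<^sub>R b) \<partial>span_measure B) \<partial>lborel)"
    by (subst insert(3)[OF insert(4)]) auto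
  also have "\<dots> = ennreal (s ^ card (insert b B)) *
      (\<integral>\<^sup>+t. (\<integral>\<^sup>+y. f (s *\<^sub>R y + (s * t) *\<^sub>R b) \<partial>span_measure B) \<partial>lborel)"
    using insert(1,2,4) by (simp add: nn_integral_cmult ennreal_mult mult.assoc)
  also have "(\<integral>\<^sup>+t. (\<integral>\<^sup>+y. f (s *\<^sub>R y + (s * t) *\<^sub>R b) \<partial>span_measure B) \<partial>lborel)
      = (\<integral>\<^sup>+y. f (s *\<^sub>R y) \<partial>span_measure (insert b B))"
    using insert(1,2) by (subst nn_integral_span_measure_insert) (auto simp: scaleR_add_right)
  finally show ?case .
qed

lemma nn_integral_span_measure_linear_image:
  assumes "finite B" "linear L" "inj_on L B" "f \<in> borel_measurable borel"
  shows "(\<integral>\<^sup>+y. f y \<partial>span_measure (L ` B)) = (\<integral>\<^sup>+y. f (L y) \<partial>span_measure B)"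
  using assms
proof (induction B arbitrary: f rule: finite_induct)
  case empty
  note [measurable] = empty(3)
  have [measurable]: "L \<in> borel_measurable borel"
    using empty(1) by (intro borel_measurable_continuous_onI linear_continuous_on) (simp add: linear_linear)
  show ?case using empty(1) by (simp add: nn_integral_span_measure_empty linear_0)
next
  case (insert b B)
  note [measurable] = insert(6)
  have [measurable]: "L \<in> borel_measurable borel"
    using insert(4) by (intro borel_measurable_continuous_onI linear_continuous_on) (simp add: linear_linear)
  have nin: "L b \<notin> L ` B" using insert(2,5) by auto
  have "(\<integral>\<^sup>+y. f y \<partial>span_measure (L ` insert b B))
      = (\<integral>\<^sup>+t. (\<integral>\<^sup>+y. f (y + t *\<^sub>R L b) \<partial>span_measure (L ` B)) \<partial>lborel)"
    using insert(1) nin by (simp add: nn_integral_span_measure_insert)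
  also have "\<dots> = (\<integral>\<^sup>+t. (\<integral>\<^sup>+y. f (L (y + t *\<^sub>R b)) \<partial>span_measure B) \<partial>lborel)"
    using insert(4,5) by (subst insert(3)) (auto simp: linear_add linear_scale)
  also have "\<dots> = (\<integral>\<^sup>+y. f (L y) \<partial>span_measure (insert b B))"
    using insert(1,2) by (simp add: nn_integral_span_measure_insert)
  finally show ?case .
qed

lemma span_measure_cball_pos:
  assumes "finite B" shows "emeasure (span_measure B) (cball 0 1) > 0"
proof -
  \<comment> \<open>Chosen so that coordinates in \<open>{0..e}\<close> give vectors of norm at most
    1; the summand 1 guards against an empty basis.\<close>
  define e where "e = 1 / (1 + (\<Sum>b\<in>B. norm b))"
  have s: "0 \<le> (\<Sum>b\<in>B. norm b)" by (simp add: sum_nonneg)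
  then have e: "0 < e" "e * (\<Sum>b\<in>B. norm b) \<le> 1" by (auto simp: e_def field_simps)
  have "norm (\<Sum>b\<in>B. c b *\<^sub>R b) \<le> 1" if "c \<in> Pi\<^sub>E B (\<lambda>_. {0..e})" for c
  proof -
    have "norm (\<Sum>b\<in>B. c b *\<^sub>R b) \<le> (\<Sum>b\<in>B. e * norm b)"
      by (rule order_trans[OF norm_sum sum_mono]) (use that in \<open>auto simp: PiE_def Pi_def intro!: mult_right_mono\<close>)
    then show ?thesis using e(2) by (simp add: sum_distrib_left)
  qed
  then have sub: "Pi\<^sub>E B (\<lambda>_. {0..e}) \<subseteq> {c \<in> Pi\<^sub>E B (\<lambda>_. UNIV). (\<Sum>b\<in>B. c b *\<^sub>R b) \<in> cball 0 1}"
    by auto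
  have "0 < ennreal (e ^ card B)" using e by simp
  also have "\<dots> = emeasure (Pi\<^sub>M B (\<lambda>_. lborel)) (Pi\<^sub>E B (\<lambda>_. {0..e}))"
    using assms e by (simp add: lborel_product.emeasure_PiM prod_ennreal ennreal_power)
  also have "\<dots> \<le> emeasure (span_measure B) (cball 0 1)"
  proof (subst emeasure_span_measure)
    have "{c \<in> Pi\<^sub>E B (\<lambda>_. UNIV). (\<Sum>b\<in>B. c b *\<^sub>R b) \<in> cball 0 1}
        = (\<lambda>c. \<Sum>b\<in>B. c b *\<^sub>R b) -` cball 0 1 \<inter> space (Pi\<^sub>M B (\<lambda>_. lborel))"
      by (auto simp: space_PiM)
    also have "\<dots> \<in> sets (Pi\<^sub>M B (\<lambda>_. lborel))" by measurable
    finally show "emeasure (Pi\<^sub>M B (\<lambda>_. lborel)) (Pi\<^sub>E B (\<lambda>_. {0..e}))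
      \<le> emeasure (Pi\<^sub>M B (\<lambda>_. lborel)) {c \<in> Pi\<^sub>E B (\<lambda>_. UNIV). (\<Sum>b\<in>B. c b *\<^sub>R b) \<in> cball 0 1}"
      by (rule emeasure_mono[OF sub])
  qed auto
  finally show ?thesis .
qed

text \<open>Each coordinate functional extends to a linear, hence bounded, functional. Bounded sets
  therefore have bounded coordinates, and so finite measure.\<close>

lemma independent_coeff_bound:
  assumes "independent (B :: 'a::euclidean_space set)"
  shows "\<exists>K. \<forall>c. \<forall>b\<in>B. \<bar>c b\<bar> \<le> K * norm (\<Sum>b\<in>B. c b *\<^sub>R b)"
proof -
  have fin: "finite B" using assms by (rule independent_imp_finite)
  have "\<exists>K\<ge>0. \<forall>c. \<bar>c b\<bar> \<le> K * norm (\<Sum>b\<in>B. c b *\<^sub>R b)" if b: "b \<in> B" for b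
  proof -
    obtain f :: "'a \<Rightarrow> real" where f: "linear f" "f b = 1" "\<And>b'. b' \<in> B \<Longrightarrow> b' \<noteq> b \<Longrightarrow> f b' = 0"
      using independent_coordinate_functional[OF assms b] by blast
    obtain K where K: "K > 0" "\<And>x. norm (f x) \<le> K * norm x"
      using linear_bounded_pos[OF f(1)] by blast
    have "f (\<Sum>b\<in>B. c b *\<^sub>R b) = c b" for c
    proof -
      have "f (\<Sum>b\<in>B. c b *\<^sub>R b) = (\<Sum>x\<in>B. c x * f x)"
        using f(1) by (simp add: linear_sum linear_scale)
      also have "\<dots> = (\<Sum>x\<in>B. if x = b then c b else 0)" by (rule sum.cong) (use f in auto)
      finally show ?thesis using b fin by simp
    qed
    then show ?thesis using K by (metis less_imp_le real_norm_def)
  qed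
  then obtain K where K: "\<And>b. b \<in> B \<Longrightarrow> K b \<ge> 0 \<and> (\<forall>c. \<bar>c b\<bar> \<le> K b * norm (\<Sum>b\<in>B. c b *\<^sub>R b))"
    by metis
  have "\<bar>c b\<bar> \<le> (\<Sum>b\<in>B. K b) * norm (\<Sum>b\<in>B. c b *\<^sub>R b)" if "b \<in> B" for b c
  proof -
    have "K b \<le> (\<Sum>b\<in>B. K b)" using K fin that by (intro member_le_sum) auto
    then show ?thesis using K[OF that] by (meson mult_right_mono norm_ge_zero order_trans)
  qed
  then show ?thesis by blast
qed

lemma span_measure_bounded_finite:
  assumes "independent B" "bounded S" "S \<in> sets borel"
  shows "emeasure (span_measure B) S < \<infinity>"
proof -
  have fin: "finite B" using assms(1) by (rule independent_imp_finite)
  obtain r where r: "\<And>x. x \<in> S \<Longrightarrow> norm x \<le> r" using assms(2) by (auto simp: bounded_iff)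
  obtain K where K: "\<And>c b. b \<in> B \<Longrightarrow> \<bar>c b\<bar> \<le> K * norm (\<Sum>b\<in>B. c b *\<^sub>R b)"
    using independent_coeff_bound[OF assms(1)] by blast
  let ?K = "\<bar>K\<bar> * \<bar>r\<bar>"
  have "{c \<in> Pi\<^sub>E B (\<lambda>_. UNIV). (\<Sum>b\<in>B. c b *\<^sub>R b) \<in> S} \<subseteq> Pi\<^sub>E B (\<lambda>_. {-?K..?K})"
  proof (intro subsetI)
    fix c assume c: "c \<in> {c \<in> Pi\<^sub>E B (\<lambda>_. UNIV). (\<Sum>b\<in>B. c b *\<^sub>R b) \<in> S}"
    have "\<bar>c b\<bar> \<le> ?K" if "b \<in> B" for b
    proof -
      have "\<bar>c b\<bar> \<le> \<bar>K\<bar> * norm (\<Sum>b\<in>B. c b *\<^sub>R b)"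
        using K[OF that] by (meson abs_ge_self mult_right_mono norm_ge_zero order_trans)
      also have "\<dots> \<le> ?K" using r c by (intro mult_left_mono) fastforce+
      finally show ?thesis .
    qed
    then show "c \<in> Pi\<^sub>E B (\<lambda>_. {-?K..?K})" using c by (auto simp: PiE_iff abs_le_iff) (fastforce simp: abs_le_iff)+
  qed
  then have "emeasure (span_measure B) S \<le> emeasure (Pi\<^sub>M B (\<lambda>_. lborel)) (Pi\<^sub>E B (\<lambda>_. {-?K..?K}))"
    unfolding emeasure_span_measure[OF assms(3)] by (rule emeasure_mono) (simp add: sets_PiM_I_finite fin)
  also have "\<dots> < \<infinity>"
    using fin by (simp add: lborel_product.emeasure_PiM prod_ennreal ennreal_power)
  finally show ?thesis .
qed

text \<open>Uniqueness of translation-invariant measures: Tonelli and invariance turn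
  \<open>\<integral>f dM \<cdot> \<integral>g dN\<close> into \<open>\<integral>f dN \<cdot> \<integral>g dM\<close> for the even function \<open>f = 1\<^bsub>ball\<^esub>\<close>.\<close>

lemma span_measure_unique_aux:
  fixes B B' :: "'a::euclidean_space set"
  assumes fin: "finite B" "finite B'" and sp: "span B = span B'"
    and g [measurable]: "g \<in> borel_measurable borel"
  shows "emeasure (span_measure B) (cball 0 1) * (\<integral>\<^sup>+y. g y \<partial>span_measure B')
       = emeasure (span_measure B') (cball 0 1) * (\<integral>\<^sup>+y. g y \<partial>span_measure B)"
proof -
  let ?P = "Pi\<^sub>M B (\<lambda>_. lborel :: real measure)" and ?P' = "Pi\<^sub>M B' (\<lambda>_. lborel :: real measure)"
  let ?x = "\<lambda>c. \<Sum>b\<in>B. c b *\<^sub>R b" and ?y = "\<lambda>c. \<Sum>b\<in>B'. c b *\<^sub>R b"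
  let ?f = "indicator (cball 0 1) :: 'a \<Rightarrow> ennreal"
  interpret P: sigma_finite_measure ?P using fin(1) by (rule lborel_product.sigma_finite)
  interpret P': sigma_finite_measure ?P' using fin(2) by (rule lborel_product.sigma_finite)
  interpret PP: pair_sigma_finite ?P ?P' ..
  have mf [measurable]: "?f \<in> borel_measurable borel"
    by (rule borel_measurable_indicator) simp
  have xin: "?x c \<in> span B'" for c unfolding sp[symmetric] by (intro span_sum span_scale span_base)
  have yin: "?y c \<in> span B" for c unfolding sp by (intro span_sum span_scale span_base)
  have [measurable]: "(\<lambda>y. h (v + y)) \<in> borel_measurable borel" "(\<lambda>y. h (y + v)) \<in> borel_measurable borel"
    if [measurable]: "h \<in> borel_measurable borel" for h :: "'a \<Rightarrow> ennreal" and v :: 'a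
    by measurable
  have "emeasure (span_measure B) (cball 0 1) * (\<integral>\<^sup>+y. g y \<partial>span_measure B')
      = (\<integral>\<^sup>+c. ?f (?x c) * (\<integral>\<^sup>+y. g y \<partial>span_measure B') \<partial>?P)"
  proof -
    have "emeasure (span_measure B) (cball 0 1) = (\<integral>\<^sup>+c. ?f (?x c) \<partial>?P)"
      using nn_integral_span_measure[OF mf, of B] by simp
    then show ?thesis by (simp add: nn_integral_multc)
  qed
  also have "\<dots> = (\<integral>\<^sup>+c. ?f (?x c) * (\<integral>\<^sup>+y. g (y + ?x c) \<partial>span_measure B') \<partial>?P)"
    using fin(2) xin by (simp add: nn_integral_span_measure_translate)
  also have "\<dots> = (\<integral>\<^sup>+c. (\<integral>\<^sup>+d. ?f (?x c) * g (?y d + ?x c) \<partial>?P') \<partial>?P)"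
    by (simp add: nn_integral_span_measure nn_integral_cmult)
  also have "\<dots> = (\<integral>\<^sup>+d. (\<integral>\<^sup>+c. ?f (?x c) * g (?y d + ?x c) \<partial>?P) \<partial>?P')"
    by (rule PP.Fubini'[symmetric]) measurable
  \<comment> \<open>Writing the argument as a difference plus the shift exhibits the inner integrand
    as a translate, so that invariance of the first measure applies.\<close>
  also have "\<dots> = (\<integral>\<^sup>+d. (\<integral>\<^sup>+x. ?f (x + - ?y d + ?y d) * g (x + ?y d) \<partial>span_measure B) \<partial>?P')"
    by (simp add: nn_integral_span_measure add.commute)
  also have "\<dots> = (\<integral>\<^sup>+d. (\<integral>\<^sup>+x. ?f (x - ?y d) * g x \<partial>span_measure B) \<partial>?P')"
  proof (rule nn_integral_cong)
    fix d
    show "(\<integral>\<^sup>+x. ?f (x + - ?y d + ?y d) * g (x + ?y d) \<partial>span_measure B)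
       = (\<integral>\<^sup>+x. ?f (x - ?y d) * g x \<partial>span_measure B)"
      using nn_integral_span_measure_translate[OF fin(1) yin, of "\<lambda>x. ?f (x - ?y d) * g x" d] by simp
  qed
  also have "\<dots> = (\<integral>\<^sup>+c. (\<integral>\<^sup>+d. ?f (?x c - ?y d) * g (?x c) \<partial>?P') \<partial>?P)"
    by (subst nn_integral_span_measure) (auto intro!: PP.Fubini')
  \<comment> \<open>Here the ball is used as a symmetric set: the indicator does not see the sign of
    the difference.\<close>
  also have "\<dots> = (\<integral>\<^sup>+c. (\<integral>\<^sup>+y. ?f (y + - ?x c) * g (?x c) \<partial>span_measure B') \<partial>?P)"
    by (simp add: nn_integral_span_measure indicator_def dist_norm norm_minus_commute)
  also have "\<dots> = (\<integral>\<^sup>+c. emeasure (span_measure B') (cball 0 1) * g (?x c) \<partial>?P)"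
    using nn_integral_span_measure_translate[OF fin(2) span_neg[OF xin] mf]
    by (simp add: nn_integral_multc)
  also have "\<dots> = emeasure (span_measure B') (cball 0 1) * (\<integral>\<^sup>+y. g y \<partial>span_measure B)"
    by (simp add: nn_integral_cmult nn_integral_span_measure)
  finally show ?thesis .
qed

text \<open>The factor is the ratio of the two masses of the unit ball, both positive and finite. It
  stands in for the determinant of the change of basis.\<close>

lemma span_measure_unique:
  fixes B B' :: "'a::euclidean_space set"
  assumes "independent B" "independent B'" "span B = span B'"
  obtains \<kappa> where "\<kappa> > (0::real)"
    "\<And>S. S \<in> sets borel \<Longrightarrow> emeasure (span_measure B') S = ennreal \<kappa> * emeasure (span_measure B) S"
proof -
  note fin = assms(1,2)[THEN independent_imp_finite]
  define a where "a = measure (span_measure B) (cball 0 1)"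
  define a' where "a' = measure (span_measure B') (cball 0 1)"
  have f: "emeasure (span_measure B) (cball 0 1) \<noteq> \<infinity>" "emeasure (span_measure B') (cball 0 1) \<noteq> \<infinity>"
    using span_measure_bounded_finite[OF assms(1), of "cball 0 1"]
      span_measure_bounded_finite[OF assms(2), of "cball 0 1"] by auto
  have ea: "emeasure (span_measure B) (cball 0 1) = ennreal a"
    "emeasure (span_measure B') (cball 0 1) = ennreal a'"
    using f by (auto simp: a_def a'_def emeasure_eq_ennreal_measure)
  have pos: "a > 0" "a' > 0"
    using span_measure_cball_pos[OF fin(1)] span_measure_cball_pos[OF fin(2)] unfolding ea by auto
  have "emeasure (span_measure B') S = ennreal (a' / a) * emeasure (span_measure B) S" if S: "S \<in> sets borel" for S
  proof -
    have "ennreal a * emeasure (span_measure B') S = ennreal a' * emeasure (span_measure B) S"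
      using span_measure_unique_aux[OF fin assms(3), of "indicator S"] S by (simp add: ea)
    then have "ennreal (1 / a) * (ennreal a * emeasure (span_measure B') S)
        = ennreal (1 / a) * (ennreal a' * emeasure (span_measure B) S)" by simp
    then show ?thesis
      using pos by (simp add: mult.assoc[symmetric] ennreal_mult[symmetric])
  qed
  then show ?thesis using that[of "a' / a"] pos by simp
qed

text \<open>The image basis spans the same subspace, so its measure is proportional to the original
  one; the unit ball is mapped to itself, so the factor is 1.\<close>

lemma span_measure_isometry:
  assumes "independent B" "linear L" "\<And>x. norm (L x) = norm x" "L ` span B = span B"
    and S: "S \<in> sets borel"
  shows "emeasure (span_measure B) (L -` S) = emeasure (span_measure B) S"
proof -
  have fin: "finite B" using assms(1) by (rule independent_imp_finite)
  have "inj L" unfolding linear_injective_0[OF assms(2)] using assms(3) by (metis norm_eq_zero)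
  then have inj: "inj_on L B" by (rule inj_on_subset) simp
  have [measurable]: "L \<in> borel_measurable borel"
    using assms(2) by (intro borel_measurable_continuous_onI linear_continuous_on) (simp add: linear_linear)
  have im: "emeasure (span_measure (L ` B)) T = emeasure (span_measure B) (L -` T)" if T [measurable]: "T \<in> sets borel" for T
  proof -
    have [measurable]: "L -` T \<in> sets borel" using measurable_sets[of L borel borel T] by simp
    have "emeasure (span_measure (L ` B)) T = (\<integral>\<^sup>+y. indicator T (L y) \<partial>span_measure B)"
      using nn_integral_span_measure_linear_image[OF fin assms(2) inj, of "indicator T"] by simp
    also have "\<dots> = (\<integral>\<^sup>+y. indicator (L -` T) y \<partial>span_measure B)"
      by (rule nn_integral_cong) (auto simp: indicator_def)
    finally show ?thesis by simp
  qed
  have "L -` cball 0 1 = cball 0 1" using assms(3) by auto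
  then have ball: "emeasure (span_measure (L ` B)) (cball 0 1) = emeasure (span_measure B) (cball 0 1)"
    by (simp add: im)
  have "span B = span (L ` B)" using assms(2,4) by (simp add: linear_span_image)
  then have "emeasure (span_measure B) (cball 0 1) * emeasure (span_measure (L ` B)) S
      = emeasure (span_measure B) (cball 0 1) * emeasure (span_measure B) S"
    using span_measure_unique_aux[OF fin _ , of "L ` B" "indicator S"] fin S ball by simp
  moreover have "emeasure (span_measure B) (cball 0 1) \<noteq> 0" "emeasure (span_measure B) (cball 0 1) \<noteq> \<infinity>"
    using span_measure_cball_pos[OF fin] span_measure_bounded_finite[OF assms(1), of "cball 0 1"] by auto
  ultimately have "emeasure (span_measure (L ` B)) S = emeasure (span_measure B) S"
    by (auto simp: ennreal_mult_cancel_left)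
  then show ?thesis using im[OF S] by simp
qed

lemma span_measure_translate:
  assumes "finite B" "u \<in> span B" and S: "S \<in> sets borel"
  shows "emeasure (span_measure B) {y. y + u \<in> S} = emeasure (span_measure B) S"
proof -
  have [measurable]: "(\<lambda>y. y + u) \<in> borel_measurable borel" by measurable
  have [measurable]: "{y. y + u \<in> S} \<in> sets borel"
    using measurable_sets[of "\<lambda>y. y + u" borel borel S] S by (simp add: vimage_def)
  have "(\<integral>\<^sup>+y. indicator {y. y + u \<in> S} y \<partial>span_measure B) = (\<integral>\<^sup>+y. indicator S (y + u) \<partial>span_measure B)"
    by (rule nn_integral_cong) (auto simp: indicator_def)
  then show ?thesis
    using nn_integral_span_measure_translate[OF assms(1,2), of "indicator S"] S by simp
qed

lemma span_measure_scale:
  fixes B :: "'a::euclidean_space set"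
  assumes "finite B" "s > 0" and S: "S \<in> sets borel"
  shows "emeasure (span_measure B) S = ennreal (s ^ card B) * emeasure (span_measure B) {y. s *\<^sub>R y \<in> S}"
proof -
  have [measurable]: "(\<lambda>y :: 'a. s *\<^sub>R y) \<in> borel_measurable borel"
    by (intro borel_measurable_continuous_onI continuous_intros)
  have [measurable]: "{y. s *\<^sub>R y \<in> S} \<in> sets borel"
    using measurable_sets[of "\<lambda>y. s *\<^sub>R y" borel borel S] S by (simp add: vimage_def)
  have "(\<integral>\<^sup>+y. indicator {y. s *\<^sub>R y \<in> S} y \<partial>span_measure B) = (\<integral>\<^sup>+y. indicator S (s *\<^sub>R y) \<partial>span_measure B)"
    by (rule nn_integral_cong) (auto simp: indicator_def)
  then show ?thesis
    using nn_integral_span_measure_scale[OF assms(1,2), of "indicator S"] S by simp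
qed

lemma span_measure_inter_span:
  assumes "S \<in> sets borel"
  shows "emeasure (span_measure B) S = emeasure (span_measure B) (S \<inter> span B)"
proof -
  have "S \<inter> span B \<in> sets borel" using assms by (simp add: borel_closed)
  moreover have "(\<Sum>b\<in>B. c b *\<^sub>R b) \<in> span B" for c by (intro span_sum span_scale span_base)
  ultimately show ?thesis using assms by (simp add: emeasure_span_measure)
qed

text \<open>A line parallel to \<open>b\<close> meets \<open>T\<close> in at most one point, since
  two points would put a multiple of \<open>b\<close> into \<open>T\<close>.\<close>

lemma span_measure_subspace_null:
  assumes "finite B" "subspace T" "b \<in> B" "b \<notin> T"
  shows "emeasure (span_measure B) T = 0"
proof -
  have [measurable]: "T \<in> sets borel" using assms(2) by (simp add: borel_closed closed_subspace)
  obtain B' where B': "B = insert b B'" "b \<notin> B'" using assms(3) by (metis mk_disjoint_insert)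
  have "(\<integral>\<^sup>+t. indicator T (y + t *\<^sub>R b) \<partial>lborel) = 0" for y
  proof (cases "\<exists>t. y + t *\<^sub>R b \<in> T")
    case True
    then obtain t where t: "y + t *\<^sub>R b \<in> T" by blast
    have "s = t" if "y + s *\<^sub>R b \<in> T" for s
    proof (rule ccontr)
      assume "s \<noteq> t"
      have "(y + s *\<^sub>R b) - (y + t *\<^sub>R b) \<in> T" using assms(2) that t by (rule subspace_diff)
      then have "(s - t) *\<^sub>R b \<in> T" by (simp add: scaleR_left_diff_distrib)
      then have "(1 / (s - t)) *\<^sub>R ((s - t) *\<^sub>R b) \<in> T"
        by (rule subspace_scale[OF assms(2)])
      then show False using \<open>s \<noteq> t\<close> assms(4) by simp
    qed
    then have "(\<integral>\<^sup>+s. indicator T (y + s *\<^sub>R b) \<partial>lborel) \<le> (\<integral>\<^sup>+s. indicator {t} s \<partial>lborel)"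
      by (intro nn_integral_mono) (auto simp: indicator_def)
    then show ?thesis by simp
  qed (auto simp: indicator_def)
  then have "(\<integral>\<^sup>+y. indicator T y \<partial>span_measure B) = 0"
    unfolding B'(1) using assms(1) B'
    by (subst nn_integral_span_measure_insert') auto
  then show ?thesis by simp
qed

text \<open>Handles degenerate weight polytopes, to which \<open>lattice_volume\<close> assigns the
  value 0.\<close>

lemma span_measure_affine_null:
  assumes "independent B" "subspace T" "T \<subset> span B" "u \<in> span B"
  shows "emeasure (span_measure B) ((+) u ` T) = 0"
proof -
  have fin: "finite B" using assms(1) by (rule independent_imp_finite)
  obtain b where b: "b \<in> B" "b \<notin> T" using assms(2,3) by (metis psubset_eq span_minimal subsetI antisym)
  have "(+) u ` T = {y. y + - u \<in> T}" by (auto simp: image_iff algebra_simps) (metis diff_add_cancel)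
  then show ?thesis
    using span_measure_translate[OF fin span_neg[OF assms(4)], of T] span_measure_subspace_null[OF fin assms(2) b]
      assms(2) by (simp add: borel_closed closed_subspace)
qed

section \<open>Bases of subgroups of a lattice\<close>

lemma int_combination_subgroup:
  fixes g :: "'a::real_vector"
  assumes "0 \<in> G" "\<And>x y. x \<in> G \<Longrightarrow> y \<in> G \<Longrightarrow> x - y \<in> G" "g \<in> G"
  shows "of_int z *\<^sub>R g \<in> G"
proof (induction z rule: int_induct[where k = 0])
  case base
  then show ?case using assms(1) by simp
next
  case (step1 i)
  have "of_int i *\<^sub>R g - (0 - g) \<in> G" using assms step1 by blast
  then show ?case by (simp add: algebra_simps)
next
  case (step2 i)
  have "of_int i *\<^sub>R g - g \<in> G" using assms step2 by blast
  then show ?case by (simp add: algebra_simps)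
qed

text \<open>Induction on the ambient basis. The coordinate at \<open>k\<close> maps the subgroup to
  the integers; its kernel has a basis by induction, and an element where the coordinate attains its
  least positive value completes it.\<close>

lemma lattice_basis_exists:
  fixes w :: "'i \<Rightarrow> 'a::euclidean_space"
  assumes "finite I" "inj_on w I" "independent (w ` I)"
    and "0 \<in> G" "\<And>x y. x \<in> G \<Longrightarrow> y \<in> G \<Longrightarrow> x - y \<in> G"
    and "G \<subseteq> range (\<lambda>c::'i \<Rightarrow> int. \<Sum>i\<in>I. of_int (c i) *\<^sub>R w i)"
  shows "\<exists>B. lattice_basis G B"
  using assms
proof (induction I arbitrary: G rule: finite_induct)
  case empty
  then have "G = {0}" by auto
  then have "lattice_basis G {}" by (auto simp: lattice_basis_def independent_empty)
  then show ?case by blast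
next
  case (insert k I)
  have wk: "w k \<notin> w ` I" using insert(2,4) by auto
  obtain f :: "'a \<Rightarrow> real" where f: "linear f" "f (w k) = 1"
      "\<And>b'. b' \<in> w ` insert k I \<Longrightarrow> b' \<noteq> w k \<Longrightarrow> f b' = 0"
    using independent_coordinate_functional[OF insert(5), of "w k"] by blast
  have fI: "f (w i) = 0" if "i \<in> I" for i using f(3)[of "w i"] that wk by (metis image_eqI insertCI)
  have coord: "f (\<Sum>i\<in>insert k I. of_int (c i) *\<^sub>R w i) = of_int (c k)" for c :: "'i \<Rightarrow> int"
    using insert(1,2) by (simp add: linear_add[OF f(1)] linear_sum[OF f(1)] linear_scale[OF f(1)] f(2) fI)
  have fint: "\<exists>z::int. f g = of_int z" if "g \<in> G" for g
    using insert(8) that coord by blast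
  define G0 where "G0 = {g \<in> G. f g = 0}"
  have G0: "0 \<in> G0" "\<And>x y. x \<in> G0 \<Longrightarrow> y \<in> G0 \<Longrightarrow> x - y \<in> G0"
    using insert(6,7) by (auto simp: G0_def linear_0[OF f(1)] linear_diff[OF f(1)])
  have "G0 \<subseteq> range (\<lambda>c::'i \<Rightarrow> int. \<Sum>i\<in>I. of_int (c i) *\<^sub>R w i)"
  proof
    fix g assume g: "g \<in> G0"
    then obtain c :: "'i \<Rightarrow> int" where c: "g = (\<Sum>i\<in>insert k I. of_int (c i) *\<^sub>R w i)"
      using insert(8) by (auto simp: G0_def)
    then have "c k = 0" using coord[of c] g by (simp add: G0_def)
    then have "g = (\<Sum>i\<in>I. of_int (c i) *\<^sub>R w i)" using insert(1,2) c by simp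
    then show "g \<in> range (\<lambda>c::'i \<Rightarrow> int. \<Sum>i\<in>I. of_int (c i) *\<^sub>R w i)" by blast
  qed
  then obtain B0 where B0: "lattice_basis G0 B0"
    using insert(3)[of G0] G0 insert(4) independent_mono[OF insert(5), of "w ` I"] by auto
  then have fin: "finite B0" and ind: "independent B0"
    and G0eq: "G0 = range (\<lambda>c::'a \<Rightarrow> int. \<Sum>b\<in>B0. of_int (c b) *\<^sub>R b)"
    by (auto simp: lattice_basis_def)
  show ?case
  proof (cases "G = G0")
    case True
    then show ?thesis using B0 by blast
  next
    case False
    have "\<exists>n::nat. n > 0 \<and> (\<exists>g\<in>G. f g = of_nat n)"
    proof -
      obtain g where g: "g \<in> G" "f g \<noteq> 0" using False by (auto simp: G0_def)
      obtain z :: int where z: "f g = of_int z" using fint[OF g(1)] by blast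
      have "0 - g \<in> G" using insert(6,7) g(1) by blast
      moreover have "f (0 - g) = - of_int z" using z by (simp add: linear_neg[OF f(1)])
      moreover have "z > 0 \<or> z < 0" using g z by auto
      ultimately show ?thesis
      proof (elim disjE)
        assume "z > 0"
        then show ?thesis using g(1) z by (intro exI[of _ "nat z"]) auto
      next
        assume "0 - g \<in> G" "f (0 - g) = - of_int z" "z < 0"
        then show ?thesis by (intro exI[of _ "nat (- z)"] conjI bexI[of _ "0 - g"]) auto
      qed
    qed
    define d where "d = (LEAST n::nat. n > 0 \<and> (\<exists>g\<in>G. f g = of_nat n))"
    have "d > 0 \<and> (\<exists>g\<in>G. f g = of_nat d)" unfolding d_def by (rule LeastI_ex) fact
    then obtain g0 where d: "d > 0" and g0: "g0 \<in> G" "f g0 = of_nat d" by blast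
    have dmin: "n \<ge> d" if "n > 0" "g \<in> G" "f g = of_nat n" for n g
      unfolding d_def by (rule Least_le) (use that in auto)
    \<comment> \<open>Division with remainder: the remainder is again a coordinate of a group
      element and smaller than \<open>d\<close>, so minimality makes it zero.\<close>
    have red: "\<exists>q::int. g - of_int q *\<^sub>R g0 \<in> G0" if g: "g \<in> G" for g
    proof -
      obtain z :: int where z: "f g = of_int z" using fint[OF g] by blast
      let ?q = "z div int d" and ?r = "nat (z mod int d)"
      have in_G: "g - of_int ?q *\<^sub>R g0 \<in> G"
        using insert(6,7) g g0 int_combination_subgroup[of G g0 ?q] by blast
      have r: "int ?r = z mod int d" using d by simp
      have "f (g - of_int ?q *\<^sub>R g0) = of_int (z - ?q * int d)"
        using z g0 by (simp add: linear_diff[OF f(1)] linear_scale[OF f(1)])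
      also have "z - ?q * int d = z mod int d" by (simp add: minus_div_mult_eq_mod)
      also have "of_int (z mod int d) = (of_nat ?r :: real)" using r by (metis of_int_of_nat_eq)
      finally have fr: "f (g - of_int ?q *\<^sub>R g0) = of_nat ?r" .
      have "?r < d" using d r by (metis of_nat_0_less_iff of_nat_less_iff pos_mod_bound)
      then have "?r = 0" using dmin[OF _ in_G fr] by force
      then show ?thesis using in_G fr by (auto simp: G0_def)
    qed
    have "B0 \<subseteq> G0"
    proof
      fix b assume b: "b \<in> B0"
      have "(\<Sum>b'\<in>B0. of_int (if b' = b then 1 else 0) *\<^sub>R b') = (\<Sum>b'\<in>B0. if b' = b then b else 0)"
        by (rule sum.cong) auto
      also have "\<dots> = b" using fin b by simp
      finally have "b = (\<Sum>b'\<in>B0. of_int (if b' = b then 1 else 0) *\<^sub>R b')" by simp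
      then show "b \<in> G0" unfolding G0eq by (rule range_eqI[of _ _ "\<lambda>b'. if b' = b then 1 else 0"])
    qed
    then have "span B0 \<subseteq> {x. f x = 0}"
      by (intro span_minimal) (auto simp: G0_def subspace_def linear_0[OF f(1)] linear_add[OF f(1)] linear_scale[OF f(1)])
    then have nin: "g0 \<notin> span B0" using g0 d by auto
    then have nin': "g0 \<notin> B0" using span_base by blast
    have "lattice_basis G (insert g0 B0)"
      unfolding lattice_basis_def
    proof (intro conjI)
      show "independent (insert g0 B0)" using nin ind by (simp add: independent_insert)
      show "G = range (\<lambda>c::'a \<Rightarrow> int. \<Sum>b\<in>insert g0 B0. of_int (c b) *\<^sub>R b)"
      proof (intro equalityI subsetI)
        fix g assume "g \<in> G"
        then obtain q :: int where "g - of_int q *\<^sub>R g0 \<in> G0" using red by blast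
        then obtain c :: "'a \<Rightarrow> int" where c: "g - of_int q *\<^sub>R g0 = (\<Sum>b\<in>B0. of_int (c b) *\<^sub>R b)"
          unfolding G0eq by blast
        have "(\<Sum>b\<in>B0. of_int ((c(g0 := q)) b) *\<^sub>R b) = (\<Sum>b\<in>B0. of_int (c b) *\<^sub>R b)"
          by (rule sum.cong) (use nin' in auto)
        then have "g = (\<Sum>b\<in>insert g0 B0. of_int ((c(g0 := q)) b) *\<^sub>R b)"
          using fin nin' c by (simp add: algebra_simps)
        then show "g \<in> range (\<lambda>c::'a \<Rightarrow> int. \<Sum>b\<in>insert g0 B0. of_int (c b) *\<^sub>R b)" by blast
      next
        fix g assume "g \<in> range (\<lambda>c::'a \<Rightarrow> int. \<Sum>b\<in>insert g0 B0. of_int (c b) *\<^sub>R b)"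
        then obtain c :: "'a \<Rightarrow> int" where "g = of_int (c g0) *\<^sub>R g0 + (\<Sum>b\<in>B0. of_int (c b) *\<^sub>R b)"
          using fin nin' by auto
        moreover have "(\<Sum>b\<in>B0. of_int (c b) *\<^sub>R b) \<in> G" using G0eq by (auto simp: G0_def)
        moreover have "of_int (c g0) *\<^sub>R g0 \<in> G"
          using insert(6,7) g0 int_combination_subgroup[of G g0] by blast
        moreover have "x + y \<in> G" if "x \<in> G" "y \<in> G" for x y
          using insert(7)[of x "0 - y"] insert(7)[of 0 y] insert(6) that by simp
        ultimately show "g \<in> G" by simp
      qed
    qed (use fin in simp)
    then show ?thesis by blast
  qed
qed

section \<open>Reflection groups and weight polytopes\<close>

lemma inner_coroot: "v \<bullet> coroot a = 2 * (v \<bullet> a) / (a \<bullet> a)"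
  by (simp add: coroot_def)

lemma linear_refl_along: "linear (refl_along a)"
  by (rule linearI) (auto simp: refl_along_def inner_coroot algebra_simps add_divide_distrib)

lemma refl_along_involution: "a \<noteq> 0 \<Longrightarrow> refl_along a (refl_along a v) = v"
  by (simp add: refl_along_def inner_coroot inner_diff_left field_simps)

lemma inner_refl_along:
  "a \<noteq> 0 \<Longrightarrow> refl_along a v \<bullet> refl_along a w = v \<bullet> w"
  by (simp add: refl_along_def inner_coroot inner_diff_left inner_diff_right field_simps inner_commute)

lemma refl_along_conjugate:
  assumes "linear g" "\<And>v w. g v \<bullet> g w = v \<bullet> w"
  shows "g (refl_along a v) = refl_along (g a) (g v)"
  using assms by (simp add: refl_along_def inner_coroot linear_diff linear_scale)

locale simple_system =
  fixes \<Phi> :: "'a::euclidean_space set" and \<alpha> :: "'n::finite \<Rightarrow> 'a"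
  assumes roots: "root_system \<Phi>" and simple: "simple_roots \<Phi> \<alpha>"
begin

abbreviation s :: "'n \<Rightarrow> 'a \<Rightarrow> 'a" where "s j \<equiv> refl_along (\<alpha> j)"

section \<open>Simple roots, their cones and positive roots\<close>

lemma inj_alpha: "inj \<alpha>" and independent_alpha: "independent (range \<alpha>)"
  and span_alpha: "span (range \<alpha>) = UNIV" and alpha_root: "\<alpha> j \<in> \<Phi>"
  using simple by (auto simp: simple_roots_def is_basis_of_def)

lemma alpha_nz: "\<alpha> j \<noteq> 0"
  using alpha_root[of j] roots by (auto simp: root_system_def)

lemma alpha_inner_pos: "\<alpha> j \<bullet> \<alpha> j > 0"
  using alpha_nz by simp

lemma refl_root: "\<beta> \<in> \<Phi> \<Longrightarrow> s j \<beta> \<in> \<Phi>"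
  using roots alpha_root[of j] by (auto simp: root_system_def)

lemma independent_alpha_image: "independent (\<alpha> ` J)"
  by (rule independent_mono[OF independent_alpha]) auto

lemma sum_alpha_eq_0:
  assumes "(\<Sum>i\<in>UNIV. c i *\<^sub>R \<alpha> i) = 0" shows "c i = 0"
proof -
  have "(\<Sum>v\<in>range \<alpha>. c (inv_into UNIV \<alpha> v) *\<^sub>R v) = 0"
    using assms by (simp add: sum.reindex[OF inj_alpha] inj_alpha)
  from independentD[OF independent_alpha _ _ this, of "\<alpha> i"] show ?thesis
    by (simp add: inj_alpha)
qed

lemma sum_alpha_unique:
  assumes "(\<Sum>i\<in>UNIV. c i *\<^sub>R \<alpha> i) = (\<Sum>i\<in>UNIV. d i *\<^sub>R \<alpha> i)" shows "c i = d i"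
proof -
  have "(\<Sum>i\<in>UNIV. (c i - d i) *\<^sub>R \<alpha> i) = 0"
    using assms by (simp add: scaleR_left_diff_distrib sum_subtractf)
  then show ?thesis using sum_alpha_eq_0[of "\<lambda>i. c i - d i"] by simp
qed

lemma sum_restrict: "(\<Sum>i\<in>J. c i *\<^sub>R \<alpha> i) = (\<Sum>i\<in>UNIV. (if i \<in> J then c i else 0) *\<^sub>R \<alpha> i)"
  by (rule sum.mono_neutral_cong_left) auto

lemma span_alpha_image: "y \<in> span (\<alpha> ` J) \<longleftrightarrow> (\<exists>c. y = (\<Sum>i\<in>J. c i *\<^sub>R \<alpha> i))"
proof
  assume "y \<in> span (\<alpha> ` J)"
  then obtain u where "y = (\<Sum>v\<in>\<alpha> ` J. u v *\<^sub>R v)" by (auto simp: span_finite)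
  then have "y = (\<Sum>i\<in>J. u (\<alpha> i) *\<^sub>R \<alpha> i)"
    by (simp add: sum.reindex[OF inj_on_subset[OF inj_alpha]])
  then show "\<exists>c. y = (\<Sum>i\<in>J. c i *\<^sub>R \<alpha> i)" by (rule exI[of _ "\<lambda>i. u (\<alpha> i)"])
qed (auto intro: span_sum span_scale span_base)

definition rcone :: "'n set \<Rightarrow> 'a set"
  where "rcone J = {\<Sum>i\<in>J. t i *\<^sub>R \<alpha> i | t. \<forall>i\<in>J. 0 \<le> t i}"

definition dominant :: "'n set \<Rightarrow> 'a set"
  where "dominant J = {x. \<forall>j\<in>J. 0 \<le> x \<bullet> \<alpha> j}"

lemma rcone_add: "x \<in> rcone J \<Longrightarrow> y \<in> rcone J \<Longrightarrow> x + y \<in> rcone J"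
  unfolding rcone_def
proof clarify
  fix t u :: "'n \<Rightarrow> real" assume "\<forall>i\<in>J. 0 \<le> t i" "\<forall>i\<in>J. 0 \<le> u i"
  then show "\<exists>v. (\<Sum>i\<in>J. t i *\<^sub>R \<alpha> i) + (\<Sum>i\<in>J. u i *\<^sub>R \<alpha> i) = (\<Sum>i\<in>J. v i *\<^sub>R \<alpha> i) \<and> (\<forall>i\<in>J. 0 \<le> v i)"
    by (intro exI[of _ "\<lambda>i. t i + u i"]) (auto simp: scaleR_left_distrib sum.distrib)
qed

lemma rcone_scale: "0 \<le> c \<Longrightarrow> x \<in> rcone J \<Longrightarrow> c *\<^sub>R x \<in> rcone J"
  unfolding rcone_def
proof clarify
  fix t :: "'n \<Rightarrow> real" assume "0 \<le> c" "\<forall>i\<in>J. 0 \<le> t i"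
  then show "\<exists>v. c *\<^sub>R (\<Sum>i\<in>J. t i *\<^sub>R \<alpha> i) = (\<Sum>i\<in>J. v i *\<^sub>R \<alpha> i) \<and> (\<forall>i\<in>J. 0 \<le> v i)"
    by (intro exI[of _ "\<lambda>i. c * t i"]) (auto simp: scaleR_sum_right)
qed

lemma rcone_0: "0 \<in> rcone J"
  unfolding rcone_def by (auto intro!: exI[of _ "\<lambda>_. 0"])

lemma rcone_pointed:
  assumes "x \<in> rcone J" "- x \<in> rcone J" shows "x = 0"
proof -
  obtain t u where t: "\<forall>i\<in>J. 0 \<le> t i" "x = (\<Sum>i\<in>J. t i *\<^sub>R \<alpha> i)"
    and u: "\<forall>i\<in>J. 0 \<le> u i" "- x = (\<Sum>i\<in>J. u i *\<^sub>R \<alpha> i)"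
    using assms by (auto simp: rcone_def)
  have "(\<Sum>i\<in>J. (t i + u i) *\<^sub>R \<alpha> i) = 0"
    using arg_cong2[OF t(2) u(2), of "(+)"] by (simp add: scaleR_left_distrib sum.distrib)
  then have "i \<in> J \<Longrightarrow> t i + u i = 0" for i
    using sum_alpha_eq_0[of "\<lambda>i. if i \<in> J then t i + u i else 0" i]
      sum_restrict[of "\<lambda>i. t i + u i" J] by simp
  then have "i \<in> J \<Longrightarrow> t i = 0" for i using t(1) u(1) by (metis add_nonneg_eq_0_iff)
  then show ?thesis using t(2) by simp
qed

lemma dominant_inner_rcone: "x \<in> dominant J \<Longrightarrow> y \<in> rcone J \<Longrightarrow> 0 \<le> x \<bullet> y"
  by (auto simp: dominant_def rcone_def inner_sum_right intro!: sum_nonneg)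

lemma convex_rcone: "convex (rcone J)"
  unfolding convex_def by (auto intro: rcone_add rcone_scale)

definition pos_root :: "'a \<Rightarrow> bool"
  where "pos_root \<beta> \<longleftrightarrow> \<beta> \<in> \<Phi> \<and> \<beta> \<in> rcone UNIV"

lemma pos_or_neg: "\<beta> \<in> \<Phi> \<Longrightarrow> \<not> pos_root \<beta> \<Longrightarrow> - \<beta> \<in> rcone UNIV"
proof -
  assume b: "\<beta> \<in> \<Phi>" "\<not> pos_root \<beta>"
  then obtain c :: "'n \<Rightarrow> nat" where
    "\<beta> = (\<Sum>i\<in>UNIV. real (c i) *\<^sub>R \<alpha> i) \<or> \<beta> = - (\<Sum>i\<in>UNIV. real (c i) *\<^sub>R \<alpha> i)"
    using simple unfolding simple_roots_def by blast
  moreover have "(\<Sum>i\<in>UNIV. real (c i) *\<^sub>R \<alpha> i) \<in> rcone UNIV"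
    unfolding rcone_def by (auto intro!: exI[of _ "\<lambda>i. real (c i)"])
  ultimately show ?thesis using b by (auto simp: pos_root_def)
qed

lemma alpha_in_rcone: "j \<in> J \<Longrightarrow> \<alpha> j \<in> rcone J"
  unfolding rcone_def
proof clarify
  assume "j \<in> J"
  then have "(\<Sum>i\<in>J. (if i = j then 1 else 0) *\<^sub>R \<alpha> i) = \<alpha> j"
    by (simp add: if_distrib[of "\<lambda>r. r *\<^sub>R _"] cong: if_cong)
  then show "\<exists>t. \<alpha> j = (\<Sum>i\<in>J. t i *\<^sub>R \<alpha> i) \<and> (\<forall>i\<in>J. 0 \<le> t i)"
    by (intro exI[of _ "\<lambda>i. if i = j then 1 else 0"]) auto
qed

lemma pos_root_alpha: "pos_root (\<alpha> j)"
  by (simp add: pos_root_def alpha_root alpha_in_rcone)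

text \<open>The reflection changes only the coordinate at \<alpha> j. If it makes the root negative,
  all other coordinates are both nonnegative and nonpositive, so the root is a multiple of \<alpha>
  j, and reducedness leaves only \<alpha> j.\<close>

lemma pos_root_refl_neg_imp_simple:
  assumes p: "pos_root \<beta>" and n: "\<not> pos_root (s j \<beta>)" shows "\<beta> = \<alpha> j"
proof -
  obtain t where t: "\<And>i. 0 \<le> t i" "\<beta> = (\<Sum>i\<in>UNIV. t i *\<^sub>R \<alpha> i)"
    using p by (auto simp: pos_root_def rcone_def)
  have "s j \<beta> \<in> \<Phi>" using p by (auto simp: pos_root_def refl_root)
  then obtain u where u: "\<And>i. 0 \<le> u i" "- s j \<beta> = (\<Sum>i\<in>UNIV. u i *\<^sub>R \<alpha> i)"
    using pos_or_neg n by (fastforce simp: rcone_def)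
  let ?k = "\<beta> \<bullet> coroot (\<alpha> j)"
  have "s j \<beta> = (\<Sum>i\<in>UNIV. (t i - (if i = j then ?k else 0)) *\<^sub>R \<alpha> i)"
  proof -
    have "(\<Sum>i\<in>UNIV. (if i = j then ?k else 0) *\<^sub>R \<alpha> i) = (\<Sum>i\<in>UNIV. if i = j then ?k *\<^sub>R \<alpha> j else 0)"
      by (rule sum.cong) auto
    then show ?thesis
      unfolding refl_along_def by (subst t(2)) (simp add: scaleR_left_diff_distrib sum_subtractf)
  qed
  then have "(\<Sum>i\<in>UNIV. (- u i) *\<^sub>R \<alpha> i) = (\<Sum>i\<in>UNIV. (t i - (if i = j then ?k else 0)) *\<^sub>R \<alpha> i)"
    using u(2) by (simp add: sum_negf) (metis minus_minus)
  from sum_alpha_unique[OF this] have e: "- u i = t i - (if i = j then ?k else 0)" for i .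
  have t0: "t i = 0" if "i \<noteq> j" for i using e[of i] t(1)[of i] u(1)[of i] that by simp
  have "\<beta> = (\<Sum>i\<in>UNIV. if i = j then t j *\<^sub>R \<alpha> j else 0)"
    by (subst t(2)) (rule sum.cong, auto simp: t0)
  then have b: "\<beta> = t j *\<^sub>R \<alpha> j" by simp
  then have "t j = 1 \<or> t j = -1"
    using p roots alpha_root[of j] by (auto simp: pos_root_def root_system_def)
  then show ?thesis using b t(1)[of j] by auto
qed

section \<open>Words in simple reflections and the exchange property\<close>

primrec wprod :: "'n list \<Rightarrow> 'a \<Rightarrow> 'a" where
  "wprod [] = id"
| "wprod (j # js) = s j \<circ> wprod js"

lemma wprod_append: "wprod (as @ bs) = wprod as \<circ> wprod bs"
  by (induction as) (auto simp: comp_assoc)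

lemma linear_wprod: "linear (wprod js)"
proof (induction js)
  case Nil
  show ?case by (simp add: linear_id id_def linear_ident)
next
  case (Cons j js)
  show ?case unfolding wprod.simps by (rule linear_compose[OF Cons linear_refl_along])
qed

lemma inner_wprod: "wprod js v \<bullet> wprod js w = v \<bullet> w"
  by (induction js) (auto simp: inner_refl_along alpha_nz)

lemma wprod_rev: "wprod (rev js) (wprod js v) = v" "wprod js (wprod (rev js) v) = v"
  by (induction js arbitrary: v) (auto simp: wprod_append refl_along_involution alpha_nz)

lemma wprod_root: "\<beta> \<in> \<Phi> \<Longrightarrow> wprod js \<beta> \<in> \<Phi>"
  by (induction js) (auto simp: refl_root)

lemma wprod_minus_span: "set js \<subseteq> J \<Longrightarrow> wprod js v - v \<in> span (\<alpha> ` J)"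
proof (induction js)
  case Nil
  then show ?case by (simp add: span_zero)
next
  case (Cons j js)
  have "(wprod js v - v) - (wprod js v \<bullet> coroot (\<alpha> j)) *\<^sub>R \<alpha> j \<in> span (\<alpha> ` J)"
    using Cons by (intro span_diff[OF _ span_scale[OF span_base]]) auto
  then show ?case by (simp add: refl_along_def algebra_simps)
qed

lemma wprod_span: "set js \<subseteq> J \<Longrightarrow> v \<in> span (\<alpha> ` J) \<Longrightarrow> wprod js v \<in> span (\<alpha> ` J)"
  using wprod_minus_span[of js J v] span_add[of "wprod js v - v" "\<alpha> ` J" v] by simp

text \<open>The letters act from the right end. At the letter where the image of \<alpha> j first
  turns from positive to negative, the current root must be the simple root of that letter.\<close>

lemma exchange:
  assumes "\<not> pos_root (wprod ks (\<alpha> j))"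
  shows "\<exists>as i bs. ks = as @ [i] @ bs \<and> wprod bs (\<alpha> j) = \<alpha> i"
  using assms
proof (induction ks)
  case Nil
  then show ?case by (simp add: pos_root_alpha)
next
  case (Cons k ks)
  show ?case
  proof (cases "pos_root (wprod ks (\<alpha> j))")
    case True
    then have "wprod ks (\<alpha> j) = \<alpha> k"
      using Cons(2) pos_root_refl_neg_imp_simple by simp
    then show ?thesis by (intro exI[of _ "[]"] exI[of _ k] exI[of _ ks]) simp
  next
    case False
    then obtain as i bs where "ks = as @ [i] @ bs" "wprod bs (\<alpha> j) = \<alpha> i" using Cons(1) by blast
    then show ?thesis by (intro exI[of _ "k # as"] exI[of _ i] exI[of _ bs]) simp
  qed
qed

text \<open>The root form of reducedness: every prefix sends the simple root of the next letter to a
  positive root.\<close>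

definition good :: "'n list \<Rightarrow> bool"
  where "good js \<longleftrightarrow> (\<forall>i<length js. pos_root (wprod (take i js) (\<alpha> (js ! i))))"

lemma good_snoc: "good (js @ [j]) \<longleftrightarrow> good js \<and> pos_root (wprod js (\<alpha> j))"
  unfolding good_def by (auto simp: nth_append less_Suc_eq)

text \<open>If the last letter \<open>j\<close> spoils a good word, \<open>exchange\<close> finds a
  letter \<open>i\<close> followed by a block that sends \<alpha> j to \<alpha> i. Conjugation by
  that block turns one reflection into the other, so the letters \<open>i\<close> and
  \<open>j\<close> cancel and a shorter word remains.\<close>

lemma good_word_exists:
  "set js \<subseteq> J \<Longrightarrow> \<exists>js'. good js' \<and> set js' \<subseteq> J \<and> wprod js' = wprod js \<and> length js' \<le> length js"
proof (induction js rule: length_induct)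
  case (1 js)
  show ?case
  proof (cases js rule: rev_cases)
    case Nil
    then show ?thesis by (auto simp: good_def)
  next
    case (snoc ks j)
    then obtain ks' where ks': "good ks'" "set ks' \<subseteq> J" "wprod ks' = wprod ks" "length ks' \<le> length ks"
      using 1 by (metis Un_subset_iff length_append_singleton lessI set_append)
    have jJ: "j \<in> J" using 1(2) snoc by auto
    have wjs: "wprod js = wprod (ks' @ [j])" by (simp add: snoc wprod_append ks'(3))
    show ?thesis
    proof (cases "pos_root (wprod ks' (\<alpha> j))")
      case True
      then show ?thesis using ks' jJ wjs snoc
        by (intro exI[of _ "ks' @ [j]"]) (simp add: good_snoc)
    next
      case False
      then obtain as i bs where e: "ks' = as @ [i] @ bs" "wprod bs (\<alpha> j) = \<alpha> i" using exchange by blast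
      have "s i (wprod bs (s j v)) = wprod bs v" for v
        using refl_along_conjugate[OF linear_wprod inner_wprod, of bs "\<alpha> j" v]
        by (simp add: e(2) refl_along_involution alpha_nz)
      then have "wprod js = wprod (as @ bs)"
        unfolding wjs e(1) by (auto simp: wprod_append fun_eq_iff)
      moreover have "length (as @ bs) < length js" using e ks'(4) snoc by simp
      moreover have "set (as @ bs) \<subseteq> J" using e ks'(2) by auto
      ultimately show ?thesis using 1(1) by (metis order.strict_implies_order order_trans)
    qed
  qed
qed

lemma rcone_UNIV_span:
  assumes "x \<in> rcone UNIV" "x \<in> span (\<alpha> ` J)" shows "x \<in> rcone J"
proof -
  obtain t where t: "\<And>i. 0 \<le> t i" "x = (\<Sum>i\<in>UNIV. t i *\<^sub>R \<alpha> i)" using assms(1) by (auto simp: rcone_def)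
  obtain c where c: "x = (\<Sum>i\<in>J. c i *\<^sub>R \<alpha> i)" using assms(2) span_alpha_image by blast
  have "t i = (if i \<in> J then c i else 0)" for i
    by (rule sum_alpha_unique) (use t c sum_restrict[of c J] in simp)
  then have "\<forall>i\<in>J. 0 \<le> c i" using t(1) by metis
  then show ?thesis using c by (auto simp: rcone_def)
qed

text \<open>Along a good word the difference telescopes into terms \<open>(x \<bullet> coroot
  (\<alpha> j)) *\<^sub>R wprod js (\<alpha> j)\<close>: the factor is nonnegative by dominance and
  the vector is a positive root in the span of \<open>J\<close>.\<close>

lemma dominant_minus_orbit:
  assumes x: "x \<in> dominant J" and js: "set js \<subseteq> J"
  shows "x - wprod js x \<in> rcone J"
proof -
  have "good js \<Longrightarrow> set js \<subseteq> J \<Longrightarrow> x - wprod js x \<in> rcone J" for js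
  proof (induction js rule: rev_induct)
    case Nil
    then show ?case by (simp add: rcone_0)
  next
    case (snoc j js)
    have j: "j \<in> J" "set js \<subseteq> J" using snoc(3) by auto
    have "wprod js (\<alpha> j) \<in> rcone UNIV" using snoc(2) by (simp add: good_snoc pos_root_def)
    then have "wprod js (\<alpha> j) \<in> rcone J"
      by (rule rcone_UNIV_span) (use j in \<open>auto intro: wprod_span span_base\<close>)
    moreover have "0 \<le> x \<bullet> coroot (\<alpha> j)" using x j by (simp add: inner_coroot dominant_def)
    ultimately have "(x - wprod js x) + (x \<bullet> coroot (\<alpha> j)) *\<^sub>R wprod js (\<alpha> j) \<in> rcone J"
      using snoc j by (intro rcone_add rcone_scale) (auto simp: good_snoc)
    then show ?case
      by (simp add: wprod_append refl_along_def linear_diff[OF linear_wprod] linear_scale[OF linear_wprod] algebra_simps)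
  qed
  then show ?thesis using good_word_exists[OF js] by metis
qed

text \<open>The reflection \<open>s j\<close> makes no positive root negative except \<alpha> j, so
  the image of \<alpha> i is positive; its coordinate at \<open>j\<close> is minus the pairing in
  question.\<close>

lemma alpha_inner_nonpos: "i \<noteq> j \<Longrightarrow> \<alpha> i \<bullet> \<alpha> j \<le> 0"
proof -
  assume ij: "i \<noteq> j"
  let ?k = "\<alpha> i \<bullet> coroot (\<alpha> j)"
  have "pos_root (s j (\<alpha> i))"
    using pos_root_refl_neg_imp_simple[OF pos_root_alpha, of j i] ij inj_alpha by (auto dest: injD)
  then obtain t where t: "\<And>i. 0 \<le> t i" "s j (\<alpha> i) = (\<Sum>i\<in>UNIV. t i *\<^sub>R \<alpha> i)"
    by (auto simp: pos_root_def rcone_def)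
  have "(\<Sum>l\<in>UNIV. (if l = i then 1 else if l = j then - ?k else 0) *\<^sub>R \<alpha> l)
      = (\<Sum>l\<in>UNIV. (if l = i then \<alpha> i else 0) + (if l = j then - ?k *\<^sub>R \<alpha> j else 0))"
    by (rule sum.cong) (use ij in auto)
  also have "\<dots> = s j (\<alpha> i)" by (simp add: sum.distrib refl_along_def)
  finally have "t j = (if j = i then 1 else if j = j then - ?k else 0)"
    using t(2) by (intro sum_alpha_unique) simp
  then have "?k \<le> 0" using t(1)[of j] ij by simp
  then show ?thesis using alpha_inner_pos[of j] by (simp add: inner_coroot divide_le_0_iff)
qed

section \<open>Parabolic subgroups and dominant representatives\<close>

definition W :: "'n set \<Rightarrow> ('a \<Rightarrow> 'a) set"
  where "W J = wprod ` {js. set js \<subseteq> J}"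

text \<open>The generators are involutions, so words are already closed under inverses.\<close>

lemma parabolic_eq_W: "parabolic \<alpha> J = W J"
proof -
  let ?G = "BijGroup (UNIV :: 'a set)"
  have bij: "bij (wprod js)" for js
    by (rule o_bij[of "wprod (rev js)"]) (auto simp: fun_eq_iff wprod_rev)
  have Bij: "wprod js \<in> Bij UNIV" for js using bij by (simp add: Bij_def)
  have mult: "wprod as \<otimes>\<^bsub>?G\<^esub> wprod bs = wprod (as @ bs)" for as bs
    using Bij by (simp add: BijGroup_def compose_def wprod_append fun_eq_iff)
  have one: "\<one>\<^bsub>?G\<^esub> = wprod []" by (simp add: BijGroup_def fun_eq_iff)
  have s_eq: "s j = wprod [j]" for j by (simp add: comp_def)
  have inv: "inv\<^bsub>?G\<^esub> (s j) = wprod [j]" for j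
  proof -
    have "inv\<^bsub>?G\<^esub> (s j) = inv_into UNIV (s j)"
      using Bij[of "[j]"] unfolding s_eq by (simp add: inv_BijGroup restrict_def)
    also have "inv_into UNIV (s j) = s j"
      by (rule inv_equality) (auto simp: refl_along_involution alpha_nz)
    finally show ?thesis by simp
  qed
  show ?thesis
  proof (intro equalityI subsetI)
    fix w assume "w \<in> parabolic \<alpha> J"
    then show "w \<in> W J" unfolding parabolic_def
    proof (induction rule: generate.induct)
      case one
      then show ?case unfolding \<open>\<one>\<^bsub>?G\<^esub> = wprod []\<close> W_def by (intro image_eqI[of _ _ "[]"]) auto
    next
      case (incl h)
      then obtain j where "j \<in> J" "h = wprod [j]" by auto
      then show ?case unfolding W_def by (intro image_eqI[of _ _ "[j]"]) auto
    next
      case (inv h)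
      then obtain j where "j \<in> J" "h = s j" by auto
      then show ?case unfolding W_def using \<open>\<And>j. inv\<^bsub>?G\<^esub> (s j) = wprod [j]\<close>
        by (intro image_eqI[of _ _ "[j]"]) auto
    next
      case (eng h1 h2)
      then obtain as bs where "set as \<subseteq> J" "set bs \<subseteq> J" "h1 = wprod as" "h2 = wprod bs" by (auto simp: W_def)
      then show ?case unfolding W_def using mult by (intro image_eqI[of _ _ "as @ bs"]) auto
    qed
  next
    fix w assume "w \<in> W J"
    then obtain js where "set js \<subseteq> J" "w = wprod js" by (auto simp: W_def)
    moreover have "set js \<subseteq> J \<Longrightarrow> wprod js \<in> parabolic \<alpha> J" for js
    proof (induction js)
      case Nil
      show ?case unfolding parabolic_def one[symmetric] by (rule generate.one)
    next
      case (Cons j js)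
      have "s j \<otimes>\<^bsub>?G\<^esub> wprod js \<in> parabolic \<alpha> J"
        unfolding parabolic_def
        by (rule generate.eng[OF generate.incl]) (use Cons in \<open>auto simp: parabolic_def\<close>)
      moreover have "s j \<otimes>\<^bsub>?G\<^esub> wprod js = wprod (j # js)"
        using mult[of "[j]" js] by (simp del: o_apply)
      ultimately show ?case by (simp only:)
    qed
    ultimately show "w \<in> parabolic \<alpha> J" by simp
  qed
qed

lemma W_id: "id \<in> W J"
  unfolding W_def by (rule image_eqI[of _ _ "[]"]) auto

lemma W_props:
  assumes "w \<in> W J"
  shows "linear w" "w v \<bullet> w u = v \<bullet> u" "norm (w v) = norm v"
    "w v - v \<in> span (\<alpha> ` J)" "v \<in> span (\<alpha> ` J) \<Longrightarrow> w v \<in> span (\<alpha> ` J)"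
    "x \<in> dominant J \<Longrightarrow> x - w x \<in> rcone J"
  using assms unfolding W_def
  by (auto simp: linear_wprod inner_wprod norm_eq_sqrt_inner wprod_minus_span wprod_span dominant_minus_orbit)

lemma W_inverse:
  assumes "w \<in> W J" obtains w' where "w' \<in> W J" "\<And>v. w' (w v) = v" "\<And>v. w (w' v) = v"
proof -
  obtain js where js: "set js \<subseteq> J" "w = wprod js" using assms by (auto simp: W_def)
  show ?thesis
  proof (rule that[of "wprod (rev js)"])
    show "wprod (rev js) \<in> W J" using js by (auto simp: W_def)
  qed (auto simp: js wprod_rev)
qed

lemma W_comp: "w \<in> W J \<Longrightarrow> w' \<in> W J \<Longrightarrow> w \<circ> w' \<in> W J"
proof -
  assume "w \<in> W J" "w' \<in> W J"
  then obtain as bs where "set as \<subseteq> J" "set bs \<subseteq> J" "w = wprod as" "w' = wprod bs" by (auto simp: W_def)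
  then show ?thesis unfolding W_def by (intro image_eqI[of _ _ "as @ bs"]) (auto simp: wprod_append)
qed

lemma W_refl: "j \<in> J \<Longrightarrow> s j \<in> W J"
  unfolding W_def by (rule image_eqI[of _ _ "[j]"]) auto

text \<open>The group permutes the finite set of roots, and linearity makes the action faithful
  because the roots span.\<close>

lemma finite_W: "finite (W J)"
proof -
  have fin: "finite \<Phi>" and sp: "span \<Phi> = UNIV" using roots by (auto simp: root_system_def)
  have "inj_on (\<lambda>w. restrict w \<Phi>) (W J)"
  proof (rule inj_onI)
    fix w w' assume w: "w \<in> W J" "w' \<in> W J" and eq: "restrict w \<Phi> = restrict w' \<Phi>"
    have "w v = w' v" for v
    proof (rule linear_eq_on[of w w' v \<Phi>])
      show "v \<in> span \<Phi>" by (simp add: sp)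
      fix b assume "b \<in> \<Phi>"
      then show "w b = w' b" using eq by (metis restrict_apply')
    qed (use w W_props(1) in auto)
    then show "w = w'" by auto
  qed
  moreover have "(\<lambda>w. restrict w \<Phi>) ` W J \<subseteq> \<Phi> \<rightarrow>\<^sub>E \<Phi>"
    by (auto simp: W_def wprod_root)
  moreover have "finite (\<Phi> \<rightarrow>\<^sub>E \<Phi>)" by (intro finite_PiE fin)
  ultimately show ?thesis by (meson finite_imageD finite_subset)
qed

text \<open>The vector that represents the linear functional with value 1 on every simple
  root.\<close>

lemma strictly_dominant_exists: "\<exists>\<rho>. \<forall>j. \<rho> \<bullet> \<alpha> j > 0"
proof -
  obtain f :: "'a \<Rightarrow> real" where f: "linear f" "\<forall>x\<in>range \<alpha>. f x = 1"
    using linear_independent_extend[OF independent_alpha, of "\<lambda>_. 1"] by auto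
  have "f x = (\<Sum>b\<in>Basis. f b *\<^sub>R b) \<bullet> x" for x
  proof -
    have "f x = f (\<Sum>b\<in>Basis. (x \<bullet> b) *\<^sub>R b)" by (simp add: euclidean_representation)
    also have "\<dots> = (\<Sum>b\<in>Basis. (x \<bullet> b) * f b)" using f(1) by (simp add: linear_sum linear_scale)
    finally show ?thesis by (simp add: inner_sum_left inner_commute[of x] mult.commute)
  qed
  then show ?thesis using f(2) by (intro exI[of _ "\<Sum>b\<in>Basis. f b *\<^sub>R b"]) (metis rangeI zero_less_one)
qed

text \<open>Take the orbit point with the largest inner product with a strictly dominant vector: a
  negative pairing with \<alpha> j would let \<open>s j\<close> increase that product
  further.\<close>

lemma dominant_translate: "\<exists>w\<in>W J. w x \<in> dominant J"
proof -
  obtain \<rho> where \<rho>: "\<And>j. \<rho> \<bullet> \<alpha> j > 0" using strictly_dominant_exists by blast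
  have "finite (W J)" "W J \<noteq> {}" using finite_W W_id by auto
  then have fin: "finite ((\<lambda>u. u x \<bullet> \<rho>) ` W J)" "(\<lambda>u. u x \<bullet> \<rho>) ` W J \<noteq> {}" by auto
  obtain w where w: "w \<in> W J" "\<And>u. u \<in> W J \<Longrightarrow> u x \<bullet> \<rho> \<le> w x \<bullet> \<rho>"
    using Max_in[OF fin] Max_ge[OF fin(1)] by auto
  have "0 \<le> w x \<bullet> \<alpha> j" if j: "j \<in> J" for j
  proof (rule ccontr)
    assume n: "\<not> 0 \<le> w x \<bullet> \<alpha> j"
    have "s j \<circ> w \<in> W J" using W_comp[OF W_refl[OF j] w(1)] .
    then have "s j (w x) \<bullet> \<rho> \<le> w x \<bullet> \<rho>" using w(2)[of "s j \<circ> w"] by simp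
    then have "0 \<le> (w x \<bullet> coroot (\<alpha> j)) * (\<rho> \<bullet> \<alpha> j)"
      by (simp add: refl_along_def inner_diff_left inner_commute[of \<rho>])
    moreover have "w x \<bullet> coroot (\<alpha> j) < 0"
      using n alpha_inner_pos[of j] by (simp add: inner_coroot divide_less_0_iff)
    ultimately show False using \<rho>[of j] by (simp add: zero_le_mult_iff)
  qed
  then show ?thesis using w(1) by (auto simp: dominant_def)
qed

text \<open>Each of the two points lies below the other in the order given by the cone, and the cone
  contains no line.\<close>

lemma dominant_orbit_unique:
  assumes "w \<in> W J" "y \<in> dominant J" "w y \<in> dominant J" shows "w y = y"
proof -
  obtain w' where w': "w' \<in> W J" "w' (w y) = y" using W_inverse[OF assms(1)] by metis
  have "y - w y \<in> rcone J" using W_props(6)[OF assms(1,2)] .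
  moreover have "- (y - w y) \<in> rcone J" using W_props(6)[OF w'(1) assms(3)] w'(2) by simp
  ultimately show ?thesis using rcone_pointed[of "y - w y" J] by simp
qed

section \<open>Weight polytopes and their dominant part\<close>

definition polytope :: "'n set \<Rightarrow> 'a \<Rightarrow> 'a set"
  where "polytope J x = convex hull ((\<lambda>w. w x) ` W J)"

lemma weight_polytope_eq: "weight_polytope \<alpha> J x = polytope J x"
  by (simp add: weight_polytope_def polytope_def parabolic_eq_W)

lemma compact_polytope: "compact (polytope J x)"
  unfolding polytope_def by (intro compact_convex_hull finite_imp_compact finite_imageI finite_W)

lemma orbit_in_polytope: "w \<in> W J \<Longrightarrow> w x \<in> polytope J x"
  unfolding polytope_def by (rule hull_inc) auto

lemma polytope_nonempty: "x \<in> polytope J x"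
  using orbit_in_polytope[OF W_id] by simp

lemma W_polytope:
  assumes "w \<in> W J" "p \<in> polytope J x" shows "w p \<in> polytope J x"
proof -
  have "w ` polytope J x = convex hull (w ` (\<lambda>w. w x) ` W J)"
    unfolding polytope_def by (rule convex_hull_linear_image[OF W_props(1)[OF assms(1)]])
  also have "\<dots> \<subseteq> polytope J x"
    unfolding polytope_def
    by (rule hull_mono) (use W_comp[OF assms(1)] in \<open>auto simp: image_iff intro!: bexI[of _ "w \<circ> _"]\<close>)
  finally show ?thesis using assms(2) by auto
qed

text \<open>The cone condition is convex and holds on the orbit, hence on its hull. Conversely,
  suppose a functional \<open>a\<close> separates \<open>y\<close> from the polytope, and let
  \<open>u\<close> carry \<open>- a\<close> to a dominant vector. Then \<open>- a \<bullet> y \<le>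
  u (- a) \<bullet> y \<le> u (- a) \<bullet> x\<close>, and the last term is the value of
  \<open>- a\<close> at an orbit point of \<open>x\<close>, which contradicts the
  separation.\<close>

lemma polytope_dominant:
  assumes x: "x \<in> dominant J"
  shows "polytope J x \<inter> dominant J = {y \<in> dominant J. x - y \<in> rcone J}"
proof (intro equalityI subsetI)
  fix y assume y: "y \<in> polytope J x \<inter> dominant J"
  have "convex {y. x - y \<in> rcone J}"
  proof -
    have "{y. x - y \<in> rcone J} = (\<lambda>z. x - z) ` rcone J" by (auto simp: image_iff) (metis diff_diff_eq2 add_diff_cancel_left')
    then show ?thesis
      using convex_translation[OF convex_negations[OF convex_rcone], of x J] by (simp add: image_image)
  qed
  moreover have "(\<lambda>w. w x) ` W J \<subseteq> {y. x - y \<in> rcone J}" using W_props(6)[OF _ x] by auto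
  ultimately have "polytope J x \<subseteq> {y. x - y \<in> rcone J}" unfolding polytope_def by (intro hull_minimal)
  then show "y \<in> {y \<in> dominant J. x - y \<in> rcone J}" using y by auto
next
  fix y assume y: "y \<in> {y \<in> dominant J. x - y \<in> rcone J}"
  have "y \<in> polytope J x"
  proof (rule ccontr)
    assume "y \<notin> polytope J x"
    moreover have "convex (polytope J x)" "closed (polytope J x)"
      by (auto simp: polytope_def compact_polytope[unfolded polytope_def] compact_imp_closed)
    ultimately obtain a b where ab: "a \<bullet> y < b" "\<And>p. p \<in> polytope J x \<Longrightarrow> a \<bullet> p > b"
      using separating_hyperplane_closed_point[of "polytope J x" y] by auto
    obtain u where u: "u \<in> W J" "u (- a) \<in> dominant J" using dominant_translate by blast
    obtain u' where u': "u' \<in> W J" "\<And>v. u' (u v) = v" "\<And>v. u (u' v) = v" using W_inverse[OF u(1)] by metis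
    have "u (- a) - u' (u (- a)) \<in> rcone J" using W_props(6)[OF u'(1) u(2)] .
    then have "0 \<le> y \<bullet> (u (- a) - - a)" using y u'(2) by (intro dominant_inner_rcone[of y J]) auto
    moreover have "0 \<le> u (- a) \<bullet> (x - y)" using y u(2) by (intro dominant_inner_rcone[of _ J]) auto
    moreover have "u (- a) \<bullet> x = - a \<bullet> u' x" using W_props(2)[OF u(1), of "- a" "u' x"] u'(3) by simp
    moreover have "a \<bullet> u' x > b" using ab(2) orbit_in_polytope[OF u'(1)] by blast
    ultimately show False using ab(1) by (simp add: inner_diff_right inner_add_right inner_commute[of y])
  qed
  then show "y \<in> polytope J x \<inter> dominant J" using y by auto
qed

lemma polytope_union: "polytope J x = (\<Union>w\<in>W J. w -` (polytope J x \<inter> dominant J))"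
proof (intro equalityI subsetI)
  fix p assume p: "p \<in> polytope J x"
  then show "p \<in> (\<Union>w\<in>W J. w -` (polytope J x \<inter> dominant J))"
    using dominant_translate[of J p] W_polytope by fastforce
next
  fix p assume "p \<in> (\<Union>w\<in>W J. w -` (polytope J x \<inter> dominant J))"
  then obtain w where w: "w \<in> W J" "w p \<in> polytope J x" by auto
  obtain w' where "w' \<in> W J" "w' (w p) = p" using W_inverse[OF w(1)] by metis
  then show "p \<in> polytope J x" using W_polytope w(2) by metis
qed

section \<open>The fundamental region of a weight polytope\<close>

text \<open>The component \<open>z\<close> of \<alpha> i orthogonal to the other simple roots of
  \<open>J\<close> is the dual vector up to scale. Its coefficient at \<alpha> i is 1, so the
  rescaled coefficient is positive.\<close>

lemma dual_coordinates_exist: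
  assumes i: "i \<in> J"
  shows "\<exists>m. m i > 0 \<and> (\<forall>j\<in>J. (\<Sum>k\<in>J. m k *\<^sub>R \<alpha> k) \<bullet> coroot (\<alpha> j) = (if i = j then 1 else 0))"
proof -
  obtain y z where y: "y \<in> span (\<alpha> ` (J - {i}))"
    and z: "\<And>w. w \<in> span (\<alpha> ` (J - {i})) \<Longrightarrow> orthogonal z w" and yz: "\<alpha> i = y + z"
    using orthogonal_subspace_decomp_exists[of "\<alpha> ` (J - {i})" "\<alpha> i"] by blast
  obtain c where c: "y = (\<Sum>k\<in>J - {i}. c k *\<^sub>R \<alpha> k)" using y span_alpha_image by blast
  have zeq: "z = (\<Sum>k\<in>J. (if k = i then 1 else - c k) *\<^sub>R \<alpha> k)"
  proof -
    have "(\<Sum>k\<in>J - {i}. (if k = i then 1 else - c k) *\<^sub>R \<alpha> k) = - y"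
      unfolding c sum_negf[symmetric] by (rule sum.cong) auto
    then show ?thesis using i yz by (simp add: sum.remove[of J i])
  qed
  have "z \<noteq> 0"
  proof
    assume "z = 0"
    then have "(\<Sum>k\<in>UNIV. (if k \<in> J then if k = i then 1 else - c k else 0) *\<^sub>R \<alpha> k) = 0"
      using zeq sum_restrict[of "\<lambda>k. if k = i then 1 else - c k" J] by simp
    from sum_alpha_eq_0[OF this, of i] show False using i by simp
  qed
  then have zz: "z \<bullet> z > 0" by simp
  have zj: "z \<bullet> \<alpha> j = (if i = j then z \<bullet> z else 0)" if "j \<in> J" for j
  proof (cases "i = j")
    case True
    then show ?thesis using z[OF y] yz by (metis inner_add_right orthogonal_def add.left_neutral)
  next
    case False
    then have "\<alpha> j \<in> span (\<alpha> ` (J - {i}))" using that by (auto intro: span_base)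
    then show ?thesis using z False by (simp add: orthogonal_def)
  qed
  \<comment> \<open>Since \<open>z \<bullet> \<alpha> i = z \<bullet> z\<close>, this factor makes
    the pairing with the coroot of \<alpha> i equal to 1.\<close>
  define k where "k = (\<alpha> i \<bullet> \<alpha> i) / (2 * (z \<bullet> z))"
  have k: "k > 0" using zz alpha_inner_pos by (simp add: k_def)
  define m where "m l = k * (if l = i then 1 else - c l)" for l
  have "(\<Sum>l\<in>J. m l *\<^sub>R \<alpha> l) = k *\<^sub>R z"
    unfolding zeq scaleR_sum_right m_def by simp
  then have "(\<Sum>k\<in>J. m k *\<^sub>R \<alpha> k) \<bullet> coroot (\<alpha> j) = (if i = j then 1 else 0)" if "j \<in> J" for j
    using zj[OF that] zz alpha_inner_pos[of j] by (simp add: inner_coroot k_def)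
  moreover have "m i > 0" using k by (simp add: m_def)
  ultimately show ?thesis by blast
qed

text \<open>The simple-root coordinates of the fundamental weight \<open>i\<close> of the subsystem
  on \<open>J\<close>; together they form the inverse of the Cartan submatrix on
  \<open>J\<close>.\<close>

definition mu :: "'n set \<Rightarrow> 'n \<Rightarrow> 'n \<Rightarrow> real"
  where "mu J i = (SOME m. m i > 0 \<and>
    (\<forall>j\<in>J. (\<Sum>k\<in>J. m k *\<^sub>R \<alpha> k) \<bullet> coroot (\<alpha> j) = (if i = j then 1 else 0)))"

definition omega :: "'n set \<Rightarrow> 'n \<Rightarrow> 'a"
  where "omega J i = (\<Sum>k\<in>J. mu J i k *\<^sub>R \<alpha> k)"

lemma mu_props:
  assumes "i \<in> J"
  shows "mu J i i > 0" "j \<in> J \<Longrightarrow> omega J i \<bullet> coroot (\<alpha> j) = (if i = j then 1 else 0)"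
  using someI_ex[OF dual_coordinates_exist[OF assms]] unfolding mu_def[symmetric] omega_def by auto

lemma orthogonal_to_span_eq_0:
  assumes "v \<in> span (\<alpha> ` J)" "\<And>j. j \<in> J \<Longrightarrow> v \<bullet> coroot (\<alpha> j) = 0" shows "v = 0"
proof -
  obtain c where c: "v = (\<Sum>i\<in>J. c i *\<^sub>R \<alpha> i)" using assms(1) span_alpha_image by blast
  have "v \<bullet> \<alpha> j = 0" if "j \<in> J" for j using assms(2)[OF that] alpha_nz by (simp add: inner_coroot)
  then have "v \<bullet> v = 0" by (subst (2) c) (simp add: inner_sum_right)
  then show ?thesis by simp
qed

lemma omega_span: "omega J i \<in> span (\<alpha> ` J)"
  unfolding omega_def by (intro span_sum span_scale span_base) auto

text \<open>The left inverse equation is the duality of \<open>omega J\<close> with the coroots. For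
  the right one, \<alpha> i is expanded in the \<open>omega J k\<close> with coefficients from row
  \<open>i\<close>, which pairing with the coroots confirms, and simple-root coordinates are
  compared.\<close>

sublocale principal_invertible "cartan_matrix \<alpha>" mu
proof
  fix i j :: 'n and J assume i: "i \<in> J"
  show "mu J i i \<noteq> 0" using mu_props(1)[OF i] by simp
  assume j: "j \<in> J"
  show "(\<Sum>k\<in>J. mu J i k * cartan_matrix \<alpha> $ k $ j) = (if i = j then 1 else 0)"
    using mu_props(2)[OF i j] by (simp add: omega_def inner_sum_left cartan_matrix_def)
  let ?C = "cartan_matrix \<alpha>"
  have "(\<Sum>k\<in>J. ?C $ i $ k *\<^sub>R omega J k) - \<alpha> i = 0"
  proof (rule orthogonal_to_span_eq_0)
    show "(\<Sum>k\<in>J. ?C $ i $ k *\<^sub>R omega J k) - \<alpha> i \<in> span (\<alpha> ` J)"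
      using i by (intro span_diff span_sum span_scale omega_span) (auto intro: span_base)
    fix l assume l: "l \<in> J"
    have "(\<Sum>k\<in>J. ?C $ i $ k *\<^sub>R omega J k) \<bullet> coroot (\<alpha> l) = (\<Sum>k\<in>J. if k = l then ?C $ i $ l else 0)"
      unfolding inner_sum_left by (rule sum.cong) (auto simp: mu_props(2) l)
    then show "((\<Sum>k\<in>J. ?C $ i $ k *\<^sub>R omega J k) - \<alpha> i) \<bullet> coroot (\<alpha> l) = 0"
      using l by (simp add: inner_diff_left cartan_matrix_def)
  qed
  then have "(\<Sum>k\<in>J. ?C $ i $ k *\<^sub>R omega J k) = \<alpha> i" by simp
  moreover have "(\<Sum>k\<in>J. ?C $ i $ k *\<^sub>R omega J k) = (\<Sum>l\<in>J. (\<Sum>k\<in>J. ?C $ i $ k * mu J k l) *\<^sub>R \<alpha> l)"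
    unfolding omega_def scaleR_sum_right scaleR_sum_left by (subst sum.swap) simp
  moreover have "\<alpha> i = (\<Sum>l\<in>J. (if i = l then 1 else 0) *\<^sub>R \<alpha> l)"
  proof -
    have "(\<Sum>l\<in>J. (if i = l then 1 else 0) *\<^sub>R \<alpha> l) = (\<Sum>l\<in>J. if l = i then \<alpha> i else 0)"
      by (rule sum.cong) auto
    then show ?thesis using i by simp
  qed
  ultimately have "(\<Sum>l\<in>J. (\<Sum>k\<in>J. ?C $ i $ k * mu J k l) *\<^sub>R \<alpha> l) = (\<Sum>l\<in>J. (if i = l then 1 else 0) *\<^sub>R \<alpha> l)"
    by simp
  then have "(\<Sum>l\<in>UNIV. (if l \<in> J then \<Sum>k\<in>J. ?C $ i $ k * mu J k l else 0) *\<^sub>R \<alpha> l)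
      = (\<Sum>l\<in>UNIV. (if l \<in> J then if i = l then 1 else 0 else 0) *\<^sub>R \<alpha> l)"
    using sum_restrict[of "\<lambda>l. \<Sum>k\<in>J. ?C $ i $ k * mu J k l" J]
      sum_restrict[of "\<lambda>l. if i = l then 1 else 0" J] by simp
  from sum_alpha_unique[OF this, of j]
  show "(\<Sum>k\<in>J. ?C $ i $ k * mu J k j) = (if i = j then 1 else 0)" using j by simp
qed

section \<open>Fundamental weights and coordinates given by coroot pairings\<close>

lemma fund_weight_pairing: "fund_weight \<alpha> i \<bullet> coroot (\<alpha> j) = (if i = j then 1 else 0)"
proof -
  have "\<exists>!w. \<forall>j. w \<bullet> coroot (\<alpha> j) = (if i = j then 1 else 0)"
  proof (rule ex1I[of _ "omega UNIV i"])
    show "\<forall>j. omega UNIV i \<bullet> coroot (\<alpha> j) = (if i = j then 1 else 0)" using mu_props(2)[of i UNIV] by simp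
    fix w assume w: "\<forall>j. w \<bullet> coroot (\<alpha> j) = (if i = j then 1 else 0)"
    have "w - omega UNIV i = 0"
      by (rule orthogonal_to_span_eq_0[of _ UNIV])
         (use w mu_props(2)[of i UNIV] span_alpha in \<open>auto simp: inner_diff_left\<close>)
    then show "w = omega UNIV i" by simp
  qed
  from theI'[OF this] show ?thesis unfolding fund_weight_def by blast
qed

lemma weight_pairing: "weight \<alpha> l \<bullet> coroot (\<alpha> j) = l $ j"
proof -
  have "weight \<alpha> l \<bullet> coroot (\<alpha> j) = (\<Sum>i\<in>UNIV. if i = j then l $ j else 0)"
    unfolding weight_def inner_sum_left by (rule sum.cong) (auto simp: fund_weight_pairing)
  then show ?thesis by simp
qed

lemma scaled_nonneg_iff: "0 < a \<Longrightarrow> 0 \<le> t * a / 2 \<longleftrightarrow> 0 \<le> (t :: real)"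
  by (simp add: zero_le_mult_iff)

lemma weight_inner: "weight \<alpha> l \<bullet> \<alpha> j = l $ j * (\<alpha> j \<bullet> \<alpha> j) / 2"
  using weight_pairing[of l j] alpha_inner_pos[of j] by (simp add: inner_coroot field_simps)

lemma weight_inner_nonneg: "0 \<le> weight \<alpha> l \<bullet> \<alpha> j \<longleftrightarrow> 0 \<le> l $ j"
  unfolding weight_inner by (rule scaled_nonneg_iff[OF alpha_inner_pos])

lemma eq_if_pairings_eq:
  assumes "\<And>j. v \<bullet> coroot (\<alpha> j) = w \<bullet> coroot (\<alpha> j)" shows "v = w"
  using orthogonal_to_span_eq_0[of "v - w" UNIV] assms span_alpha by (simp add: inner_diff_left)

lemma weight_add: "weight \<alpha> (l + k) = weight \<alpha> l + weight \<alpha> k"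
  and weight_scaleR: "weight \<alpha> (c *\<^sub>R l) = c *\<^sub>R weight \<alpha> l"
  by (simp_all add: weight_def scaleR_left_distrib sum.distrib scaleR_sum_right)

text \<open>The reason why rows of the Cartan matrix are the directions of differentiation: moving
  the coordinates along row \<open>i\<close> moves the weight along \<alpha> i.\<close>

lemma alpha_eq_weight: "\<alpha> i = weight \<alpha> (cartan_matrix \<alpha> $ i)"
  by (rule eq_if_pairings_eq) (simp add: weight_pairing cartan_matrix_def)

text \<open>The dominant part of the polytope under the point reflection that replaces a point by
  its difference from \<open>x\<close>. Now the cone is fixed, and \<open>x\<close> enters only
  through the bounds on the pairings with the roots of \<open>J\<close>.\<close>

definition region :: "'n set \<Rightarrow> 'a \<Rightarrow> 'a set"
  where "region J x = {y \<in> rcone J. x - y \<in> dominant J}"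

lemma omega_inner: "i \<in> J \<Longrightarrow> k \<in> J \<Longrightarrow> \<alpha> k \<bullet> omega J i = (if i = k then (\<alpha> k \<bullet> \<alpha> k) / 2 else 0)"
  using mu_props(2)[of i J k] alpha_inner_pos[of k] inner_commute[of "\<alpha> k" "omega J i"]
  unfolding inner_coroot by (auto simp: field_simps)

text \<open>The \<open>omega J i\<close> are dual to the simple roots up to positive factors. As
  half-spaces cut out of its span, the cone is visibly closed.\<close>

lemma rcone_eq: "rcone J = span (\<alpha> ` J) \<inter> (\<Inter>i\<in>J. {y. 0 \<le> omega J i \<bullet> y})"
proof -
  have pos: "0 \<le> omega J i \<bullet> (\<Sum>k\<in>J. t k *\<^sub>R \<alpha> k) \<longleftrightarrow> 0 \<le> t i" if i: "i \<in> J" for t i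
  proof -
    have "omega J i \<bullet> (\<Sum>k\<in>J. t k *\<^sub>R \<alpha> k) = (\<Sum>k\<in>J. if k = i then t i * (\<alpha> i \<bullet> \<alpha> i) / 2 else 0)"
      unfolding inner_sum_right by (rule sum.cong) (auto simp: omega_inner i inner_commute[of "omega J i"])
    then have "omega J i \<bullet> (\<Sum>k\<in>J. t k *\<^sub>R \<alpha> k) = t i * (\<alpha> i \<bullet> \<alpha> i) / 2" using i by simp
    then show ?thesis using scaled_nonneg_iff[OF alpha_inner_pos] by metis
  qed
  show ?thesis
  proof (intro equalityI subsetI)
    fix y assume "y \<in> rcone J"
    then obtain t where "y = (\<Sum>k\<in>J. t k *\<^sub>R \<alpha> k)" "\<forall>k\<in>J. 0 \<le> t k" by (auto simp: rcone_def)
    then show "y \<in> span (\<alpha> ` J) \<inter> (\<Inter>i\<in>J. {y. 0 \<le> omega J i \<bullet> y})"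
      using pos span_alpha_image by auto
  next
    fix y assume y: "y \<in> span (\<alpha> ` J) \<inter> (\<Inter>i\<in>J. {y. 0 \<le> omega J i \<bullet> y})"
    then obtain t where t: "y = (\<Sum>k\<in>J. t k *\<^sub>R \<alpha> k)" using span_alpha_image by auto
    then have "\<forall>k\<in>J. 0 \<le> t k" using y pos by auto
    then show "y \<in> rcone J" unfolding rcone_def using t by auto
  qed
qed

lemma closed_rcone: "closed (rcone J)"
  unfolding rcone_eq by (intro closed_Int closed_INT ballI closed_halfspace_ge) auto

lemma closed_dominant: "closed (dominant J)"
proof -
  have "dominant J = (\<Inter>j\<in>J. {x. 0 \<le> \<alpha> j \<bullet> x})" by (auto simp: dominant_def inner_commute)
  then show ?thesis by (simp add: closed_INT closed_halfspace_ge)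
qed

lemma closed_region: "closed (region J x)"
proof -
  have "region J x = rcone J \<inter> (\<lambda>y. x - y) -` dominant J" by (auto simp: region_def)
  moreover have "closed ((\<lambda>y. x - y) -` dominant J)"
    by (rule closed_vimage[OF closed_dominant]) (intro continuous_intros)
  ultimately show ?thesis by (simp add: closed_Int closed_rcone)
qed

lemma borel_region [measurable]: "region J x \<in> sets borel"
  using closed_region by (rule borel_closed)

text \<open>A dominant \<open>x - y\<close> pairs nonnegatively with \<open>y\<close> in the cone,
  so \<open>y \<bullet> y \<le> x \<bullet> y\<close>, and Cauchy-Schwarz bounds the norm of
  \<open>y\<close> by that of \<open>x\<close>.\<close>

lemma bounded_region: "bounded (region J x)"
proof -
  have "norm y \<le> norm x" if "y \<in> region J x" for y
  proof -
    have "0 \<le> (x - y) \<bullet> y" using that dominant_inner_rcone by (auto simp: region_def)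
    then have "norm y * norm y \<le> x \<bullet> y" by (simp add: inner_diff_left norm_eq_sqrt_inner)
    also have "\<dots> \<le> norm x * norm y" by (rule norm_cauchy_schwarz)
    finally show ?thesis by (metis mult_right_le_imp_le norm_ge_zero norm_zero zero_less_norm_iff)
  qed
  then show ?thesis by (auto simp: bounded_iff)
qed

section \<open>Slices of the region along a simple root\<close>

abbreviation M :: "'n set \<Rightarrow> 'a measure" where "M J \<equiv> span_measure (\<alpha> ` J)"

lemma region_finite: "emeasure (M J) (region J x) < \<infinity>"
  by (rule span_measure_bounded_finite[OF independent_alpha_image bounded_region borel_region])

lemma region_cong: "(\<And>j. j \<in> J \<Longrightarrow> x \<bullet> \<alpha> j = x' \<bullet> \<alpha> j) \<Longrightarrow> region J x = region J x'"
  by (auto simp: region_def dominant_def inner_diff_left)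

text \<open>Apart from the sign of \<open>t\<close>, the slice at height \<open>t\<close> sees
  \<open>x\<close> only through \<open>x - t *\<^sub>R \<alpha> i\<close>; shifting \<open>x\<close>
  along \<alpha> i therefore just shifts the heights.\<close>

lemma region_shift_slice:
  assumes i: "i \<in> J" and y: "y \<in> span (\<alpha> ` (J - {i}))"
  shows "y + t *\<^sub>R \<alpha> i \<in> region J x \<longleftrightarrow> 0 \<le> t \<and> y \<in> rcone (J - {i}) \<and> (x - t *\<^sub>R \<alpha> i) - y \<in> dominant J"
proof -
  obtain c where c: "y = (\<Sum>k\<in>J - {i}. c k *\<^sub>R \<alpha> k)" using y span_alpha_image by blast
  have e: "y + t *\<^sub>R \<alpha> i = (\<Sum>k\<in>J. (c(i := t)) k *\<^sub>R \<alpha> k)"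
    using i by (simp add: sum.remove[of J i] c)
  have u: "c' k = d k" if "(\<Sum>k\<in>K. c' k *\<^sub>R \<alpha> k) = (\<Sum>k\<in>K. d k *\<^sub>R \<alpha> k)" "k \<in> K" for c' d K k
    using sum_alpha_unique[of "\<lambda>k. if k \<in> K then c' k else 0" "\<lambda>k. if k \<in> K then d k else 0" k] that
      sum_restrict[of c' K] sum_restrict[of d K] by simp
  have "y + t *\<^sub>R \<alpha> i \<in> rcone J \<longleftrightarrow> (\<forall>k\<in>J. 0 \<le> (c(i := t)) k)"
  proof
    assume "y + t *\<^sub>R \<alpha> i \<in> rcone J"
    then obtain d where d: "y + t *\<^sub>R \<alpha> i = (\<Sum>k\<in>J. d k *\<^sub>R \<alpha> k)" "\<forall>k\<in>J. 0 \<le> d k" by (auto simp: rcone_def)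
    then show "\<forall>k\<in>J. 0 \<le> (c(i := t)) k" using u[of "c(i := t)" J d] e by metis
  qed (auto simp: rcone_def e)
  moreover have "y \<in> rcone (J - {i}) \<longleftrightarrow> (\<forall>k\<in>J - {i}. 0 \<le> c k)"
  proof
    assume "y \<in> rcone (J - {i})"
    then obtain d where d: "y = (\<Sum>k\<in>J - {i}. d k *\<^sub>R \<alpha> k)" "\<forall>k\<in>J - {i}. 0 \<le> d k" by (auto simp: rcone_def)
    then show "\<forall>k\<in>J - {i}. 0 \<le> c k" using u[of c "J - {i}" d] c by metis
  qed (auto simp: rcone_def c)
  ultimately have "y + t *\<^sub>R \<alpha> i \<in> rcone J \<longleftrightarrow> 0 \<le> t \<and> y \<in> rcone (J - {i})" using i by auto
  then show ?thesis by (auto simp: region_def algebra_simps)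
qed

text \<open>Combinations of the other simple roots with nonnegative coefficients pair nonpositively
  with \<alpha> i, so subtracting them preserves the inequality at \<open>i\<close>. The slice thus
  becomes the region of the smaller index set.\<close>

lemma region_remove:
  assumes i: "i \<in> J" and x: "0 \<le> x \<bullet> \<alpha> i"
  shows "{y \<in> rcone (J - {i}). x - y \<in> dominant J} = region (J - {i}) x"
proof -
  have "0 \<le> (x - y) \<bullet> \<alpha> i" if y: "y \<in> rcone (J - {i})" for y
  proof -
    obtain t where t: "y = (\<Sum>k\<in>J - {i}. t k *\<^sub>R \<alpha> k)" "\<forall>k\<in>J - {i}. 0 \<le> t k" using y by (auto simp: rcone_def)
    have "y \<bullet> \<alpha> i \<le> 0" unfolding t(1) inner_sum_left
      using t(2) alpha_inner_nonpos[of _ i] by (auto intro!: sum_nonpos mult_nonneg_nonpos)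
    then show ?thesis using x by (simp add: inner_diff_left)
  qed
  then show ?thesis using i by (auto simp: region_def dominant_def)
qed

text \<open>An integrated form of the derivative formula, with the antiderivative \<open>F\<close>
  supplied. By Fubini both sides are integrals over slices; the shifted region has the old slices
  together with those at \<open>x + u *\<^sub>R \<alpha> i\<close> for \<open>u\<close> between 0
  and \<open>s\<close>, whose measures integrate to \<open>F s - F 0\<close>.\<close>

lemma region_shift:
  fixes s :: real
  assumes i: "i \<in> J" and s: "0 \<le> s" and x: "0 \<le> x \<bullet> \<alpha> i"
    and F: "\<And>u. u \<in> {0..s} \<Longrightarrow> (F has_real_derivative f u) (at u)"
    and f: "\<And>u. u \<in> {0..s} \<Longrightarrow> emeasure (M (J - {i})) (region (J - {i}) (x + u *\<^sub>R \<alpha> i)) = ennreal (f u)"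
    and f0: "\<And>u. u \<in> {0..s} \<Longrightarrow> 0 \<le> f u" and fm: "f \<in> borel_measurable borel"
  shows "emeasure (M J) (region J (x + s *\<^sub>R \<alpha> i)) = emeasure (M J) (region J x) + ennreal (F s - F 0)"
proof -
  let ?N = "M (J - {i})"
  define h where "h x t = (\<integral>\<^sup>+y. indicator (region J x) (y + t *\<^sub>R \<alpha> i) \<partial>?N)" for x t
  define g where "g z = emeasure ?N {y \<in> rcone (J - {i}). z - y \<in> dominant J}" for z
  have ins: "\<alpha> ` J = insert (\<alpha> i) (\<alpha> ` (J - {i}))" "\<alpha> i \<notin> \<alpha> ` (J - {i})"
    using i inj_alpha by (auto dest: injD)
  have hm [measurable]: "h x \<in> borel_measurable borel" for x
    unfolding h_def by (rule borel_measurable_nn_integral_slice) auto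
  have E: "emeasure (M J) (region J x) = (\<integral>\<^sup>+t. h x t \<partial>lborel)" for x
    using nn_integral_span_measure_insert[OF _ ins(2), of "indicator (region J x)"]
    unfolding ins(1)[symmetric] h_def by simp
  have hg: "h x t = (if 0 \<le> t then g (x - t *\<^sub>R \<alpha> i) else 0)" for x t
  proof -
    let ?S = "{y. y + t *\<^sub>R \<alpha> i \<in> region J x}" and ?T = "{y \<in> rcone (J - {i}). (x - t *\<^sub>R \<alpha> i) - y \<in> dominant J}"
    have "closed ((\<lambda>y. y + t *\<^sub>R \<alpha> i) -` region J x)"
      by (rule closed_vimage[OF closed_region]) (intro continuous_intros)
    then have S: "?S \<in> sets borel" by (auto simp: vimage_def)
    have "closed (rcone (J - {i}) \<inter> (\<lambda>y. (x - t *\<^sub>R \<alpha> i) - y) -` dominant J)"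
      by (intro closed_Int closed_rcone closed_vimage[OF closed_dominant] continuous_intros)
    moreover have "rcone (J - {i}) \<inter> (\<lambda>y. (x - t *\<^sub>R \<alpha> i) - y) -` dominant J = ?T" by auto
    ultimately have T: "?T \<in> sets borel" by simp
    have "h x t = (\<integral>\<^sup>+y. indicator ?S y \<partial>?N)"
      unfolding h_def by (rule nn_integral_cong) (auto simp: indicator_def)
    also have "\<dots> = emeasure ?N (?S \<inter> span (\<alpha> ` (J - {i})))"
      using S span_measure_inter_span[OF S] by simp
    also have "?S \<inter> span (\<alpha> ` (J - {i})) = (if 0 \<le> t then ?T \<inter> span (\<alpha> ` (J - {i})) else {})"
      using region_shift_slice[OF i] by auto
    also have "emeasure ?N \<dots> = (if 0 \<le> t then g (x - t *\<^sub>R \<alpha> i) else 0)"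
      using span_measure_inter_span[OF T] by (simp add: g_def)
    finally show ?thesis .
  qed
  \<comment> \<open>Counting heights downwards from \<open>r\<close> labels each slice by the point
    \<open>x + u *\<^sub>R \<alpha> i\<close> it depends on, a label shared by the old and the new
    region.\<close>
  have refl: "emeasure (M J) (region J (x + r *\<^sub>R \<alpha> i)) = (\<integral>\<^sup>+u. h (x + r *\<^sub>R \<alpha> i) (r - u) \<partial>lborel)" for r
    unfolding E using nn_integral_real_affine[OF hm, of "-1" "x + r *\<^sub>R \<alpha> i" r] by simp
  have "emeasure (M J) (region J (x + s *\<^sub>R \<alpha> i)) = (\<integral>\<^sup>+u. h (x + s *\<^sub>R \<alpha> i) (s - u) \<partial>lborel)"
    by (rule refl)
  \<comment> \<open>The old slices are those with \<open>u \<le> 0\<close> and the new ones those in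
    \<open>{0..s}\<close>; the doubly counted value \<open>u = 0\<close> is removed as a null
    set.\<close>
  also have "\<dots> = (\<integral>\<^sup>+u. h x (0 - u) + ennreal (f u) * indicator {0..s} u \<partial>lborel)"
  proof (rule nn_integral_cong_AE, rule eventually_mono[OF AE_lborel_singleton[of 0]])
    fix u :: real assume u: "u \<noteq> 0"
    have "g (x + u *\<^sub>R \<alpha> i) = ennreal (f u)" if "u \<in> {0..s}"
    proof -
      have "0 \<le> (x + u *\<^sub>R \<alpha> i) \<bullet> \<alpha> i" using x that by (simp add: inner_left_distrib)
      then show ?thesis unfolding g_def using region_remove[OF i] f[OF that] by simp
    qed
    then show "h (x + s *\<^sub>R \<alpha> i) (s - u) = h x (0 - u) + ennreal (f u) * indicator {0..s} u"
      using u s by (auto simp: hg algebra_simps indicator_def)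
  qed
  also have "\<dots> = (\<integral>\<^sup>+u. h x (0 - u) \<partial>lborel) + (\<integral>\<^sup>+u. ennreal (f u) * indicator {0..s} u \<partial>lborel)"
    using fm by (intro nn_integral_add) auto
  also have "(\<integral>\<^sup>+u. h x (0 - u) \<partial>lborel) = emeasure (M J) (region J x)"
    using refl[of 0] by simp
  also have "(\<integral>\<^sup>+u. ennreal (f u) * indicator {0..s} u \<partial>lborel) = ennreal (F s - F 0)"
    by (rule nn_integral_FTC_Icc[OF fm]) (use F f0 s in \<open>auto intro: has_vector_derivative_at_within\<close>)
  finally show ?thesis .
qed

section \<open>The volume of the region as a polynomial\<close>

abbreviation C where "C \<equiv> cartan_matrix \<alpha>"

definition region_vol :: "'n set \<Rightarrow> real ^ 'n \<Rightarrow> real"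
  where "region_vol J l = measure (M J) (region J (weight \<alpha> l))"

lemma emeasure_region: "emeasure (M J) (region J (weight \<alpha> l)) = ennreal (region_vol J l)"
  unfolding region_vol_def using region_finite[of J "weight \<alpha> l"] by (intro emeasure_eq_ennreal_measure) auto

lemma region_vol_cong: "(\<And>j. j \<in> J \<Longrightarrow> l $ j = l' $ j) \<Longrightarrow> region_vol J l = region_vol J l'"
  unfolding region_vol_def using region_cong[of J "weight \<alpha> l" "weight \<alpha> l'"] by (simp add: weight_inner)

lemma region_vol_scale:
  assumes "r > 0" shows "region_vol J (r *\<^sub>R l) = r ^ card J * region_vol J l"
proof -
  let ?x = "weight \<alpha> l"
  have dom: "r *\<^sub>R x - r *\<^sub>R y \<in> dominant J \<longleftrightarrow> x - y \<in> dominant J" for x y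
    using assms by (simp add: dominant_def scaleR_diff_right[symmetric] zero_le_mult_iff)
  have con: "r *\<^sub>R y \<in> rcone J \<longleftrightarrow> y \<in> rcone J" for y
    using rcone_scale[of r y J] rcone_scale[of "1 / r" "r *\<^sub>R y" J] assms by auto
  have "{y. r *\<^sub>R y \<in> region J (r *\<^sub>R ?x)} = region J ?x"
    by (auto simp: region_def dom con)
  then have "emeasure (M J) (region J (r *\<^sub>R ?x)) = ennreal (r ^ card (\<alpha> ` J)) * emeasure (M J) (region J ?x)"
    using span_measure_scale[OF _ assms, of "\<alpha> ` J" "region J (r *\<^sub>R ?x)"] by simp
  then have "ennreal (region_vol J (r *\<^sub>R l)) = ennreal (r ^ card J * region_vol J l)"
    using assms inj_alpha
    by (simp add: emeasure_region weight_scaleR[symmetric] card_image inj_on_subset ennreal_mult region_vol_def)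
  then show ?thesis using assms by (subst (asm) ennreal_inj) (auto simp: region_vol_def)
qed

lemma region_vol_eq:
  "(\<And>j. j \<in> J \<Longrightarrow> 0 \<le> l $ j) \<Longrightarrow> region_vol J l = peval (vpoly J) l"
proof (induction "card J" arbitrary: J l)
  case 0
  then have J: "J = {}" by simp
  have "region {} (weight \<alpha> l) = {0}" by (auto simp: region_def rcone_def dominant_def)
  moreover have "emeasure (span_measure {}) {0 :: 'a} = 1"
    using nn_integral_span_measure_empty[of "indicator {0 :: 'a}"] by simp
  ultimately show ?case by (simp add: J region_vol_def measure_def vpoly_empty)
next
  case (Suc r)
  define d where "d l = region_vol J l - peval (vpoly J) l" for l
  have shift_pos: "d (l + t *\<^sub>R C $ i) = d l"
    if i: "i \<in> J" and t: "0 \<le> t" and l0: "\<And>j. j \<in> J \<Longrightarrow> 0 \<le> l $ j"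
      and l1: "\<And>j. j \<in> J \<Longrightarrow> 0 \<le> (l + t *\<^sub>R C $ i) $ j" for i t l
  proof -
    define F where "F u = peval (vpoly J) (l + u *\<^sub>R C $ i)" for u
    define f where "f u = peval (vpoly (J - {i})) (l + u *\<^sub>R C $ i)" for u
    have F: "(F has_real_derivative f u) (at u)" for u
      unfolding F_def f_def using peval_has_derivative[of "vpoly J" l "C $ i" u] by (simp add: pdir_vpoly[OF i])
    have f: "f u = region_vol (J - {i}) (l + u *\<^sub>R C $ i)" if u: "u \<in> {0..t}" for u
      unfolding f_def
    proof (rule Suc(1)[symmetric])
      show "r = card (J - {i})" using Suc(2) i by simp
      fix j assume "j \<in> J - {i}"
      then have a: "0 \<le> l $ j" "0 \<le> l $ j + t * C $ i $ j" using l0 l1[of j] by auto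
      \<comment> \<open>Each coordinate is affine in \<open>u\<close>, so nonnegativity at both ends
        of the move gives it in between.\<close>
      have "0 \<le> u * C $ i $ j \<or> t * C $ i $ j \<le> u * C $ i $ j"
        using u by (cases "0 \<le> C $ i $ j") (auto simp: mult_right_mono_neg)
      then show "0 \<le> (l + u *\<^sub>R C $ i) $ j" using a by auto
    qed
    have f0: "0 \<le> f u" if "u \<in> {0..t}" for u using f[OF that] by (simp add: region_vol_def)
    have fm: "f \<in> borel_measurable borel"
      unfolding f_def
      by (intro borel_measurable_continuous_onI continuous_on_compose2[OF peval_continuous] continuous_intros) auto
    have w: "weight \<alpha> (l + u *\<^sub>R C $ i) = weight \<alpha> l + u *\<^sub>R \<alpha> i" for u
      by (simp add: weight_add weight_scaleR alpha_eq_weight[symmetric])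
    have mono: "F 0 \<le> F t"
      by (rule DERIV_nonneg_imp_nondecreasing[OF t]) (use F f0 in auto)
    have "emeasure (M J) (region J (weight \<alpha> l + t *\<^sub>R \<alpha> i)) = emeasure (M J) (region J (weight \<alpha> l)) + ennreal (F t - F 0)"
    proof (rule region_shift[OF i t _ F _ f0 fm])
      show "0 \<le> weight \<alpha> l \<bullet> \<alpha> i" using l0[OF i] by (simp add: weight_inner_nonneg)
      fix u assume "u \<in> {0..t}"
      then show "emeasure (M (J - {i})) (region (J - {i}) (weight \<alpha> l + u *\<^sub>R \<alpha> i)) = ennreal (f u)"
        unfolding w[symmetric] emeasure_region using f by simp
    qed
    then have "ennreal (region_vol J (l + t *\<^sub>R C $ i)) = ennreal (region_vol J l + (F t - F 0))"
      unfolding w[symmetric] emeasure_region using mono by (subst ennreal_plus) (auto simp: region_vol_def)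
    then have "region_vol J (l + t *\<^sub>R C $ i) = region_vol J l + (F t - F 0)"
      using mono by (subst (asm) ennreal_inj) (auto simp: region_vol_def)
    then show ?thesis by (simp add: d_def F_def)
  qed
  have shift: "d (l + t *\<^sub>R C $ i) = d l"
    if "i \<in> J" "\<And>j. j \<in> J \<Longrightarrow> 0 \<le> l $ j" "\<And>j. j \<in> J \<Longrightarrow> 0 \<le> (l + t *\<^sub>R C $ i) $ j" for i t l
  proof (cases "0 \<le> t")
    case True
    then show ?thesis using shift_pos that by blast
  next
    case False
    then show ?thesis using shift_pos[of i "- t" "l + t *\<^sub>R C $ i"] that by simp
  qed
  have dcong: "d l = d l'" if "\<And>j. j \<in> J \<Longrightarrow> l $ j = l' $ j" for l l'
    using region_vol_cong[of J l l'] peval_cong[OF vpoly_vars[of J], of l l'] that by (simp add: d_def)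
  have Jne: "J \<noteq> {}" using Suc(2) by auto
  have interior: "d l = 0" if l: "\<And>j. j \<in> J \<Longrightarrow> 0 < l $ j" for l
  proof -
    \<comment> \<open>The coordinates of \<open>l\<close> in the rows of \<open>C\<close> restricted
      to \<open>J\<close>: moving by \<open>- e * m i\<close> along every row multiplies
      \<open>l\<close> by \<open>1 - e\<close> on \<open>J\<close>.\<close>
    define m where "m i = (\<Sum>k\<in>J. l $ k * mu J k i)" for i
    define T where "T = (\<Sum>j\<in>J. \<Sum>i\<in>J. \<bar>m i * C $ i $ j\<bar>)"
    \<comment> \<open>\<open>T\<close> bounds every coordinate of every partial sum of the moves, so
      this size keeps all intermediate points nonnegative; the bound 1/2 keeps \<open>1 - e\<close>
      positive.\<close>
    define e where "e = min (1 / 2) (Min ((\<lambda>j. l $ j) ` J) / (1 + T))"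
    have T0: "0 \<le> T" unfolding T_def by (intro sum_nonneg) auto
    have mp: "0 < Min ((\<lambda>j. l $ j) ` J)" using Jne l by (subst Min_gr_iff) auto
    have e: "0 < e" "e < 1" using mp T0 by (auto simp: e_def)
    have eT: "e * T \<le> l $ j" if "j \<in> J" for j
    proof -
      have "e * T \<le> e * (1 + T)" using e by (intro mult_left_mono) auto
      also have "\<dots> \<le> Min ((\<lambda>j. l $ j) ` J) / (1 + T) * (1 + T)"
        using T0 by (intro mult_right_mono) (auto simp: e_def)
      also have "\<dots> = Min ((\<lambda>j. l $ j) ` J)" using T0 by simp
      also have "\<dots> \<le> l $ j" using that by (intro Min_le) auto
      finally show ?thesis .
    qed
    \<comment> \<open>The point reached after the moves indexed by \<open>K\<close>, so that one
      index at a time can be inserted.\<close>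
    define q where "q K = l - e *\<^sub>R (\<Sum>i\<in>K. m i *\<^sub>R C $ i)" for K
    have qpos: "0 \<le> q K $ j" if "K \<subseteq> J" "j \<in> J" for K j
    proof -
      have "(\<Sum>i\<in>K. m i * C $ i $ j) \<le> (\<Sum>i\<in>K. \<bar>m i * C $ i $ j\<bar>)" by (intro sum_mono) auto
      also have "\<dots> \<le> (\<Sum>i\<in>J. \<bar>m i * C $ i $ j\<bar>)" using that by (intro sum_mono2) auto
      also have "\<dots> \<le> T" unfolding T_def using that by (intro member_le_sum) (auto intro: sum_nonneg)
      finally have "e * (\<Sum>i\<in>K. m i * C $ i $ j) \<le> e * T" using e by (intro mult_left_mono) auto
      then show ?thesis using eT[OF that(2)] by (simp add: q_def)
    qed
    have "finite K \<Longrightarrow> K \<subseteq> J \<Longrightarrow> d (q K) = d l" for K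
    proof (induction K rule: finite_induct)
      case empty
      then show ?case by (simp add: q_def)
    next
      case (insert i K)
      have qi: "q (insert i K) = q K + (- e * m i) *\<^sub>R C $ i"
        using insert(1,2) by (simp add: q_def algebra_simps)
      have "d (q K + (- e * m i) *\<^sub>R C $ i) = d (q K)"
      proof (rule shift)
        show "0 \<le> q K $ j" if "j \<in> J" for j using qpos insert(4) that by auto
        show "0 \<le> (q K + (- e * m i) *\<^sub>R C $ i) $ j" if "j \<in> J" for j
          using qpos[OF insert(4) that] unfolding qi .
      qed (use insert in auto)
      then show ?case using insert qi by auto
    qed
    then have "d (q J) = d l" by simp
    moreover have "d (q J) = d ((1 - e) *\<^sub>R l)"
    proof (rule dcong)
      fix j assume j: "j \<in> J"
      have "(\<Sum>i\<in>J. m i * C $ i $ j) = (\<Sum>k\<in>J. l $ k * (\<Sum>i\<in>J. mu J k i * C $ i $ j))"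
        unfolding m_def sum_distrib_left sum_distrib_right by (subst sum.swap) (simp add: mult.assoc)
      also have "\<dots> = (\<Sum>k\<in>J. if k = j then l $ j else 0)"
        by (rule sum.cong) (auto simp: left_inv j)
      finally show "q J $ j = ((1 - e) *\<^sub>R l) $ j" using j by (simp add: q_def algebra_simps)
    qed
    moreover have "d ((1 - e) *\<^sub>R l) = (1 - e) ^ card J * d l"
      using e region_vol_scale[of "1 - e" J l] homogeneous_peval_scaleR[OF vpoly_homogeneous, of J "1 - e" l]
      by (simp add: d_def algebra_simps)
    ultimately have "(1 - (1 - e) ^ card J) * d l = 0" by (simp add: algebra_simps)
    \<comment> \<open>Positivity of the degree enters here, through
      \<open>card J = Suc r\<close>.\<close>
    moreover have "(1 - e) ^ card J < 1" unfolding Suc(2)[symmetric] using e by (intro power_Suc_less_one) auto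
    ultimately show ?thesis by simp
  qed
  \<comment> \<open>Approaching from above gives strictly positive coordinates and a decreasing
    sequence of regions of finite measure, so continuity from above applies.\<close>
  define k where "k n = l + (\<chi> i. 1 / real (Suc n))" for n
  have kpos: "0 < k n $ j" if "j \<in> J" for n j using Suc(3)[OF that] by (simp add: k_def add_nonneg_pos)
  have "region_vol J (k n) = peval (vpoly J) (k n)" for n using interior[OF kpos] by (simp add: d_def)
  moreover have "(\<lambda>n. peval (vpoly J) (k n)) \<longlonglongrightarrow> peval (vpoly J) l"
  proof (rule continuous_on_tendsto_compose[OF peval_continuous])
    have "(\<lambda>n. k n $ i) \<longlonglongrightarrow> l $ i" for i
      using tendsto_add[OF tendsto_const LIMSEQ_inverse_real_of_nat, of "l $ i"] by (simp add: k_def inverse_eq_divide)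
    then show "k \<longlonglongrightarrow> l" by (intro vec_tendstoI) auto
  qed auto
  moreover have "(\<lambda>n. region_vol J (k n)) \<longlonglongrightarrow> region_vol J l"
  proof -
    let ?A = "\<lambda>n. region J (weight \<alpha> (k n))"
    have mem: "y \<in> region J (weight \<alpha> v) \<longleftrightarrow> y \<in> rcone J \<and> (\<forall>j\<in>J. y \<bullet> \<alpha> j \<le> v $ j * (\<alpha> j \<bullet> \<alpha> j) / 2)" for y v
      by (simp add: region_def dominant_def inner_diff_left weight_inner)
    have "(\<lambda>n. measure (M J) (?A n)) \<longlonglongrightarrow> measure (M J) (\<Inter>n. ?A n)"
    proof (rule Lim_measure_decseq)
      show "range ?A \<subseteq> sets (M J)" by auto
      show "decseq ?A"
      proof (intro decseq_SucI subsetI)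
        fix n y assume y: "y \<in> ?A (Suc n)"
        have "k (Suc n) $ j * (\<alpha> j \<bullet> \<alpha> j) / 2 \<le> k n $ j * (\<alpha> j \<bullet> \<alpha> j) / 2" for j
          by (intro divide_right_mono mult_right_mono) (auto simp: k_def field_simps)
        then show "y \<in> ?A n" using y unfolding mem by (meson order_trans)
      qed
      show "emeasure (M J) (?A n) \<noteq> \<infinity>" for n using region_finite[of J "weight \<alpha> (k n)"] by simp
    qed
    moreover have "(\<Inter>n. ?A n) = region J (weight \<alpha> l)"
    proof (intro equalityI subsetI)
      fix y assume y: "y \<in> (\<Inter>n. ?A n)"
      have "y \<bullet> \<alpha> j \<le> l $ j * (\<alpha> j \<bullet> \<alpha> j) / 2" if "j \<in> J" for j
      proof (rule LIMSEQ_le_const)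
        have "(\<lambda>n. (l $ j + inverse (real (Suc n))) * (\<alpha> j \<bullet> \<alpha> j) / 2) \<longlonglongrightarrow> (l $ j + 0) * (\<alpha> j \<bullet> \<alpha> j) / 2"
          by (intro tendsto_intros LIMSEQ_inverse_real_of_nat) auto
        then show "(\<lambda>n. k n $ j * (\<alpha> j \<bullet> \<alpha> j) / 2) \<longlonglongrightarrow> l $ j * (\<alpha> j \<bullet> \<alpha> j) / 2"
          by (simp add: k_def inverse_eq_divide)
        show "\<exists>N. \<forall>n\<ge>N. y \<bullet> \<alpha> j \<le> k n $ j * (\<alpha> j \<bullet> \<alpha> j) / 2" using y that by (auto simp: mem)
      qed
      then show "y \<in> region J (weight \<alpha> l)" using y by (auto simp: mem)
    next
      fix y assume y: "y \<in> region J (weight \<alpha> l)"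
      have "l $ j * (\<alpha> j \<bullet> \<alpha> j) / 2 \<le> k n $ j * (\<alpha> j \<bullet> \<alpha> j) / 2" for n j
        by (intro divide_right_mono mult_right_mono) (auto simp: k_def)
      then show "y \<in> (\<Inter>n. ?A n)" using y unfolding mem by (auto simp: mem) (meson order_trans)
    qed
    ultimately show ?thesis by (simp add: region_vol_def)
  qed
  ultimately show ?case by (simp add: LIMSEQ_unique)
qed

section \<open>Volumes of weight polytopes\<close>


lemma W_fixes_orthogonal:
  assumes "w \<in> W J" "\<And>j. j \<in> J \<Longrightarrow> z \<bullet> \<alpha> j = 0" shows "w z = z"
proof -
  have "set js \<subseteq> J \<Longrightarrow> wprod js z = z" for js
    using assms(2) by (induction js) (auto simp: refl_along_def inner_coroot)
  then show ?thesis using assms(1) by (auto simp: W_def)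
qed

text \<open>The part of a weight orthogonal to the roots of \<open>J\<close> is fixed by the group,
  so it only translates the polytope and can be split off.\<close>

lemma polytope_translate:
  assumes "\<And>j. j \<in> J \<Longrightarrow> z \<bullet> \<alpha> j = 0"
  shows "polytope J (z + y) = (+) z ` polytope J y"
proof -
  have "w (z + y) = z + w y" if "w \<in> W J" for w
    using W_fixes_orthogonal[OF that assms] linear_add[OF W_props(1)[OF that]] by simp
  then have "(\<lambda>w. w (z + y)) ` W J = (+) z ` (\<lambda>w. w y) ` W J"
    unfolding image_image by (rule image_cong[OF refl])
  then show ?thesis unfolding polytope_def by (simp only: convex_hull_translation)
qed

lemma W_fixes_simple_imp_id:
  assumes "w \<in> W J" "\<And>j. j \<in> J \<Longrightarrow> w (\<alpha> j) = \<alpha> j" shows "w = id"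
proof
  fix v
  obtain y z where y: "y \<in> span (\<alpha> ` J)" and z: "\<And>u. u \<in> span (\<alpha> ` J) \<Longrightarrow> orthogonal z u" and v: "v = y + z"
    using orthogonal_subspace_decomp_exists[of "\<alpha> ` J" v] by blast
  have "w z = z"
    by (rule W_fixes_orthogonal[OF assms(1)]) (use z in \<open>auto simp: orthogonal_def intro: span_base\<close>)
  moreover have "w y = id y"
    by (rule linear_eq_on[OF W_props(1)[OF assms(1)] linear_id[folded id_def] y]) (use assms(2) in auto)
  ultimately show "w v = id v" by (simp add: v linear_add[OF W_props(1)[OF assms(1)]])
qed

lemma W_span_image:
  assumes "w \<in> W J" shows "w ` span (\<alpha> ` J) = span (\<alpha> ` J)"
proof -
  obtain w' where w': "w' \<in> W J" "\<And>v. w (w' v) = v" using W_inverse[OF assms] by metis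
  show ?thesis
  proof (intro equalityI subsetI)
    fix v assume "v \<in> span (\<alpha> ` J)"
    then have "w' v \<in> span (\<alpha> ` J)" using W_props(5)[OF w'(1)] by blast
    then show "v \<in> w ` span (\<alpha> ` J)" using w'(2)[of v] by (metis image_eqI)
  qed (use W_props(5)[OF assms] in auto)
qed

text \<open>The preimages of the dominant part cover the polytope and have equal measure because the
  group acts by isometries of the span. A point in two of them is fixed by a nontrivial element,
  since dominant representatives are unique; such an element moves some \<alpha> j, so its fixed
  space is null.\<close>

lemma emeasure_polytope:
  "emeasure (M J) (polytope J x) = of_nat (card (W J)) * emeasure (M J) (polytope J x \<inter> dominant J)"
proof -
  let ?S = "polytope J x \<inter> dominant J"
  have S [measurable]: "?S \<in> sets borel"
    by (intro borel_closed closed_Int compact_imp_closed[OF compact_polytope] closed_dominant)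
  have P [measurable]: "polytope J x \<in> sets borel"
    using compact_polytope by (intro borel_closed compact_imp_closed)
  have wS: "w -` ?S \<in> sets borel" if "w \<in> W J" for w
  proof -
    have "w \<in> borel_measurable borel"
      using W_props(1)[OF that] by (intro borel_measurable_continuous_onI linear_continuous_on) (simp add: linear_linear)
    then show ?thesis using measurable_sets[of w borel borel ?S] S by simp
  qed
  define N where "N = (\<Union>u\<in>W J - {id}. {v. u v = v})"
  have fix_null: "{v. u v = v} \<in> null_sets (M J)" if u: "u \<in> W J - {id}" for u
  proof -
    have lin: "linear u" using W_props(1) u by blast
    have sub: "subspace {v. u v = v}"
      by (auto simp: subspace_def linear_0[OF lin] linear_add[OF lin] linear_scale[OF lin])
    obtain j where "j \<in> J" "u (\<alpha> j) \<noteq> \<alpha> j" using W_fixes_simple_imp_id[of u J] u by auto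
    then have "emeasure (M J) {v. u v = v} = 0"
      by (intro span_measure_subspace_null[OF _ sub, of _ "\<alpha> j"]) auto
    then show ?thesis using sub by (auto simp: null_sets_def borel_closed closed_subspace)
  qed
  have "N \<in> null_sets (M J)" unfolding N_def by (intro null_sets.finite_UN fix_null) (auto simp: finite_W)
  then have AE: "AE p in M J. p \<notin> N" by (rule AE_not_in)
  have ind: "indicator (polytope J x) p = (\<Sum>w\<in>W J. indicator (w -` ?S) p :: ennreal)" if p: "p \<notin> N" for p
  proof (cases "p \<in> polytope J x")
    case False
    then have "w \<in> W J \<Longrightarrow> p \<notin> w -` ?S" for w using polytope_union by blast
    then have "(\<Sum>w\<in>W J. indicator (w -` ?S) p :: ennreal) = 0" by (intro sum.neutral) auto
    then show ?thesis using False by simp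
  next
    case True
    then obtain w where w: "w \<in> W J" "p \<in> w -` ?S" using polytope_union[of J x] by auto
    have uniq: "u = w" if u: "u \<in> W J" "p \<in> u -` ?S" for u
    proof (rule ccontr)
      assume ne: "u \<noteq> w"
      obtain w' where w': "w' \<in> W J" "\<And>v. w' (w v) = v" "\<And>v. w (w' v) = v" using W_inverse[OF w(1)] by metis
      have "u (w' (w p)) = w p"
        using dominant_orbit_unique[OF W_comp[OF u(1) w'(1)], of "w p"] u(2) w w'(2) by simp
      then have "(w' \<circ> u) p = p" using w'(2) by simp
      moreover have "w' \<circ> u \<noteq> id"
      proof
        assume "w' \<circ> u = id"
        then have "u v = w v" for v using w'(3)[of "u v"] by (metis comp_apply id_apply)
        then show False using ne by auto
      qed
      ultimately have "p \<in> N" unfolding N_def using W_comp[OF w'(1) u(1)] by (intro UN_I[of "w' \<circ> u"]) auto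
      then show False using p by simp
    qed
    have "(\<Sum>u\<in>W J. indicator (u -` ?S) p :: ennreal) = (\<Sum>u\<in>W J. if u = w then 1 else 0)"
    proof (intro sum.cong refl)
      fix u assume u: "u \<in> W J"
      show "(indicator (u -` ?S) p :: ennreal) = (if u = w then 1 else 0)"
      proof (cases "u = w")
        case True
        have "(indicator (w -` ?S) p :: ennreal) = 1" using w(2) by (rule indicator_simps(1))
        then show ?thesis unfolding True by simp
      next
        case False
        then have "p \<notin> u -` ?S" using uniq[OF u] by blast
        then have "(indicator (u -` ?S) p :: ennreal) = 0" by (rule indicator_simps(2))
        then show ?thesis using False by simp
      qed
    qed
    also have "\<dots> = 1" using w(1) finite_W by simp
    finally show ?thesis using True by simp
  qed
  have "emeasure (M J) (polytope J x) = (\<integral>\<^sup>+p. indicator (polytope J x) p \<partial>M J)" by simp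
  also have "\<dots> = (\<integral>\<^sup>+p. (\<Sum>w\<in>W J. indicator (w -` ?S) p) \<partial>M J)"
    by (rule nn_integral_cong_AE, rule eventually_mono[OF AE]) (rule ind)
  also have "\<dots> = (\<Sum>w\<in>W J. emeasure (M J) (w -` ?S))"
    using wS by (subst nn_integral_sum) auto
  also have "\<dots> = (\<Sum>w\<in>W J. emeasure (M J) ?S)"
    by (rule sum.cong[OF refl], rule span_measure_isometry[OF independent_alpha_image _ _ _ S])
       (auto simp: W_props W_span_image)
  finally show ?thesis by simp
qed

text \<open>The two sets are exchanged by the point reflection that sends \<open>y\<close> to
  \<open>x - y\<close>, here a negation composed with a translation by \<open>x\<close>. The
  translation preserves the measure because \<open>x\<close> lies in the span.\<close>

lemma emeasure_polytope_dominant: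
  assumes x: "x \<in> dominant J" "x \<in> span (\<alpha> ` J)"
  shows "emeasure (M J) (polytope J x \<inter> dominant J) = emeasure (M J) (region J x)"
proof -
  have T: "{y. y + x \<in> region J x} \<in> sets borel"
  proof -
    have "closed ((\<lambda>y. y + x) -` region J x)"
      by (rule closed_vimage[OF closed_region]) (intro continuous_intros)
    then show ?thesis by (auto simp: vimage_def)
  qed
  have "polytope J x \<inter> dominant J = uminus -` {y. y + x \<in> region J x}"
    unfolding polytope_dominant[OF x(1)] by (auto simp: region_def)
  moreover have "emeasure (M J) (uminus -` {y. y + x \<in> region J x}) = emeasure (M J) {y. y + x \<in> region J x}"
  proof (rule span_measure_isometry[OF independent_alpha_image _ _ _ T])
    show "linear (uminus :: 'a \<Rightarrow> 'a)" by (rule linearI) auto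
    show "uminus ` span (\<alpha> ` J) = span (\<alpha> ` J)"
      by (auto simp: image_iff intro: span_neg) (metis minus_minus span_neg)
  qed auto
  ultimately show ?thesis using span_measure_translate[OF _ x(2) borel_region, of J x] by simp
qed

section \<open>The weight lattice inside the span of a set of simple roots\<close>

lemma lattice_weight_basis:
  "\<exists>B. lattice_basis (weight_lattice \<alpha> \<inter> span (\<alpha> ` J)) B"
proof -
  have inj: "inj (fund_weight \<alpha>)"
    by (rule injI) (metis fund_weight_pairing zero_neq_one)
  have ind: "independent (range (fund_weight \<alpha>))"
  proof (rule independent_if_scalars_zero)
    fix f v assume f: "(\<Sum>x\<in>range (fund_weight \<alpha>). f x *\<^sub>R x) = 0" and "v \<in> range (fund_weight \<alpha>)"
    then obtain i where i: "v = fund_weight \<alpha> i" by blast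
    have "0 = (\<Sum>k\<in>UNIV. f (fund_weight \<alpha> k) *\<^sub>R fund_weight \<alpha> k) \<bullet> coroot (\<alpha> i)"
      using f by (simp add: sum.reindex[OF inj])
    also have "\<dots> = (\<Sum>k\<in>UNIV. if k = i then f v else 0)"
      unfolding inner_sum_left by (rule sum.cong) (auto simp: fund_weight_pairing i)
    finally show "f v = 0" by simp
  qed simp
  have "0 \<in> weight_lattice \<alpha>"
    unfolding weight_lattice_def by (rule range_eqI[of _ _ "\<lambda>_. 0"]) simp
  moreover have "x - y \<in> weight_lattice \<alpha>" if xy: "x \<in> weight_lattice \<alpha>" "y \<in> weight_lattice \<alpha>" for x y
  proof -
    obtain c d :: "'n \<Rightarrow> int" where "x = (\<Sum>i\<in>UNIV. of_int (c i) *\<^sub>R fund_weight \<alpha> i)"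
      "y = (\<Sum>i\<in>UNIV. of_int (d i) *\<^sub>R fund_weight \<alpha> i)" using xy by (auto simp: weight_lattice_def)
    then have "x - y = (\<Sum>i\<in>UNIV. of_int (c i - d i) *\<^sub>R fund_weight \<alpha> i)"
      by (simp add: scaleR_left_diff_distrib sum_subtractf)
    then show ?thesis unfolding weight_lattice_def by (rule range_eqI[of _ _ "\<lambda>i. c i - d i"])
  qed
  ultimately show ?thesis
    by (intro lattice_basis_exists[OF finite inj ind])
       (auto simp: span_zero span_diff, auto simp: weight_lattice_def)
qed

text \<open>Integrality of the Cartan matrix. It gives the lattice in the span of \<open>J\<close>
  full rank.\<close>

lemma alpha_in_weight_lattice: "\<alpha> j \<in> weight_lattice \<alpha>"
proof -
  have "\<exists>z. C $ j $ i = of_int z" for i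
  proof -
    have "C $ j $ i \<in> \<int>" using roots alpha_root by (auto simp: root_system_def cartan_matrix_def)
    then show ?thesis by (auto elim: Ints_cases)
  qed
  then obtain c where c: "\<And>i. C $ j $ i = of_int (c i)" by metis
  have "\<alpha> j = (\<Sum>i\<in>UNIV. of_int (c i) *\<^sub>R fund_weight \<alpha> i)"
    by (subst alpha_eq_weight) (simp add: weight_def c)
  then show ?thesis unfolding weight_lattice_def by (rule range_eqI[of _ _ c])
qed

lemma lattice_basis_span:
  assumes "lattice_basis (weight_lattice \<alpha> \<inter> span (\<alpha> ` J)) B"
  shows "span B = span (\<alpha> ` J)"
proof
  have fin: "finite B" and G: "weight_lattice \<alpha> \<inter> span (\<alpha> ` J) = range (\<lambda>c::'a \<Rightarrow> int. \<Sum>b\<in>B. of_int (c b) *\<^sub>R b)"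
    using assms by (auto simp: lattice_basis_def)
  have "B \<subseteq> span (\<alpha> ` J)"
  proof
    fix b assume b: "b \<in> B"
    have "(\<Sum>b'\<in>B. of_int (if b' = b then 1 else 0) *\<^sub>R b') = (\<Sum>b'\<in>B. if b' = b then b else 0)"
      by (rule sum.cong) auto
    also have "\<dots> = b" using fin b by simp
    finally have "b = (\<Sum>b'\<in>B. of_int (if b' = b then 1 else 0) *\<^sub>R b')" by simp
    then have "b \<in> range (\<lambda>c::'a \<Rightarrow> int. \<Sum>b\<in>B. of_int (c b) *\<^sub>R b)"
      by (rule range_eqI[of _ _ "\<lambda>b'. if b' = b then 1 else 0"])
    then show "b \<in> span (\<alpha> ` J)" unfolding G[symmetric] by simp
  qed
  then show "span B \<subseteq> span (\<alpha> ` J)" by (intro span_minimal) auto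
  have "\<alpha> j \<in> span B" if "j \<in> J" for j
  proof -
    have "\<alpha> j \<in> weight_lattice \<alpha> \<inter> span (\<alpha> ` J)" using that alpha_in_weight_lattice by (auto intro: span_base)
    then obtain c :: "'a \<Rightarrow> int" where "\<alpha> j = (\<Sum>b\<in>B. of_int (c b) *\<^sub>R b)" unfolding G by blast
    then show ?thesis by (simp only:) (intro span_sum span_scale span_base)
  qed
  then show "span (\<alpha> ` J) \<subseteq> span B" by (intro span_minimal) auto
qed

lemma direction_space_eq:
  assumes "a \<in> P" shows "direction_space P = span ((+) (- a) ` P)"
proof -
  let ?S = "span ((+) (- a) ` P)"
  have a: "affine hull P = (+) a ` ?S"
    using affine_hull_span_gen[of a P] assms by (simp add: hull_inc)
  show ?thesis
  proof (intro equalityI subsetI)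
    fix v assume "v \<in> direction_space P"
    then obtain p q where "p \<in> ?S" "q \<in> ?S" "v = (a + p) - (a + q)" unfolding direction_space_def a by auto
    then show "v \<in> ?S" using span_diff[of p _ q] by simp
  next
    fix v assume "v \<in> ?S"
    then have "a + v \<in> affine hull P" "a + 0 \<in> affine hull P"
      unfolding a by (auto intro!: imageI span_zero simp del: add_0_right)
    then show "v \<in> direction_space P" unfolding direction_space_def
      by (intro CollectI exI[of _ "a + v"] exI[of _ "a + 0"]) auto
  qed
qed

text \<open>For full-dimensional polytopes the direction space is always the span of
  \<open>J\<close>, so one lattice basis, and hence one factor, serves all \<open>y\<close> and
  \<open>z\<close>. In smaller dimension both sides are zero.\<close>

lemma lattice_volume_eq_span_measure:
  obtains \<kappa> where "\<kappa> > 0"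
    "\<And>y z. y \<in> span (\<alpha> ` J) \<Longrightarrow> (\<And>j. j \<in> J \<Longrightarrow> z \<bullet> \<alpha> j = 0) \<Longrightarrow>
      lattice_volume (weight_lattice \<alpha>) (card J) (polytope J (z + y)) = \<kappa> * measure (M J) (polytope J y)"
proof -
  let ?U = "span (\<alpha> ` J)"
  \<comment> \<open>The very choice made by \<open>lattice_volume\<close> in the full-dimensional
    case; existence of a lattice basis makes it a genuine one.\<close>
  define B where "B = (SOME B. lattice_basis (weight_lattice \<alpha> \<inter> ?U) B)"
  have B: "lattice_basis (weight_lattice \<alpha> \<inter> ?U) B" unfolding B_def by (rule someI_ex[OF lattice_weight_basis])
  then have Bind: "independent B" and Bfin: "finite B" by (auto simp: lattice_basis_def)
  have Bsp: "span (\<alpha> ` J) = span B" using lattice_basis_span[OF B] by simp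
  obtain \<kappa> where \<kappa>: "\<kappa> > 0"
    "\<And>S. S \<in> sets borel \<Longrightarrow> emeasure (span_measure B) S = ennreal \<kappa> * emeasure (M J) S"
    using span_measure_unique[OF independent_alpha_image Bind Bsp] by blast
  have dimU: "dim ?U = card J"
    using dim_eq_card_independent[OF independent_alpha_image, of J] inj_alpha by (simp add: card_image inj_on_subset)
  have "lattice_volume (weight_lattice \<alpha>) (card J) (polytope J (z + y)) = \<kappa> * measure (M J) (polytope J y)"
    if y: "y \<in> ?U" and z: "\<And>j. j \<in> J \<Longrightarrow> z \<bullet> \<alpha> j = 0" for y z
  proof -
    let ?Q = "polytope J y" and ?P = "polytope J (z + y)"
    have P: "?P = (+) z ` ?Q" by (rule polytope_translate[OF z])
    have P0: "?Q \<subseteq> ?U"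
      unfolding polytope_def by (rule hull_minimal) (use W_props(5) y in \<open>auto simp: subspace_imp_convex\<close>)
    have P0b: "?Q \<in> sets borel" using compact_polytope by (intro borel_closed compact_imp_closed)
    let ?a = "SOME a. a \<in> ?P"
    have aP: "?a \<in> ?P" by (rule someI[of _ "z + y"]) (rule polytope_nonempty)
    define a where "a = ?a"
    have a: "a \<in> ?P" using aP by (simp add: a_def)
    define S where "S = span ((+) (- a) ` ?P)"
    have dS: "direction_space ?P = S" unfolding S_def by (rule direction_space_eq[OF a])
    have aff: "aff_dim ?P = int (dim S)" unfolding S_def using aff_dim_eq_dim[of a ?P] a by (simp add: hull_inc)
    obtain a0 where a0: "a = z + a0" "a0 \<in> ?Q" using a P by auto
    have SU: "S \<subseteq> ?U" unfolding S_def
    proof (rule span_minimal)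
      show "(+) (- a) ` ?P \<subseteq> ?U"
      proof
        fix v assume "v \<in> (+) (- a) ` ?P"
        then obtain p where "p \<in> ?Q" "v = p - a0" unfolding P a0(1) by auto
        then show "v \<in> ?U" using P0 a0(2) by (auto intro: span_diff)
      qed
    qed simp
    show ?thesis
    proof (cases "dim S = card J")
      case True
      then have SeqU: "S = ?U" using SU dimU by (intro subspace_dim_equal) (auto simp: S_def)
      have sh: "{v. v + a0 \<in> ?Q} \<in> sets borel"
      proof -
        have "closed ((\<lambda>v. v + a0) -` ?Q)"
          by (rule closed_vimage[OF compact_imp_closed[OF compact_polytope]]) (intro continuous_intros)
        then show ?thesis by (auto simp: vimage_def)
      qed
      have in_iff: "a + v \<in> ?P \<longleftrightarrow> v + a0 \<in> ?Q" for v
        unfolding P a0(1) by (auto simp: image_iff algebra_simps)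
      have "lattice_volume (weight_lattice \<alpha>) (card J) ?P
          = measure (Pi\<^sub>M B (\<lambda>_. lborel)) {c \<in> Pi\<^sub>E B (\<lambda>_. UNIV). a + (\<Sum>b\<in>B. c b *\<^sub>R b) \<in> ?P}"
        unfolding lattice_volume_def aff dS SeqU using True dimU
        by (simp add: Let_def B_def[symmetric] a_def[symmetric])
      also have "\<dots> = measure (span_measure B) {v. v + a0 \<in> ?Q}"
        unfolding measure_def emeasure_span_measure[OF sh] in_iff by simp
      also have "\<dots> = \<kappa> * measure (M J) {v. v + a0 \<in> ?Q}"
        unfolding measure_def \<kappa>(2)[OF sh] using \<kappa>(1) by (simp add: enn2real_mult)
      also have "measure (M J) {v. v + a0 \<in> ?Q} = measure (M J) ?Q"
        unfolding measure_def using span_measure_translate[of "\<alpha> ` J" a0 ?Q] a0(2) P0 P0b by auto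
      finally show ?thesis .
    next
      case False
      have "S \<subset> ?U" using SU False dimU by auto
      \<comment> \<open>The polytope lies in a translate of a proper subspace, so its measure agrees
        with the default value 0 of the lattice volume.\<close>
      have "?Q \<subseteq> (+) a0 ` S"
      proof
        fix p assume "p \<in> ?Q"
        then have "p - a0 \<in> S" unfolding S_def P a0(1) by (intro span_base) (auto simp: image_iff)
        then show "p \<in> (+) a0 ` S" by (auto simp: image_iff) (metis diff_add_cancel add.commute)
      qed
      moreover have "emeasure (M J) ((+) a0 ` S) = 0"
        using \<open>S \<subset> ?U\<close> a0(2) P0 by (intro span_measure_affine_null[OF independent_alpha_image]) (auto simp: S_def)
      moreover have "(+) a0 ` S \<in> sets borel"
        by (intro borel_closed closed_translation closed_subspace) (simp add: S_def)
      ultimately have "emeasure (M J) ?Q = 0"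
        by (metis emeasure_mono le_zero_eq sets_span_measure)
      then have "measure (M J) ?Q = 0" by (simp add: measure_def)
      moreover have "lattice_volume (weight_lattice \<alpha>) (card J) ?P = 0"
        unfolding lattice_volume_def aff using False by simp
      ultimately show ?thesis by simp
    qed
  qed
  then show ?thesis using that \<kappa>(1) by blast
qed

text \<open>The constructed multiple satisfies the description of \<open>vol_poly\<close>, and
  values on the positive orthant leave no other candidate.\<close>

lemma vol_poly_eq: "\<exists>c. c \<noteq> 0 \<and> vol_poly \<alpha> J = c *\<^sub>R vpoly J"
proof -
  obtain \<kappa> where \<kappa>: "\<kappa> > 0"
    "\<And>y z. y \<in> span (\<alpha> ` J) \<Longrightarrow> (\<And>j. j \<in> J \<Longrightarrow> z \<bullet> \<alpha> j = 0) \<Longrightarrow>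
      lattice_volume (weight_lattice \<alpha>) (card J) (polytope J (z + y)) = \<kappa> * measure (M J) (polytope J y)"
    using lattice_volume_eq_span_measure[of J] by blast
  \<comment> \<open>The change from root coordinates to lattice coordinates, times one copy of the
    dominant part for each group element.\<close>
  define c where "c = \<kappa> * real (card (W J))"
  have "card (W J) > 0" using finite_W W_id by (auto simp: card_gt_0_iff)
  then have c0: "c \<noteq> 0" using \<kappa>(1) by (simp add: c_def)
  have vol: "lattice_volume (weight_lattice \<alpha>) (card J) (weight_polytope \<alpha> J (weight \<alpha> l)) = peval (c *\<^sub>R vpoly J) l"
    if l: "\<forall>i. 0 \<le> l $ i" for l
  proof -
    let ?x = "weight \<alpha> l"
    \<comment> \<open>The orthogonal part \<open>z\<close> only translates the polytope, while
      \<open>y\<close> has the same pairings with the roots of \<open>J\<close> as the full weight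
      and hence the same region.\<close>
    obtain y z where y: "y \<in> span (\<alpha> ` J)" and z: "\<And>u. u \<in> span (\<alpha> ` J) \<Longrightarrow> orthogonal z u" and v: "?x = y + z"
      using orthogonal_subspace_decomp_exists[of "\<alpha> ` J" ?x] by blast
    have z0: "z \<bullet> \<alpha> j = 0" if "j \<in> J" for j using z[of "\<alpha> j"] that by (auto simp: orthogonal_def intro: span_base)
    then have xy: "?x \<bullet> \<alpha> j = y \<bullet> \<alpha> j" if "j \<in> J" for j using that by (simp add: v inner_add_left)
    have ydom: "y \<in> dominant J" unfolding dominant_def using xy l by (auto simp: weight_inner_nonneg simp flip: xy)
    have "emeasure (M J) (polytope J y) = of_nat (card (W J)) * emeasure (M J) (region J y)"
      using emeasure_polytope[of J y] emeasure_polytope_dominant[OF ydom y] by simp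
    also have "region J y = region J ?x" by (rule region_cong) (simp add: xy)
    finally have "measure (M J) (polytope J y) = real (card (W J)) * region_vol J l"
      unfolding measure_def region_vol_def by (simp add: enn2real_mult)
    moreover have "region_vol J l = peval (vpoly J) l" using l by (intro region_vol_eq) auto
    moreover have "?x = z + y" using v by simp
    ultimately show ?thesis
      using \<kappa>(2)[OF y z0] by (simp add: weight_polytope_eq peval_scaleR c_def)
  qed
  have "vol_poly \<alpha> J = c *\<^sub>R vpoly J"
    unfolding vol_poly_def
  proof (rule the_equality)
    show "pvars (c *\<^sub>R vpoly J) \<subseteq> J \<and> homogeneous (card J) (c *\<^sub>R vpoly J) \<and>
        (\<forall>l. (\<forall>i. 0 \<le> l $ i) \<longrightarrow> peval (c *\<^sub>R vpoly J) l =
            lattice_volume (weight_lattice \<alpha>) (card J) (weight_polytope \<alpha> J (weight \<alpha> l)))"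
      using vol pvars_scaleR[OF vpoly_vars[of J]] homogeneous_scaleR[OF vpoly_homogeneous[of J]] by simp
    fix p :: "'n rpoly"
    assume p: "pvars p \<subseteq> J \<and> homogeneous (card J) p \<and>
        (\<forall>l. (\<forall>i. 0 \<le> l $ i) \<longrightarrow> peval p l =
            lattice_volume (weight_lattice \<alpha>) (card J) (weight_polytope \<alpha> J (weight \<alpha> l)))"
    have "p - c *\<^sub>R vpoly J = 0"
    proof (rule peval_eq_0_on_orthant_imp_zero)
      fix x :: "real ^ 'n" assume "\<And>i. 0 < x $ i"
      then have "\<forall>i. 0 \<le> x $ i" by (simp add: less_imp_le)
      then show "peval (p - c *\<^sub>R vpoly J) x = 0" using p vol by (simp add: peval_diff)
    qed
    then show "p = c *\<^sub>R vpoly J" by simp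
  qed
  then show ?thesis using c0 by blast
qed

end

theorem theorem3p10:
  fixes \<Phi> :: "'a::euclidean_space set"
    and \<alpha> :: "'n::finite \<Rightarrow> 'a"
  assumes "irreducible_root_system \<Phi>"
    and "simple_roots \<Phi> \<alpha>"
  shows "is_basis_of {vol_poly \<alpha> J | J. J \<subseteq> UNIV} (Delta (cartan_matrix \<alpha>))
    \<and> dim (Delta (cartan_matrix \<alpha>)) = 2 ^ CARD('n)
    \<and> graded (Delta (cartan_matrix \<alpha>))
    \<and> Abs_fps (\<lambda>d. int (dim (graded_part (Delta (cartan_matrix \<alpha>)) d))) = (1 + fps_X) ^ CARD('n)
    \<and> (\<forall>d. is_basis_of {vol_poly \<alpha> J | J. card J = d} (graded_part (Delta (cartan_matrix \<alpha>)) d))"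
proof -
  interpret simple_system \<Phi> \<alpha>
    using assms by unfold_locales (auto simp: irreducible_root_system_def)
  obtain c where "\<And>J. c J \<noteq> 0" "\<And>J. vol_poly \<alpha> J = c J *\<^sub>R vpoly J"
    using vol_poly_eq by metis
  then show ?thesis by (rule Delta_structure)
qed

end
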